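(* Let $\kappa$ be an infinite regular cardinal or $\infty$. For ordinals $j\leqslant i$, the following are equivalent. (1) For all $a\in\nu^{(i)}\mathcal{P}_{<\kappa}$ we have $p_j a=\nu^{(i\geqslant j)}a$. (2) Either $j\leqslant\mathrm{FP}(i)$ or $\mathrm{LP}(i)$ is $\kappa$-extensible.
   Context: Work in ZFC. $0$ is deemed a limit ordinal. $\kappa$ is an infinite regular cardinal or the formal symbol $\infty$, which is greater than every ordinal and cardinal ("$\kappa<\infty$" means $\kappa$ is a cardinal). $\mathcal{P}_{<\kappa}X$ is the set of subsets of $X$ of cardinality $<\kappa$, a functor on $\mathbf{Set}$ via direct image; $\mathcal{P}=\mathcal{P}_{<\infty}$ is the powerset functor. Final chain of an endofunctor $F$ on $\mathbf{Set}$: sets $\nu^{(i)}F$ for all ordinals $i$, with functorial connecting maps $\nu^{(i\geqslant j)}:\nu^{(i)}F\to\nu^{(j)}F$ for $j\leqslant i$, determined by: $\nu^{(i+1)}F=F\nu^{(i)}F$ and $\nu^{(i+1\geqslant j+1)}=F\nu^{(i\geqslant j)}$; for $i$ a limit, $\nu^{(i)}F$ is the set of families $(x_j)_{j<i}$ with $x_j\in\nu^{(j)}F$ and $\nu^{(j\geqslant k)}x_j=x_k$ for $k\leqslant j<i$, and $\nu^{(i\geqslant j)}x=x_j$ for $j<i$. So $\nu^{(0)}F=\{()\}$, and $\nu^{(i)}\mathcal{P}_{<\kappa}\subseteq\nu^{(i)}\mathcal{P}$. Let $\mathrm{pred}(i+1)=i$ and $\mathrm{pred}(i)=i$ for $i$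 a limit. For $a\in\nu^{(i)}\mathcal{P}$ and $b\in\nu^{(\mathrm{pred}(i))}\mathcal{P}$, put $a\rightsquigarrow_i b$ iff $\nu^{(\mathrm{pred}(i)\geqslant j)}b\in\nu^{(i\geqslant j+1)}a$ for all $j<i$ (so for $i=k+1$: $b\in a$; for $i$ a limit: $b_j\in a_{j+1}$ for all $j<i$). If $a\in\nu^{(i)}\mathcal{P}_{<\kappa}$ then $b\in\nu^{(\mathrm{pred}(i))}\mathcal{P}_{<\kappa}$. A transition system is a set with a binary relation $\rightsquigarrow$. A pointed system is a transition system with a chosen element $x$, written just $x$. Each $a\in\nu^{(i)}\mathcal{P}$ is regarded as a pointed system, the ambient transition system being the disjoint union of the levels $\nu^{(k)}\mathcal{P}$ ($k\leqslant i$) with the relations $\rightsquigarrow_k$. For a pointed system $x$, $p_i x\in\nu^{(i)}\mathcal{P}$ is defined by $p_{i+1}x=\{p_i y\mid x\rightsquigarrow y\}$ and, for $i$ a limit, $p_i x=(p_j x)_{j<i}$. Every ordinal is uniquely $i=i'+m$ with $i'$ a limit and $m\in\mathbb{N}$; $\mathrm{LP}(i)=i'$ and $\mathrm{FP}(i)=m$. An ordinal is $\omega$-cofinal if it is the supremum of a strictly increasing sequence $(i_n)_{n\in\mathbb{N}}$. A tidy $\lambda$-tree is a functor $D:\lambda^{\mathrm{op}}\to\mathbf{Set}$ (levels $D_i$, connecting maps $D_i\to D_j$ for $j\leqslant i<\lambda$) such that all connecting maps are surjective, for each limit $i<\lambda$ every full branch of $(D_j)_{j<i}$ has at most one extension to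 a full branch of $(D_j)_{j\leqslant i}$, and $D_0$ is a singleton; a full branch is a compatible family $(x_i)_i$ with $x_i\in D_i$. A regular infinite cardinal $\lambda$ has the tree property when every tidy $\lambda$-tree with all levels of size $<\lambda$ has a full branch; it is strongly inaccessible when $|A|<\lambda$ implies $|\mathcal{P}A|<\lambda$ (so $\aleph_0$ qualifies); it is weakly compact when it is strongly inaccessible and has the tree property. The $\kappa$-extensible limit ordinals are: $0$; any $\omega$-cofinal ordinal; any weakly compact cardinal; any limit ordinal $\geqslant\kappa+\omega$, if $\kappa<\infty$; and $\kappa$ itself, if $\kappa<\infty$ and $\kappa$ has the tree property. *)

theory Defs
  imports Main
begin

unbundle cardinal_syntax

section \<open>The set-theoretic universe\<close>

text \<open>
  The final chain of the powerset functor has levels of size beth-i for every ordinal i, so it does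
  not live in any type that HOL can construct. As the ambient universe of ZFC sets we therefore take
  an arbitrary type satisfying the (second-order) ZFC axioms. Replacement ranges over all HOL
  functions; choice is inherited from HOL. Elements of such a type are called sets;
  \<open>elts x\<close> is the HOL set (class) of the elements of \<open>x\<close>.
\<close>

class zfc =
  fixes elts :: "'a \<Rightarrow> 'a set"
  assumes zfc_extensionality: "elts x = elts y \<Longrightarrow> x = y"
    and zfc_separation: "X \<subseteq> elts y \<Longrightarrow> X \<in> range elts"
    and zfc_pairing: "{x, y} \<in> range elts"
    and zfc_union: "(\<Union>y \<in> elts x. elts y) \<in> range elts"
    and zfc_power: "{y. elts y \<subseteq> elts x} \<in> range elts"
    and zfc_replacement: "f ` elts x \<in> range elts"
    and zfc_infinity: "\<exists>w. (\<exists>z \<in> elts w. elts z = {}) \<and>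
                          (\<forall>x \<in> elts w. \<exists>y \<in> elts w. elts y = insert x (elts x))"
    and zfc_foundation: "wf {(x, y). x \<in> elts y}"

definition small :: "'v::zfc set \<Rightarrow> bool" where
  "small X \<longleftrightarrow> X \<in> range elts"

text \<open>The set with a given class of elements; meaningful only for small classes.\<close>

definition vset :: "'v::zfc set \<Rightarrow> 'v" where
  "vset X = (THE x. elts x = X)"

definition vempty :: "'v::zfc" where
  "vempty = vset {}"

definition vpair :: "'v::zfc \<Rightarrow> 'v \<Rightarrow> 'v" where
  "vpair x y = vset {vset {x}, vset {x, y}}"

definition vpow :: "'v::zfc \<Rightarrow> 'v" where
  "vpow x = vset {y. elts y \<subseteq> elts x}"

definition dimage :: "('v::zfc \<Rightarrow> 'v) \<Rightarrow> 'v \<Rightarrow> 'v" where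
  "dimage f x = vset (f ` elts x)"

text \<open>The family \<open>(f j)\<close> indexed by the elements \<open>j\<close> of \<open>i\<close>, as a set-theoretic function.\<close>

definition family :: "'v::zfc \<Rightarrow> ('v \<Rightarrow> 'v) \<Rightarrow> 'v" where
  "family i f = vset ((\<lambda>j. vpair j (f j)) ` elts i)"

definition component :: "'v::zfc \<Rightarrow> 'v \<Rightarrow> 'v" where
  "component x j = (THE y. vpair j y \<in> elts x)"


section \<open>Ordinals and cardinals\<close>

text \<open>Ordinals are von Neumann ordinals, so that \<open>j < i\<close> is \<open>j \<in> elts i\<close>.\<close>

definition Ord :: "'v::zfc \<Rightarrow> bool" where
  "Ord i \<longleftrightarrow> (\<forall>j \<in> elts i. elts j \<subseteq> elts i) \<and> (\<forall>j \<in> elts i. \<forall>k \<in> elts j. elts k \<subseteq> elts j)"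

definition ord_le :: "'v::zfc \<Rightarrow> 'v \<Rightarrow> bool" where
  "ord_le j i \<longleftrightarrow> j \<in> elts i \<or> j = i"

definition vsucc :: "'v::zfc \<Rightarrow> 'v" where
  "vsucc i = vset (insert i (elts i))"

definition is_succ :: "'v::zfc \<Rightarrow> bool" where
  "is_succ i \<longleftrightarrow> (\<exists>k. i = vsucc k)"

definition Limit :: "'v::zfc \<Rightarrow> bool" where
  "Limit i \<longleftrightarrow> Ord i \<and> \<not> is_succ i"

definition vpred :: "'v::zfc \<Rightarrow> 'v" where
  "vpred i = (if is_succ i then THE k. i = vsucc k else i)"

fun ord_of_nat :: "nat \<Rightarrow> 'v::zfc" where
  "ord_of_nat 0 = vempty"
| "ord_of_nat (Suc n) = vsucc (ord_of_nat n)"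

definition omega :: "'v::zfc" where
  "omega = vset (range ord_of_nat)"

lemma zfc_wf_induct [case_names step]:
  fixes x :: "'v::zfc"
  assumes "\<And>x. (\<And>y. y \<in> elts x \<Longrightarrow> P y) \<Longrightarrow> P x"
  shows "P x"
  using wf_induct_rule[OF zfc_foundation, of P x] assms by auto

lemma vset_elts [simp]: "vset (elts x) = (x :: 'v::zfc)"
  unfolding vset_def by (auto intro: zfc_extensionality)

lemma elts_vset [simp]: "small X \<Longrightarrow> elts (vset X) = (X :: 'v::zfc set)"
  unfolding small_def by auto

lemma small_elts [simp]: "small (elts (x :: 'v::zfc))"
  by (simp add: small_def)

lemma small_subset: "small Y \<Longrightarrow> X \<subseteq> Y \<Longrightarrow> small (X :: 'v::zfc set)"
  unfolding small_def using zfc_separation by blast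

lemma small_image [simp]: "small X \<Longrightarrow> small ((f :: 'v \<Rightarrow> 'v) ` X :: 'v::zfc set)"
  unfolding small_def using zfc_replacement by blast

lemma small_pair [simp]: "small {x, y :: 'v::zfc}"
  by (simp add: small_def zfc_pairing)

lemma small_single [simp]: "small {x :: 'v::zfc}"
  using small_pair[of x x] by simp

lemma small_empty [simp]: "small ({} :: 'v::zfc set)"
  by (rule small_subset[OF small_elts]) simp

lemma small_Union:
  fixes X :: "'v::zfc set" and f :: "'v \<Rightarrow> 'v set"
  assumes X: "small X" and f: "\<And>x. x \<in> X \<Longrightarrow> small (f x)"
  shows "small (\<Union>x\<in>X. f x)"
proof -
  let ?Y = "vset ((\<lambda>x. vset (f x)) ` X)"
  have "(\<Union>y\<in>elts ?Y. elts y) = (\<Union>x\<in>X. f x)" using X f by simp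
  then show ?thesis using zfc_union[of ?Y] by (simp add: small_def)
qed

lemma small_Un: "small X \<Longrightarrow> small Y \<Longrightarrow> small (X \<union> Y :: 'v::zfc set)"
proof -
  assume a: "small X" "small Y"
  have "X \<union> Y = (\<Union>z\<in>{vset X, vset Y}. elts z)" using a by simp
  also have "small \<dots>" by (rule small_Union) simp_all
  finally show ?thesis .
qed

lemma small_insert [simp]: "small X \<Longrightarrow> small (insert (x :: 'v::zfc) X)"
  using small_Un[of "{x}" X] by simp

lemma elts_vpow [simp]: "elts (vpow x) = {y. elts y \<subseteq> elts (x :: 'v::zfc)}"
  unfolding vpow_def using zfc_power[of x] by (simp add: small_def)

lemma small_Pow: "small X \<Longrightarrow> small {y. elts y \<subseteq> (X :: 'v::zfc set)}"
  unfolding small_def using zfc_power by blast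

lemma elts_vsucc [simp]: "elts (vsucc i) = insert i (elts (i :: 'v::zfc))"
  by (simp add: vsucc_def)

lemma mem_not_refl: "x \<notin> elts (x :: 'v::zfc)"
  using wf_not_refl[OF zfc_foundation, of x] by simp

lemma mem_not_sym: "x \<in> elts y \<Longrightarrow> y \<notin> elts (x :: 'v::zfc)"
  using wf_not_sym[OF zfc_foundation, of x y] by simp

lemma vsucc_inject [simp]: "vsucc i = vsucc j \<longleftrightarrow> i = (j :: 'v::zfc)"
  by (metis elts_vsucc insertE insertI1 mem_not_sym)

lemma is_succ_vsucc [simp]: "is_succ (vsucc (i :: 'v::zfc))"
  by (auto simp: is_succ_def)

lemma vpred_vsucc [simp]: "vpred (vsucc i) = (i :: 'v::zfc)"
  by (simp add: vpred_def)

lemma vpred_mem: "is_succ i \<Longrightarrow> vpred i \<in> elts (i :: 'v::zfc)"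
  by (auto simp: is_succ_def)

lemma family_cong [fundef_cong]:
  "i = i' \<Longrightarrow> (\<And>j. j \<in> elts i' \<Longrightarrow> f j = f' j) \<Longrightarrow> family i f = family i' f'"
  by (simp add: family_def cong: image_cong_simp)

lemma dimage_cong [fundef_cong]:
  "x = x' \<Longrightarrow> (\<And>y. y \<in> elts x' \<Longrightarrow> f y = f' y) \<Longrightarrow> dimage f x = dimage f' x'"
  by (simp add: dimage_def cong: image_cong_simp)

lemma small_range_ord_of_nat: "small (range (ord_of_nat :: nat \<Rightarrow> 'v::zfc))"
proof -
  obtain w :: 'v where w: "\<exists>z\<in>elts w. elts z = {}"
    "\<forall>x\<in>elts w. \<exists>y\<in>elts w. elts y = insert x (elts x)"
    using zfc_infinity by blast
  have "ord_of_nat n \<in> elts w" for n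
  proof (induction n)
    case 0
    obtain z where "z \<in> elts w" "elts z = {}" using w by blast
    then show ?case by (metis ord_of_nat.simps(1) vempty_def vset_elts)
  next
    case (Suc n)
    then obtain y where "y \<in> elts w" "elts y = insert (ord_of_nat n) (elts (ord_of_nat n))"
      using w by blast
    then show ?case by (metis ord_of_nat.simps(2) vsucc_def vset_elts)
  qed
  then show ?thesis using small_subset[OF small_elts, of _ w] by blast
qed

text \<open>Ordinal addition, \<open>i + j = i \<union> {i + k | k < j}\<close>.\<close>

function ord_add :: "'v::zfc \<Rightarrow> 'v \<Rightarrow> 'v" where
  "ord_add i j = vset (elts i \<union> ord_add i ` elts j)"
  by pat_completeness auto
termination
  by (relation "inv_image {(x, y). x \<in> elts y} snd") (auto intro: zfc_foundation)
declare ord_add.simps [simp del]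

lemma elts_ord_add: "elts (ord_add i j) = elts i \<union> ord_add i ` elts (j :: 'v::zfc)"
  by (subst ord_add.simps) (simp add: small_Un)

lemma ord_add_empty: "ord_add i vempty = (i :: 'v::zfc)"
  by (rule zfc_extensionality) (simp add: elts_ord_add vempty_def)

lemma ord_add_vsucc: "ord_add i (vsucc j) = vsucc (ord_add i (j :: 'v::zfc))"
  by (rule zfc_extensionality) (simp add: elts_ord_add)

definition LP :: "'v::zfc \<Rightarrow> 'v" where
  "LP i = (THE l. Limit l \<and> (\<exists>m. i = ord_add l (ord_of_nat m)))"

definition FP :: "'v::zfc \<Rightarrow> nat" where
  "FP i = (THE m. \<exists>l. Limit l \<and> i = ord_add l (ord_of_nat m))"

text \<open>
  Cardinals are initial ordinals. Since every HOL function between small classes is (the graph of)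
  a set, comparing sizes by HOL's cardinals agrees with comparing them within the universe.
\<close>

definition Cardinal :: "'v::zfc \<Rightarrow> bool" where
  "Cardinal \<kappa> \<longleftrightarrow> Ord \<kappa> \<and> (\<forall>i \<in> elts \<kappa>. |elts i| <o |elts \<kappa>| )"

definition infinite_regular :: "'v::zfc \<Rightarrow> bool" where
  "infinite_regular \<kappa> \<longleftrightarrow> Cardinal \<kappa> \<and> infinite (elts \<kappa>) \<and> regularCard |elts \<kappa>|"

text \<open>The parameter \<open>\<kappa>\<close>: a cardinal or the formal symbol \<open>\<infinity>\<close>.\<close>

datatype 'v bound = Card 'v | Infty

fun regular_or_infty :: "'v::zfc bound \<Rightarrow> bool" where
  "regular_or_infty (Card \<kappa>) \<longleftrightarrow> infinite_regular \<kappa>"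
| "regular_or_infty Infty \<longleftrightarrow> True"

fun size_less :: "'v::zfc \<Rightarrow> 'v bound \<Rightarrow> bool" where
  "size_less x (Card \<kappa>) \<longleftrightarrow> |elts x| <o |elts \<kappa>|"
| "size_less x Infty \<longleftrightarrow> True"


section \<open>The final chain of the bounded powerset functor\<close>

definition Pless :: "'v::zfc bound \<Rightarrow> 'v \<Rightarrow> 'v" where
  "Pless \<kappa> x = vset {y. elts y \<subseteq> elts x \<and> size_less y \<kappa>}"

text \<open>
  \<open>conn i j\<close> is the connecting map from level \<open>i\<close> to level \<open>j \<le> i\<close>. The formula mentions neither the
  levels nor \<open>\<kappa>\<close>, because direct image and projection do not depend on their domain. From a limit
  \<open>i > j\<close> it is the projection; from a successor to a successor it is the direct image under
  \<open>conn (vpred i) (vpred j)\<close>; from a successor \<open>i\<close> to a limit \<open>j < i\<close> it is determined by its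
  components, which by functoriality are the \<open>conn i k\<close> for \<open>k < j\<close>. The equations defining
  the final chain are derived below.
\<close>

function conn :: "'v::zfc \<Rightarrow> 'v \<Rightarrow> 'v \<Rightarrow> 'v" where
  "conn i j x =
    (if i = j then x
     else if \<not> is_succ i then component x j
     else if is_succ j then dimage (\<lambda>y. conn (vpred i) (vpred j) y) x
     else family j (\<lambda>k. conn i k x))"
  by pat_completeness auto
termination
  by (relation "inv_image {(x, y). x \<in> elts y} (\<lambda>(i, j, x). j)")
     (auto intro: zfc_foundation vpred_mem)
declare conn.simps [simp del]

function nu :: "'v::zfc bound \<Rightarrow> 'v \<Rightarrow> 'v" where
  "nu \<kappa> i =
    (if is_succ i then Pless \<kappa> (nu \<kappa> (vpred i))
     else vset {family i x | x.
       (\<forall>j. j \<in> elts i \<longrightarrow> x j \<in> elts (nu \<kappa> j)) \<and>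
       (\<forall>j. j \<in> elts i \<longrightarrow> (\<forall>k. ord_le k j \<longrightarrow> conn j k (x j) = x k))})"
  by pat_completeness auto
termination
  by (relation "inv_image {(x, y). x \<in> elts y} snd") (auto intro: zfc_foundation vpred_mem)
declare nu.simps [simp del]


subsection \<open>The defining equations of the final chain\<close>

lemma elts_vpair [simp]: "elts (vpair x y) = {vset {x}, vset {x, y :: 'v::zfc}}"
  by (simp add: vpair_def)

lemma vset_eq_iff: "small X \<Longrightarrow> small Y \<Longrightarrow> vset X = vset Y \<longleftrightarrow> X = (Y :: 'v::zfc set)"
  by (metis elts_vset)

lemma vpair_inject [simp]: "vpair x y = vpair x' y' \<longleftrightarrow> x = x' \<and> y = (y' :: 'v::zfc)"
proof
  assume "vpair x y = vpair x' y'"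
  then have "elts (vpair x y) = elts (vpair x' y')" by simp
  then have "{{x}, {x, y}} = {{x'}, {x', y'}}"
    by (simp add: doubleton_eq_iff vset_eq_iff)
  then show "x = x' \<and> y = y'" by (auto simp: doubleton_eq_iff)
qed simp

lemma elts_family [simp]: "elts (family i f) = (\<lambda>j. vpair j (f j)) ` elts (i :: 'v::zfc)"
  by (simp add: family_def)

lemma component_family [simp]: "j \<in> elts i \<Longrightarrow> component (family i f) j = f (j :: 'v::zfc)"
  by (auto simp: component_def)

lemma elts_dimage [simp]: "elts (dimage f x) = f ` elts (x :: 'v::zfc)"
  by (simp add: dimage_def)

lemma elts_Pless [simp]:
  "elts (Pless \<kappa> x) = {y. elts y \<subseteq> elts (x :: 'v::zfc) \<and> size_less y \<kappa>}"
  unfolding Pless_def by (rule elts_vset, rule small_subset[OF small_Pow[OF small_elts[of x]]]) auto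

lemma dimage_Pless:
  assumes "y \<in> elts (Pless \<kappa> x)" "f ` elts x \<subseteq> elts x'"
  shows "dimage f y \<in> elts (Pless \<kappa> (x' :: 'v::zfc))"
proof -
  have "size_less (dimage f y) \<kappa>"
    using assms(1) by (cases \<kappa>) (auto intro: ordLeq_ordLess_trans card_of_image)
  then show ?thesis using assms by auto
qed

lemma nu_succ: "nu \<kappa> (vsucc i) = Pless \<kappa> (nu \<kappa> i)"
  by (subst nu.simps) simp

lemma elts_nu_Limit:
  assumes "\<not> is_succ (i :: 'v::zfc)"
  shows "elts (nu \<kappa> i) = {family i x | x.
       (\<forall>j \<in> elts i. x j \<in> elts (nu \<kappa> j)) \<and>
       (\<forall>j \<in> elts i. \<forall>k. ord_le k j \<longrightarrow> conn j k (x j) = x k)}" (is "_ = ?L")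
proof -
  let ?Z = "\<Union>j\<in>elts i. vpair j ` elts (nu \<kappa> j)"
  have "small ?L"
  proof (rule small_subset[OF small_Pow[of ?Z]])
    show "small ?Z" by (intro small_Union small_image small_elts)
    show "?L \<subseteq> {y. elts y \<subseteq> ?Z}" by (auto simp del: elts_vpair) blast
  qed
  moreover have "nu \<kappa> i = vset ?L"
    using assms by (subst nu.simps) (simp add: Ball_def)
  ultimately show ?thesis by simp
qed

lemma conn_refl [simp]: "conn i i x = x"
  by (subst conn.simps) simp

lemma conn_succ: "conn (vsucc i) (vsucc j) x = dimage (conn i j) x"
proof (cases "i = j")
  case False
  then show ?thesis by (subst conn.simps) simp
qed (simp add: dimage_def)

lemma conn_Limit: "\<not> is_succ i \<Longrightarrow> j \<in> elts i \<Longrightarrow> conn i j x = component x j"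
  by (subst conn.simps) (auto simp: mem_not_refl)

lemma conn_succ_Limit:
  "is_succ i \<Longrightarrow> \<not> is_succ j \<Longrightarrow> conn i j x = family j (\<lambda>k. conn i k x)"
  by (subst conn.simps) auto

lemma Ord_vsucc_le:
  assumes "Ord (vsucc p)" "ord_le (vsucc l) (vsucc p)"
  shows "ord_le l (p :: 'v::zfc)"
  using assms by (auto simp: ord_le_def Ord_def)

lemma Ord_mem: "Ord i \<Longrightarrow> j \<in> elts i \<Longrightarrow> Ord (j :: 'v::zfc)"
  unfolding Ord_def by blast

lemma ord_le_Ord: "Ord i \<Longrightarrow> ord_le j i \<Longrightarrow> Ord (j :: 'v::zfc)"
  using Ord_mem by (auto simp: ord_le_def)

lemma ord_le_trans: "Ord i \<Longrightarrow> ord_le k j \<Longrightarrow> ord_le j i \<Longrightarrow> ord_le k (i :: 'v::zfc)"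
  unfolding Ord_def ord_le_def by blast

lemma final_chain:
  fixes i :: "'v::zfc"
  assumes "Ord i" "x \<in> elts (nu \<kappa> i)" "ord_le j i"
  shows conn_in_nu: "conn i j x \<in> elts (nu \<kappa> j)"
    and conn_conn: "ord_le k j \<Longrightarrow> conn j k (conn i j x) = conn i k x"
proof -
  have "\<forall>x j. Ord i \<longrightarrow> x \<in> elts (nu \<kappa> i) \<longrightarrow> ord_le j i \<longrightarrow>
    conn i j x \<in> elts (nu \<kappa> j) \<and> (\<forall>k. ord_le k j \<longrightarrow> conn j k (conn i j x) = conn i k x)"
  proof (induction i rule: zfc_wf_induct)
    case (step i)
    show ?case
    proof (intro allI impI)
      fix x j assume i: "Ord i" and x: "x \<in> elts (nu \<kappa> i)" and j: "ord_le j i"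
      show "conn i j x \<in> elts (nu \<kappa> j) \<and> (\<forall>k. ord_le k j \<longrightarrow> conn j k (conn i j x) = conn i k x)"
      proof (cases "is_succ i")
        case False
        then obtain f where f: "x = family i f" "\<forall>j \<in> elts i. f j \<in> elts (nu \<kappa> j)"
          "\<forall>j \<in> elts i. \<forall>k. ord_le k j \<longrightarrow> conn j k (f j) = f k"
          using x by (auto simp: elts_nu_Limit)
        show ?thesis
        proof (cases "j = i")
          case True then show ?thesis using x by simp
        next
          case ne: False
          then have ji: "j \<in> elts i" using j by (simp add: ord_le_def)
          have "k \<in> elts i" if "ord_le k j" for k
            using i that ji unfolding Ord_def ord_le_def by blast
          then show ?thesis using f ji False by (simp add: conn_Limit)
        qed
      next
        case True
        then obtain p where p: "i = vsucc p" by (auto simp: is_succ_def)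
        have pi: "p \<in> elts i" by (simp add: p)
        have Op: "Ord p" using i pi by (rule Ord_mem)
        have IH: "conn p l y \<in> elts (nu \<kappa> l)"
          "ord_le k l \<Longrightarrow> conn l k (conn p l y) = conn p k y"
          if "y \<in> elts (nu \<kappa> p)" "ord_le l p" for y l k
          using step[OF pi] Op that by blast+
        have xs: "elts x \<subseteq> elts (nu \<kappa> p)" using x p by (simp add: nu_succ)
        show ?thesis using j
        proof (induction j rule: zfc_wf_induct)
          case (step j)
          show ?case
          proof (cases "is_succ j")
            case True
            then obtain l where l: "j = vsucc l" by (auto simp: is_succ_def)
            have lp: "ord_le l p" using Ord_vsucc_le i step.prems by (simp add: p l)
            have 1: "conn i j x \<in> elts (nu \<kappa> j)"
              unfolding p l conn_succ nu_succ
              by (rule dimage_Pless) (use x p IH(1) lp in \<open>auto simp: nu_succ\<close>)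
            have "ord_le k j \<longrightarrow> conn j k (conn i j x) = conn i k x" for k
            proof (induction k rule: zfc_wf_induct)
              case (step k)
              show ?case
              proof
                assume kj: "ord_le k j"
                have Oj: "Ord j" using ord_le_Ord[OF i \<open>ord_le j i\<close>] .
                show "conn j k (conn i j x) = conn i k x"
                proof (cases "is_succ k")
                  case True
                  then obtain m where m: "k = vsucc m" by (auto simp: is_succ_def)
                  have "ord_le m l" using Ord_vsucc_le Oj kj by (simp add: m l)
                  then have "conn l m ` conn p l ` elts x = conn p m ` elts x"
                    using IH(2)[OF _ lp] xs unfolding image_image by (intro image_cong) blast+
                  then show ?thesis
                    unfolding p l m conn_succ by (simp add: dimage_def)
                next
                  case False
                  have "ord_le m j" if "m \<in> elts k" for m
                    using ord_le_trans[OF Oj _ kj] that by (simp add: ord_le_def)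
                  then have "family k (\<lambda>m. conn j m (conn i j x)) = family k (\<lambda>m. conn i m x)"
                    using step by (intro family_cong) auto
                  then show ?thesis
                    using False by (simp add: conn_succ_Limit p l)
                qed
              qed
            qed
            then show ?thesis using 1 by blast
          next
            case False
            then have cf: "conn i j x = family j (\<lambda>k. conn i k x)"
              by (simp add: conn_succ_Limit p)
            have Oj: "Ord j" using ord_le_Ord[OF i step.prems] .
            have ki: "ord_le k i" if "k \<in> elts j" for k
              using ord_le_trans[OF i _ step.prems] that by (simp add: ord_le_def)
            have "conn i j x \<in> elts (nu \<kappa> j)"
              unfolding cf elts_nu_Limit[OF False] using step.IH ki by blast
            moreover have "conn j k (conn i j x) = conn i k x" if "ord_le k j" for k
            proof (cases "k = j")
              case ne: False
              then have "k \<in> elts j" using that by (simp add: ord_le_def)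
              then show ?thesis using False by (simp add: cf conn_Limit)
            qed simp
            ultimately show ?thesis by blast
          qed
        qed
      qed
    qed
  qed
  then show "conn i j x \<in> elts (nu \<kappa> j)"
    and "ord_le k j \<Longrightarrow> conn j k (conn i j x) = conn i k x"
    using assms by blast+
qed

lemma nu_subset_Infty: "x \<in> elts (nu \<kappa> i) \<Longrightarrow> x \<in> elts (nu Infty (i :: 'v::zfc))"
proof (induction i arbitrary: x rule: zfc_wf_induct)
  case (step i)
  show ?case
  proof (cases "is_succ i")
    case True
    then obtain p where p: "i = vsucc p" by (auto simp: is_succ_def)
    show ?thesis using step.IH[of p] step.prems by (auto simp: p nu_succ)
  next
    case False
    show ?thesis using step unfolding elts_nu_Limit[OF False] by blast
  qed
qed


section \<open>Transition systems and the maps into the final chain\<close>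

text \<open>
  A transition system is given by its relation. No size condition is needed: by induction
  \<open>approx R i x\<close> lies in level \<open>i\<close>, so the class of all \<open>approx R i y\<close> is small.
\<close>

function approx :: "('s \<times> 's) set \<Rightarrow> 'v::zfc \<Rightarrow> 's \<Rightarrow> 'v" where
  "approx R i x =
    (if is_succ i then vset ((\<lambda>y. approx R (vpred i) y) ` {y. (x, y) \<in> R})
     else family i (\<lambda>j. approx R j x))"
  by pat_completeness auto
termination
  by (relation "inv_image {(x, y). x \<in> elts y} (\<lambda>(R, i, x). i)")
     (auto intro: zfc_foundation vpred_mem)
declare approx.simps [simp del]

lemma approx_Limit: "\<not> is_succ i \<Longrightarrow> approx R i x = family i (\<lambda>j. approx R j x)"
  by (subst approx.simps) simp

lemma approx_succ: "approx R (vsucc i) x = vset (approx R i ` {y. (x, y) \<in> R})"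
  by (subst approx.simps) simp

lemma approx_in_nu:
  fixes i :: "'v::zfc"
  assumes "Ord i"
  shows "approx R i x \<in> elts (nu Infty i)"
    and "ord_le j i \<Longrightarrow> conn i j (approx R i x) = approx R j x"
proof -
  have "\<forall>x. Ord i \<longrightarrow> approx R i x \<in> elts (nu Infty i) \<and>
          (\<forall>j. ord_le j i \<longrightarrow> conn i j (approx R i x) = approx R j x)"
  proof (induction i rule: zfc_wf_induct)
    case (step i)
    show ?case
    proof (intro allI impI)
      fix x assume i: "Ord i"
      show "approx R i x \<in> elts (nu Infty i) \<and>
          (\<forall>j. ord_le j i \<longrightarrow> conn i j (approx R i x) = approx R j x)"
      proof (cases "is_succ i")
        case True
        then obtain p where p: "i = vsucc p" by (auto simp: is_succ_def)
        have pi: "p \<in> elts i" by (simp add: p)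
        have Op: "Ord p" using i pi by (rule Ord_mem)
        note IH = step[OF pi, rule_format, OF Op]
        have sm: "small (approx R p ` {y. (x, y) \<in> R})" for x
          using IH by (intro small_subset[OF small_elts[of "nu Infty p"]]) auto
        have e: "approx R i x = vset (approx R p ` {y. (x, y) \<in> R})"
          by (simp add: p approx_succ)
        have "conn i j (approx R i x) = approx R j x" if "ord_le j i" for j
          using that
        proof (induction j rule: zfc_wf_induct)
          case (step j)
          show ?case
          proof (cases "is_succ j")
            case True
            then obtain l where l: "j = vsucc l" by (auto simp: is_succ_def)
            have "ord_le l p" using Ord_vsucc_le i step.prems by (simp add: p l)
            then have "conn p l ` approx R p ` {y. (x, y) \<in> R} = approx R l ` {y. (x, y) \<in> R}"
              using IH unfolding image_image by (intro image_cong) blast+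
            then show ?thesis unfolding e unfolding p l conn_succ approx_succ
              by (simp add: dimage_def sm)
          next
            case False
            have "ord_le k i" if "k \<in> elts j" for k
              using ord_le_trans[OF i _ step.prems] that by (simp add: ord_le_def)
            then have "family j (\<lambda>k. conn i k (approx R i x)) = family j (\<lambda>k. approx R k x)"
              using step.IH by (intro family_cong) auto
            then show ?thesis using False by (simp add: conn_succ_Limit p approx_Limit)
          qed
        qed
        moreover have "approx R i x \<in> elts (nu Infty i)"
          unfolding e using IH sm by (auto simp: p nu_succ)
        ultimately show ?thesis by blast
      next
        case False
        have IH: "approx R j x \<in> elts (nu Infty j)"
          "ord_le k j \<Longrightarrow> conn j k (approx R j x) = approx R k x"
          if "j \<in> elts i" for j k
          using step[OF that] Ord_mem[OF i that] by blast+
        have e: "approx R i x = family i (\<lambda>j. approx R j x)"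
          by (rule approx_Limit[OF False])
        have "approx R i x \<in> elts (nu Infty i)"
          unfolding e elts_nu_Limit[OF False] using IH by blast
        moreover have "conn i j (approx R i x) = approx R j x" if "ord_le j i" for j
        proof (cases "j = i")
          case ne: False
          then have "j \<in> elts i" using that by (simp add: ord_le_def)
          then show ?thesis using False by (simp add: conn_Limit e)
        qed simp
        ultimately show ?thesis by blast
      qed
    qed
  qed
  then show "approx R i x \<in> elts (nu Infty i)"
    and "ord_le j i \<Longrightarrow> conn i j (approx R i x) = approx R j x"
    using assms by blast+
qed

lemma elts_approx_succ:
  "Ord i \<Longrightarrow> elts (approx R (vsucc i) x) = {approx R i y | y. (x, y) \<in> R}"
proof -
  assume "Ord i"
  then have "small (approx R i ` {y. (x, y) \<in> R})"
    using approx_in_nu(1) by (intro small_subset[OF small_elts[of "nu Infty i"]]) auto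
  then show ?thesis by (auto simp: approx_succ)
qed

definition step_rel :: "'v::zfc \<Rightarrow> 'v \<Rightarrow> 'v \<Rightarrow> bool" where
  "step_rel i a b \<longleftrightarrow> a \<in> elts (nu Infty i) \<and> b \<in> elts (nu Infty (vpred i)) \<and>
     (\<forall>j \<in> elts i. conn (vpred i) j b \<in> elts (conn i (vsucc j) a))"

text \<open>
  The disjoint union of the levels \<open>k \<le> i\<close> of the final chain of the full powerset functor;
  an element \<open>a\<close> of level \<open>k\<close> appears as the pair \<open>(k, a)\<close>.
\<close>

definition level_system :: "'v::zfc \<Rightarrow> (('v \<times> 'v) \<times> ('v \<times> 'v)) set" where
  "level_system i = {((k, a), (vpred k, b)) | k a b. ord_le k i \<and> step_rel k a b}"


section \<open>Trees and extensible ordinals\<close>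

text \<open>
  For \<open>l\<close> an ordinal, \<open>D\<close> (levels) and \<open>d\<close> (connecting maps \<open>d i j\<close> from \<open>D i\<close> to \<open>D j\<close> for \<open>j \<le> i < l\<close>)
  form a functor from the opposite of \<open>l\<close> to sets.
\<close>

definition is_tree_functor :: "'v::zfc \<Rightarrow> ('v \<Rightarrow> 'v) \<Rightarrow> ('v \<Rightarrow> 'v \<Rightarrow> 'v \<Rightarrow> 'v) \<Rightarrow> bool" where
  "is_tree_functor l D d \<longleftrightarrow>
     (\<forall>i \<in> elts l. \<forall>j. ord_le j i \<longrightarrow> d i j ` elts (D i) \<subseteq> elts (D j)) \<and>
     (\<forall>i \<in> elts l. \<forall>x \<in> elts (D i). d i i x = x) \<and>
     (\<forall>i \<in> elts l. \<forall>j k. ord_le j i \<longrightarrow> ord_le k j \<longrightarrow>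
        (\<forall>x \<in> elts (D i). d j k (d i j x) = d i k x))"

text \<open>\<open>full_branch l D d x\<close>: the family \<open>(x i)\<close>, \<open>i < l\<close>, is a full branch of \<open>(D i)\<close>, \<open>i < l\<close>.\<close>

definition full_branch :: "'v::zfc \<Rightarrow> ('v \<Rightarrow> 'v) \<Rightarrow> ('v \<Rightarrow> 'v \<Rightarrow> 'v \<Rightarrow> 'v) \<Rightarrow> ('v \<Rightarrow> 'v) \<Rightarrow> bool" where
  "full_branch l D d x \<longleftrightarrow>
     (\<forall>i \<in> elts l. x i \<in> elts (D i)) \<and>
     (\<forall>i \<in> elts l. \<forall>j. ord_le j i \<longrightarrow> d i j (x i) = x j)"

definition tidy_tree :: "'v::zfc \<Rightarrow> ('v \<Rightarrow> 'v) \<Rightarrow> ('v \<Rightarrow> 'v \<Rightarrow> 'v \<Rightarrow> 'v) \<Rightarrow> bool" where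
  "tidy_tree l D d \<longleftrightarrow>
     is_tree_functor l D d \<and>
     (\<forall>i \<in> elts l. \<forall>j. ord_le j i \<longrightarrow> d i j ` elts (D i) = elts (D j)) \<and>
     (\<forall>i \<in> elts l. Limit i \<longrightarrow>
        (\<forall>x y z. full_branch i D d x \<longrightarrow>
           full_branch (vsucc i) D d y \<longrightarrow> (\<forall>j \<in> elts i. y j = x j) \<longrightarrow>
           full_branch (vsucc i) D d z \<longrightarrow> (\<forall>j \<in> elts i. z j = x j) \<longrightarrow> y i = z i)) \<and>
     (\<exists>r. elts (D vempty) = {r})"

definition tree_property :: "'v::zfc \<Rightarrow> bool" where
  "tree_property l \<longleftrightarrow> infinite_regular l \<and>
     (\<forall>D d. tidy_tree l D d \<longrightarrow> (\<forall>i \<in> elts l. |elts (D i)| <o |elts l| ) \<longrightarrow>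
        (\<exists>x. full_branch l D d x))"

definition strongly_inaccessible :: "'v::zfc \<Rightarrow> bool" where
  "strongly_inaccessible l \<longleftrightarrow> infinite_regular l \<and>
     (\<forall>x :: 'v. |elts x| <o |elts l| \<longrightarrow> |elts (vpow x)| <o |elts l| )"

definition weakly_compact :: "'v::zfc \<Rightarrow> bool" where
  "weakly_compact l \<longleftrightarrow> strongly_inaccessible l \<and> tree_property l"

definition omega_cofinal :: "'v::zfc \<Rightarrow> bool" where
  "omega_cofinal i \<longleftrightarrow> Ord i \<and>
     (\<exists>s :: nat \<Rightarrow> 'v. (\<forall>n. Ord (s n)) \<and> (\<forall>m n. m < n \<longrightarrow> s m \<in> elts (s n)) \<and>
        (\<forall>n. ord_le (s n) i) \<and>
        (\<forall>b. Ord b \<longrightarrow> (\<forall>n. ord_le (s n) b) \<longrightarrow> ord_le i b))"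

definition extensible :: "'v::zfc bound \<Rightarrow> 'v \<Rightarrow> bool" where
  "extensible \<kappa> i \<longleftrightarrow>
     i = vempty \<or>
     omega_cofinal i \<or>
     weakly_compact i \<or>
     (\<exists>c. \<kappa> = Card c \<and> Limit i \<and> ord_le (ord_add c omega) i) \<or>
     (\<exists>c. \<kappa> = Card c \<and> i = c \<and> tree_property c)"

end

theory Submission
  imports Defs
begin

text \<open>
  For \<open>i = l + n\<close> with \<open>l\<close> a limit, everything reduces to level \<open>l\<close>: there the approximations of \<open>a\<close>
  agree with its projections iff every element of every \<open>a\<^bsub>k+1\<^esub>\<close> lies on a branch of the tree
  \<open>(a\<^bsub>j+1\<^esub>)\<^bsub>j<l\<^esub>\<close>, whose branches are exactly the transitions from \<open>a\<close>.
  Such branches exist by dependent choice if \<open>l\<close> is \<open>\<omega>\<close>-cofinal, by the tree property if \<open>l\<close> is weakly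
  compact or \<open>l = \<kappa>\<close> has the tree property, and because the connecting maps down to level \<open>\<kappa>\<close> are
  injective if \<open>l > \<kappa>\<close>.

  If \<open>l\<close> is not extensible, a tree of height \<open>l\<close> without branches has to be coded by subsets of
  the levels of the chain. The codes are sets regarded as pointed systems, and rest on the fact that
  the approximation of index \<open>j\<close> separates the ordinals below \<open>j\<close> and identifies all others. If \<open>l\<close> is
  regular and lacks the tree property, the nodes of a counterexample are labelled injectively by ordinals
  below \<open>l\<close>. Otherwise some cofinal subset \<open>C\<close> of \<open>l\<close> embeds into the powerset of some \<open>m < l\<close>, and one
  uses the finite subsets of \<open>C\<close>: such a subset \<open>S\<close> reveals, at each \<open>k\<close>, its least element above
  \<open>k\<close>, so that a branch would yield an infinite sequence in \<open>C\<close> with finitely many terms below each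
  \<open>j < l\<close>, which is impossible as \<open>l\<close> is not \<open>\<omega>\<close>-cofinal.
\<close>

section \<open>Ordinals and cardinals\<close>

lemma Ord_subset: "Ord i \<Longrightarrow> j \<in> elts i \<Longrightarrow> elts j \<subseteq> elts (i :: 'v::zfc)"
  by (auto simp: Ord_def)

lemma Ord_trans: "Ord i \<Longrightarrow> j \<in> elts i \<Longrightarrow> k \<in> elts j \<Longrightarrow> k \<in> elts (i :: 'v::zfc)"
  by (auto simp: Ord_def)

lemma OrdI:
  "(\<And>j. j \<in> elts i \<Longrightarrow> Ord j) \<Longrightarrow> (\<And>j. j \<in> elts i \<Longrightarrow> elts j \<subseteq> elts i) \<Longrightarrow> Ord (i :: 'v::zfc)"
  by (auto simp: Ord_def)

text \<open>Nested membership induction: if \<open>i\<close> and \<open>j\<close> were incomparable,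
  the two hypotheses would put every element of each into the other, and extensionality would give
  \<open>i = j\<close>.\<close>

lemma Ord_linear:
  "Ord (i :: 'v::zfc) \<Longrightarrow> Ord j \<Longrightarrow> i \<in> elts j \<or> i = j \<or> j \<in> elts i"
proof (induction i arbitrary: j rule: zfc_wf_induct)
  case (step i)
  note IH1 = step.IH and Oi = step.prems(1)
  show ?case using step.prems(2)
  proof (induction j rule: zfc_wf_induct)
    case (step j)
    show ?case
    proof (rule ccontr)
      assume c: "\<not> ?thesis"
      have "x \<in> elts j" if "x \<in> elts i" for x
        using IH1[OF that Ord_mem[OF Oi that] step.prems] c Ord_trans[OF Oi that] that by blast
      moreover have "x \<in> elts i" if "x \<in> elts j" for x
        using step.IH[OF that Ord_mem[OF step.prems that]] c Ord_trans[OF step.prems that] that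
        by blast
      ultimately have "i = j" by (intro zfc_extensionality) blast
      then show False using c by blast
    qed
  qed
qed

lemma ord_le_refl [simp]: "ord_le i (i :: 'v::zfc)"
  by (simp add: ord_le_def)

lemma Ord_not_mem_iff: "Ord i \<Longrightarrow> Ord j \<Longrightarrow> i \<notin> elts j \<longleftrightarrow> ord_le j (i :: 'v::zfc)"
  unfolding ord_le_def using Ord_linear[of i j] mem_not_sym mem_not_refl by blast

lemma Ord_not_le_iff: "Ord i \<Longrightarrow> Ord j \<Longrightarrow> \<not> ord_le i j \<longleftrightarrow> j \<in> elts (i :: 'v::zfc)"
  using Ord_not_mem_iff[of j i] by blast

lemma ord_le_total: "Ord i \<Longrightarrow> Ord j \<Longrightarrow> ord_le i j \<or> ord_le j (i :: 'v::zfc)"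
  unfolding ord_le_def using Ord_linear by blast

lemma ord_le_antisym: "ord_le i j \<Longrightarrow> ord_le j i \<Longrightarrow> i = (j :: 'v::zfc)"
  unfolding ord_le_def using mem_not_sym by blast

lemma ord_le_mem_trans: "Ord i \<Longrightarrow> ord_le k j \<Longrightarrow> j \<in> elts i \<Longrightarrow> k \<in> elts (i :: 'v::zfc)"
  unfolding ord_le_def using Ord_trans by blast

lemma mem_ord_le_trans: "Ord i \<Longrightarrow> k \<in> elts j \<Longrightarrow> ord_le j i \<Longrightarrow> k \<in> elts (i :: 'v::zfc)"
  unfolding ord_le_def using Ord_trans by blast

lemma Ord_vsucc: "Ord i \<Longrightarrow> Ord (vsucc (i :: 'v::zfc))"
  unfolding Ord_def by auto

lemma Ord_vsucc_iff [simp]: "Ord (vsucc i) \<longleftrightarrow> Ord (i :: 'v::zfc)"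
  using Ord_vsucc Ord_mem[of "vsucc i" i] by auto

lemma mem_vsucc_iff: "j \<in> elts (vsucc i) \<longleftrightarrow> ord_le j (i :: 'v::zfc)"
  by (auto simp: ord_le_def)

lemma vsucc_le_iff: "Ord i \<Longrightarrow> ord_le (vsucc j) i \<longleftrightarrow> j \<in> elts (i :: 'v::zfc)"
proof
  assume i: "Ord i" and j: "j \<in> elts i"
  then have "Ord (vsucc j)" using Ord_mem by simp
  moreover have "i \<notin> elts (vsucc j)"
    using j mem_not_refl mem_not_sym by auto
  ultimately show "ord_le (vsucc j) i" using i Ord_not_mem_iff by blast
qed (auto simp: ord_le_def Ord_def)

lemma vsucc_mono: "Ord i \<Longrightarrow> j \<in> elts i \<Longrightarrow> vsucc j \<in> elts (vsucc (i :: 'v::zfc))"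
  using vsucc_le_iff[of i j] by (simp add: mem_vsucc_iff del: elts_vsucc)

lemma vsucc_le_vsucc: "Ord i \<Longrightarrow> ord_le j i \<Longrightarrow> ord_le (vsucc j) (vsucc (i :: 'v::zfc))"
  using vsucc_mono by (auto simp: ord_le_def)

lemma elts_vempty [simp]: "elts (vempty :: 'v::zfc) = {}"
  by (simp add: vempty_def)

lemma Ord_vempty [simp]: "Ord (vempty :: 'v::zfc)"
  by (simp add: Ord_def)

lemma vempty_le: "Ord i \<Longrightarrow> ord_le vempty (i :: 'v::zfc)"
  using Ord_not_mem_iff[of i vempty] by simp

lemma not_is_succ_vempty [simp]: "\<not> is_succ (vempty :: 'v::zfc)"
  by (metis elts_vempty elts_vsucc insert_not_empty is_succ_def)

lemma Limit_vsucc_mem: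
  assumes "Limit i" "j \<in> elts i" shows "vsucc j \<in> elts (i :: 'v::zfc)"
proof -
  have "ord_le (vsucc j) i" using assms vsucc_le_iff by (auto simp: Limit_def)
  then show ?thesis using assms by (auto simp: ord_le_def Limit_def)
qed

lemma Limit_vempty_mem: "Limit i \<Longrightarrow> i \<noteq> vempty \<Longrightarrow> vempty \<in> elts (i :: 'v::zfc)"
  using vempty_le[of i] by (auto simp: Limit_def ord_le_def)

text \<open>Defined by cases, so that the value is literally one of the two arguments and lies in
  every class that contains both.\<close>

definition omax :: "'v::zfc \<Rightarrow> 'v \<Rightarrow> 'v" where
  "omax i j = (if ord_le i j then j else i)"

lemma omax_cases: "omax i j = i \<or> omax i j = (j :: 'v::zfc)"
  by (simp add: omax_def)

lemma omax_ge: "Ord i \<Longrightarrow> Ord j \<Longrightarrow> ord_le i (omax i j) \<and> ord_le j (omax i (j :: 'v::zfc))"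
  using ord_le_total by (auto simp: omax_def)

lemma omax_mem: "i \<in> elts l \<Longrightarrow> j \<in> elts l \<Longrightarrow> omax i j \<in> elts (l :: 'v::zfc)"
  using omax_cases[of i j] by auto

lemma Ord_omax: "Ord i \<Longrightarrow> Ord j \<Longrightarrow> Ord (omax i (j :: 'v::zfc))"
  using omax_cases[of i j] by auto

lemma vpred_not_succ: "\<not> is_succ i \<Longrightarrow> vpred i = (i :: 'v::zfc)"
  by (simp add: vpred_def)

lemma Ord_ord_of_nat [simp]: "Ord (ord_of_nat n :: 'v::zfc)"
  by (induction n) auto

text \<open>All \<open>c + n\<close> stay below the limit \<open>i\<close>, and together with the
  ordinals below \<open>c\<close> they exhaust \<open>c + omega\<close>. Hence the clause about
  limits from \<open>\<kappa> + \<omega>\<close> on covers every limit above \<kappa>.\<close>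

lemma Limit_omega_add_le:
  assumes i: "Limit i" and c: "c \<in> elts (i :: 'v::zfc)"
  shows "ord_le (ord_add c omega) i"
proof -
  have Oi: "Ord i" using i by (simp add: Limit_def)
  have n: "ord_add c (ord_of_nat n) \<in> elts i" for n
    by (induction n) (use i c Limit_vsucc_mem in \<open>auto simp: ord_add_empty ord_add_vsucc\<close>)
  have om: "elts (omega :: 'v) = range ord_of_nat"
    by (simp add: omega_def small_range_ord_of_nat)
  have "elts (ord_add c omega) \<subseteq> elts i"
    using n Ord_subset[OF Oi c] by (auto simp: elts_ord_add om)
  moreover have "Ord (ord_add c omega)"
  proof (rule OrdI)
    have Oc: "Ord c" using Oi c by (rule Ord_mem)
    fix x assume "x \<in> elts (ord_add c omega)"
    then consider "x \<in> elts c" | n where "x = ord_add c (ord_of_nat n)"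
      by (auto simp: elts_ord_add om)
    then have "Ord x \<and> elts x \<subseteq> elts (ord_add c omega)"
    proof cases
      case 1
      then show ?thesis
        using Ord_mem[OF Oc] Ord_subset[OF Oc] by (auto simp: elts_ord_add)
    next
      case (2 n)
      have "elts (ord_add c (ord_of_nat n)) \<subseteq> elts (ord_add c omega)"
      proof (induction n)
        case 0 then show ?case by (auto simp: ord_add_empty elts_ord_add)
      next
        case (Suc n) then show ?case by (auto simp: ord_add_vsucc) (auto simp: elts_ord_add om)
      qed
      then show ?thesis using 2 Ord_mem[OF Oi n] by simp
    qed
    then show "Ord x" "elts x \<subseteq> elts (ord_add c omega)" by simp_all
  qed
  ultimately show ?thesis
    using Ord_not_mem_iff[OF Oi, of "ord_add c omega"] mem_not_refl by blast
qed

section \<open>Limit part and finite part\<close>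

lemma LP_FP_exist: "Ord (i :: 'v::zfc) \<Longrightarrow> \<exists>l m. Limit l \<and> i = ord_add l (ord_of_nat m)"
proof (induction i rule: zfc_wf_induct)
  case (step i)
  show ?case
  proof (cases "is_succ i")
    case True
    then obtain p where p: "i = vsucc p" by (auto simp: is_succ_def)
    then have "\<exists>l m. Limit l \<and> p = ord_add l (ord_of_nat m)"
      using step by simp
    then obtain l m where "Limit l" "p = ord_add l (ord_of_nat m)"
      by blast
    then have "Limit l \<and> i = ord_add l (ord_of_nat (Suc m))"
      by (simp add: p ord_add_vsucc)
    then show ?thesis by blast
  next
    case False
    then have "Limit i \<and> i = ord_add i (ord_of_nat 0)"
      using step by (simp add: Limit_def ord_add_empty)
    then show ?thesis by blast
  qed
qed

text \<open>Successors cancel on both sides, and a mismatch would exhibit a limit as a successor.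
  This makes the descriptions in \<open>LP\<close> and \<open>FP\<close> well defined.\<close>

lemma LP_FP_unique:
  "Limit l \<Longrightarrow> Limit l' \<Longrightarrow> ord_add l (ord_of_nat m) = ord_add l' (ord_of_nat m') \<Longrightarrow>
    l = l' \<and> m = (m' :: nat)" for l l' :: "'v::zfc"
proof (induction m arbitrary: m')
  case 0
  then show ?case
    by (cases m') (auto simp: ord_add_empty ord_add_vsucc Limit_def)
next
  case (Suc m)
  then show ?case
    by (cases m') (auto simp: ord_add_empty ord_add_vsucc Limit_def)
qed

lemma LP_ord_add: "Limit l \<Longrightarrow> LP (ord_add l (ord_of_nat m)) = (l :: 'v::zfc)"
  unfolding LP_def using LP_FP_unique by (intro the_equality) blast+

lemma FP_ord_add: "Limit (l :: 'v::zfc) \<Longrightarrow> FP (ord_add l (ord_of_nat m)) = m"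
  unfolding FP_def using LP_FP_unique by (intro the_equality) blast+

section \<open>Cardinality and cofinality of infinite ordinals\<close>

lemma infinite_Limit:
  assumes "Limit i" "i \<noteq> vempty" shows "infinite (elts (i :: 'v::zfc))"
proof
  assume "finite (elts i)"
  have "ord_of_nat n \<in> elts i" for n
    by (induction n) (use assms Limit_vempty_mem Limit_vsucc_mem in auto)
  moreover have "m < n \<longrightarrow> ord_of_nat m \<in> elts (ord_of_nat n :: 'v)" for m n
    by (induction n) (auto simp: less_Suc_eq)
  then have "inj (ord_of_nat :: nat \<Rightarrow> 'v)"
    by (intro injI) (metis linorder_neqE_nat mem_not_refl)
  ultimately show False
    using \<open>finite (elts i)\<close> by (meson finite_subset image_subsetI infinite_iff_countable_subset)
qed

lemma card_vsucc_less:
  assumes "infinite B" "|elts i| <o |B|"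
  shows "|elts (vsucc (i :: 'v::zfc))| <o |B|"
proof -
  have "|{i} \<union> elts i| <o |B|"
    using assms
    by (intro card_of_Un_ordLess_infinite finite_ordLess_infinite[of "|{i}|"] card_of_Well_order)
      (auto simp: Field_card_of)
  then show ?thesis by simp
qed

lemma infinite_regular_stable: "infinite_regular i \<Longrightarrow> stable |elts (i :: 'v::zfc)|"
  unfolding infinite_regular_def
  by (intro regularCard_stable card_of_Card_order) (auto simp: Field_card_of)

lemma infinite_regular_Limit:
  assumes "infinite_regular (i :: 'v::zfc)" shows "Limit i"
proof -
  have i: "Cardinal i" "infinite (elts i)" using assms by (auto simp: infinite_regular_def)
  have False if "i = vsucc p" for p
  proof -
    have "|elts p| <o |elts i|" using i that by (auto simp: Cardinal_def)
    then have "|elts i| <o |elts i|" using card_vsucc_less[OF i(2)] that by blast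
    then show False using ordLess_irreflexive by blast
  qed
  then show ?thesis using i by (auto simp: Limit_def Cardinal_def is_succ_def)
qed

text \<open>\<open>regularCard |elts i|\<close> speaks about an arbitrary well-order of \<open>elts i\<close> of minimal type, not about
  the order of the ordinal \<open>i\<close>.\<close>

lemma infinite_regular_bounded:
  assumes i: "infinite_regular (i :: 'v::zfc)" and X: "X \<subseteq> elts i" "|X| <o |elts i|"
  shows "\<exists>b\<in>elts i. \<forall>x\<in>X. x \<in> elts b"
proof (rule ccontr)
  assume c: "\<not> ?thesis"
  have "Limit i" using i by (rule infinite_regular_Limit)
  then have Oi: "Ord i" by (simp add: Limit_def)
  \<comment> \<open>If \<open>X\<close> were unbounded, \<open>i\<close> would be a union of fewer
    than \<open>|elts i|\<close> sets, each smaller than \<open>i\<close>, against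
    stability.\<close>
  have "elts i \<subseteq> (\<Union>x\<in>X. elts (vsucc x))"
  proof
    fix b assume b: "b \<in> elts i"
    then obtain x where "x \<in> X" "x \<notin> elts b" using c by blast
    then have "ord_le b x" using Ord_not_mem_iff b X Oi Ord_mem by blast
    then show "b \<in> (\<Union>x\<in>X. elts (vsucc x))" using \<open>x \<in> X\<close> mem_vsucc_iff by blast
  qed
  moreover have "|\<Union>x\<in>X. elts (vsucc x)| <o |elts i|"
  proof (rule stable_UNION[OF infinite_regular_stable[OF i] X(2)])
    fix x assume "x \<in> X"
    then have "|elts x| <o |elts i|" using i X by (auto simp: infinite_regular_def Cardinal_def)
    then show "|elts (vsucc x)| <o |elts i|"
      using i by (intro card_vsucc_less) (auto simp: infinite_regular_def)
  qed
  ultimately have "|elts i| <o |elts i|"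
    using card_of_mono1 ordLeq_ordLess_trans by blast
  then show False using ordLess_irreflexive by blast
qed

text \<open>The order of \<open>i\<close> is a well-order, so \<open>|elts i|\<close>, being least,
  embeds into it. A strictly smaller cardinal is then isomorphic to a proper initial segment, whose
  elements all lie below some \<open>m\<close>.\<close>

lemma card_le_elts_mem:
  fixes i :: "'v::zfc"
  assumes i: "Ord i" and A: "|A| <o |elts i|"
  shows "\<exists>m\<in>elts i. |A| \<le>o |elts m|"
proof -
  define r where "r = {(x, y). x \<in> elts i \<and> y \<in> elts i \<and> ord_le x y}"
  have F: "Field r = elts i" by (auto simp: r_def Field_def)
  have O: "Ord x" if "x \<in> elts i" for x using that i Ord_mem by blast
  have "r - Id \<subseteq> {(x, y). x \<in> elts y}" by (auto simp: r_def ord_le_def)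
  then have "wf (r - Id)" using zfc_foundation wf_subset by blast
  moreover have "linear_order_on (elts i) r"
    unfolding linear_order_on_def partial_order_on_def preorder_on_def
  proof (intro conjI)
    show "trans r" using O ord_le_trans unfolding r_def trans_def by blast
    show "antisym r" using ord_le_antisym by (auto simp: r_def antisym_def)
    show "total_on (elts i) r" using O ord_le_total by (auto simp: r_def total_on_def)
  qed (auto simp: r_def refl_on_def)
  ultimately have W: "well_order_on (elts i) r" by (simp add: well_order_on_def)
  have "|elts i| \<le>o r" using W card_of_least by blast
  then have "|A| <o r" using A ordLess_ordLeq_trans by blast
  then obtain a where a: "a \<in> Field r" "|A| =o Restr r (underS r a)"
    using ordLess_iff_ordIso_Restr[of r "|A|"] W F card_of_Well_order by auto
  have "|Field |A|| \<le>o |Field (Restr r (underS r a))|"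
    using a(2) card_of_mono2 ordIso_imp_ordLeq by blast
  moreover have "Field (Restr r (underS r a)) \<subseteq> elts a"
    by (auto simp: Field_def underS_def r_def ord_le_def)
  ultimately have "|A| \<le>o |elts a|"
    using card_of_mono1 ordLeq_transitive by (simp add: Field_card_of) blast
  then show ?thesis using a F by blast
qed

text \<open>A non-cardinal \<open>i\<close> injects into some \<open>m < i\<close>, so
  \<open>C\<close> can be all of \<open>i\<close>. For a cardinal, the failure of regularity
  concerns the abstract order \<open>|elts i|\<close>; it is carried over to the order of
  \<open>i\<close> by assuming that all smaller subsets of \<open>i\<close> are bounded.\<close>

lemma not_regular_cofinal:
  assumes i: "Limit (i :: 'v::zfc)" "i \<noteq> vempty" "\<not> infinite_regular i"
  shows "\<exists>C m. C \<subseteq> elts i \<and> m \<in> elts i \<and> (\<forall>j\<in>elts i. \<exists>v\<in>C. ord_le j v) \<and> |C| \<le>o |elts m|"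
proof (cases "Cardinal i")
  case False
  then obtain m where "m \<in> elts i" "\<not> |elts m| <o |elts i|"
    using i by (auto simp: Cardinal_def Limit_def)
  then have "m \<in> elts i \<and> |elts i| \<le>o |elts m|"
    using not_ordLess_iff_ordLeq card_of_Well_order by blast
  moreover have "\<forall>j\<in>elts i. \<exists>v\<in>elts i. ord_le j v" using ord_le_refl by blast
  ultimately show ?thesis by blast
next
  case True
  have Oi: "Ord i" using i by (simp add: Limit_def)
  show ?thesis
  proof (rule ccontr)
    assume c: "\<not> ?thesis"
    have bnd: "\<exists>b\<in>elts i. C \<subseteq> elts b" if C: "C \<subseteq> elts i" "|C| <o |elts i|" for C
    proof -
      have "\<exists>m\<in>elts i. |C| \<le>o |elts m|" using card_le_elts_mem Oi C by blast
      then obtain m where "m \<in> elts i" "|C| \<le>o |elts m|" by blast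
      then have "\<not> (\<forall>j\<in>elts i. \<exists>v\<in>C. ord_le j v)" using c C(1) by metis
      then obtain j where "j \<in> elts i" "\<forall>v\<in>C. \<not> ord_le j v" by metis
      then show ?thesis using Ord_not_le_iff C Oi Ord_mem by (meson subset_iff)
    qed
    let ?r = "|elts i|"
    have "\<not> regularCard ?r"
      using True i infinite_Limit by (auto simp: infinite_regular_def)
    then obtain K where K: "K \<subseteq> elts i" "cofinal K ?r" "\<not> |K| =o ?r"
      by (auto simp: regularCard_def Field_card_of)
    have "|K| \<le>o ?r" using K(1) by (rule card_of_mono1)
    then have K': "|K| <o ?r" using K(3) by (auto simp: ordLeq_iff_ordLess_or_ordIso)
    \<comment> \<open>Initial segments of \<open>|elts i|\<close> are smaller than \<open>i\<close>,
      hence bounded by some \<open>g a\<close>. A bound \<open>b\<close> of all \<open>g a\<close>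
      precedes some \<open>a\<close> of \<open>K\<close> in the abstract order, so that
      \<open>b < g a < b\<close>.\<close>
    have "\<exists>b\<in>elts i. underS ?r a \<subseteq> elts b" if "a \<in> K" for a
    proof (rule bnd)
      show "underS ?r a \<subseteq> elts i" using underS_Field[of _ ?r a] by (auto simp: Field_card_of)
      show "|underS ?r a| <o ?r"
        using that K by (intro card_of_underS card_of_Card_order) (auto simp: Field_card_of)
    qed
    then obtain g where g: "\<And>a. a \<in> K \<Longrightarrow> g a \<in> elts i \<and> underS ?r a \<subseteq> elts (g a)" by metis
    have "|g ` K| <o ?r" using K' card_of_image ordLeq_ordLess_trans by blast
    then obtain b where b: "b \<in> elts i" "g ` K \<subseteq> elts b" using bnd[of "g ` K"] g by blast
    obtain a where a: "a \<in> K" "b \<noteq> a" "(b, a) \<in> ?r"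
      using K(2) b(1) by (auto simp: cofinal_def Field_card_of)
    then have "b \<in> underS ?r a" by (simp add: underS_def)
    then have "b \<in> elts (g a)" using g a by blast
    moreover have "g a \<in> elts b" using b a by blast
    ultimately show False using mem_not_sym by blast
  qed
qed

text \<open>Induction on a bound for the size: a nonempty finite set arises from a smaller one by
  inserting an element, which costs one product with \<open>B\<close>. Countably many bounds remain
  to be united.\<close>

lemma card_of_finite_subsets:
  assumes B: "infinite B"
  shows "|{S. S \<subseteq> B \<and> finite S}| \<le>o |B|"
proof -
  have "|{S. S \<subseteq> B \<and> finite S \<and> card S \<le> n}| \<le>o |B|" for n
  proof (induction n)
    case 0
    have "{S. S \<subseteq> B \<and> finite S \<and> card S \<le> 0} = {{}}" by auto
    moreover have "B \<noteq> {}" using B by auto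
    then have "|{{}}| \<le>o |B|" by (rule card_of_singl_ordLeq)
    ultimately show ?case by simp
  next
    case (Suc n)
    let ?X = "{S. S \<subseteq> B \<and> finite S \<and> card S \<le> n}"
    have "{S. S \<subseteq> B \<and> finite S \<and> card S \<le> Suc n} \<subseteq> ?X \<union> (\<lambda>(S, b). insert b S) ` (?X \<times> B)"
    proof
      fix S assume S: "S \<in> {S. S \<subseteq> B \<and> finite S \<and> card S \<le> Suc n}"
      show "S \<in> ?X \<union> (\<lambda>(S, b). insert b S) ` (?X \<times> B)"
      proof (cases "S = {}")
        case False
        then obtain b where b: "b \<in> S" by blast
        have S': "S \<subseteq> B" "finite S" "card S \<le> Suc n" using S by auto
        have "card (S - {b}) \<le> n" using S'(3) b by (simp add: card_Diff_singleton)
        then have "(S - {b}, b) \<in> ?X \<times> B"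
          using S' b by (intro SigmaI CollectI conjI) auto
        moreover have "(\<lambda>(S, b). insert b S) (S - {b}, b) = S" using b by auto
        ultimately show ?thesis by (intro UnI2) (rule image_eqI, rule sym)
      qed auto
    qed
    moreover have "|?X \<times> B| \<le>o |B|"
      using Suc B card_of_mono1[of B B]
      by (intro card_of_Times_ordLeq_infinite_Field[of "|B|"] card_of_Card_order)
        (auto simp: Field_card_of)
    then have "|(\<lambda>(S, b). insert b S) ` (?X \<times> B)| \<le>o |B|"
      by (rule ordLeq_transitive[OF card_of_image])
    then have "|?X \<union> (\<lambda>(S, b). insert b S) ` (?X \<times> B)| \<le>o |B|"
      using Suc B by (intro card_of_Un_ordLeq_infinite_Field card_of_Card_order)
        (auto simp: Field_card_of)
    ultimately show ?case by (rule ordLeq_transitive[OF card_of_mono1])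
  qed
  moreover have "|UNIV :: nat set| \<le>o |B|" using B by (rule infinite_iff_card_of_nat[THEN iffD1])
  ultimately have "|\<Union>n\<in>(UNIV :: nat set). {S. S \<subseteq> B \<and> finite S \<and> card S \<le> n}| \<le>o |B|"
    using B by (intro card_of_UNION_ordLeq_infinite ballI)
  moreover have "{S. S \<subseteq> B \<and> finite S} = (\<Union>n. {S. S \<subseteq> B \<and> finite S \<and> card S \<le> n})" by auto
  ultimately show ?thesis by simp
qed

section \<open>Branches of trees\<close>

text \<open>The part of tidiness that the trees of components have by construction; levels may be
  empty.\<close>

definition surjective_tree :: "'v::zfc \<Rightarrow> ('v \<Rightarrow> 'v) \<Rightarrow> ('v \<Rightarrow> 'v \<Rightarrow> 'v \<Rightarrow> 'v) \<Rightarrow> bool" where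
  "surjective_tree l D d \<longleftrightarrow> is_tree_functor l D d \<and>
     (\<forall>i \<in> elts l. \<forall>j. ord_le j i \<longrightarrow> d i j ` elts (D i) = elts (D j))"

lemma surjective_tree_mem:
  "surjective_tree l D d \<Longrightarrow> i \<in> elts l \<Longrightarrow> ord_le j i \<Longrightarrow> x \<in> elts (D i) \<Longrightarrow> d i j x \<in> elts (D j)"
  unfolding surjective_tree_def by blast

lemma surjective_tree_refl:
  "surjective_tree l D d \<Longrightarrow> i \<in> elts l \<Longrightarrow> x \<in> elts (D i) \<Longrightarrow> d i i x = x"
  unfolding surjective_tree_def is_tree_functor_def by blast

lemma surjective_tree_comp:
  "surjective_tree l D d \<Longrightarrow> i \<in> elts l \<Longrightarrow> ord_le j i \<Longrightarrow> ord_le k j \<Longrightarrow> x \<in> elts (D i) \<Longrightarrow>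
    d j k (d i j x) = d i k x"
  unfolding surjective_tree_def is_tree_functor_def by blast

lemma surjective_tree_lift:
  "surjective_tree l D d \<Longrightarrow> i \<in> elts l \<Longrightarrow> ord_le j i \<Longrightarrow> x \<in> elts (D j) \<Longrightarrow>
    \<exists>z\<in>elts (D i). d i j z = x"
  unfolding surjective_tree_def by (metis imageE)

text \<open>The subtree of nodes compatible with the node \<open>c\<close> of level
  \<open>k\<close>. Asking for a common extension at some level \<open>t\<close> treats the levels
  above and below \<open>k\<close> alike.\<close>

definition comparable ::
  "'v::zfc \<Rightarrow> ('v \<Rightarrow> 'v) \<Rightarrow> ('v \<Rightarrow> 'v \<Rightarrow> 'v \<Rightarrow> 'v) \<Rightarrow> 'v \<Rightarrow> 'v \<Rightarrow> 'v \<Rightarrow> 'v" where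
  "comparable l D d k c j = vset {x \<in> elts (D j).
     \<exists>t\<in>elts l. ord_le j t \<and> ord_le k t \<and> (\<exists>z\<in>elts (D t). d t j z = x \<and> d t k z = c)}"

lemma elts_comparable: "elts (comparable l D d k c j) = {x \<in> elts (D j).
    \<exists>t\<in>elts l. ord_le j t \<and> ord_le k t \<and> (\<exists>z\<in>elts (D t). d t j z = x \<and> d t k z = c)}"
  unfolding comparable_def by (rule elts_vset[OF small_subset[OF small_elts]]) auto

lemma comparable_above:
  assumes T: "surjective_tree l D d" and l: "Ord l" and jl: "j \<in> elts l" "ord_le k j"
  shows "elts (comparable l D d k c j) = {x \<in> elts (D j). d j k x = c}"
proof -
  have "d j k x = c" if "t \<in> elts l" "ord_le j t" "z \<in> elts (D t)" "d t j z = x" "d t k z = c"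
    for x t z
    using surjective_tree_comp[OF T that(1,2) jl(2) that(3)] that by simp
  moreover have "d j j x = x" if "x \<in> elts (D j)" for x
    using surjective_tree_refl[OF T jl(1) that] .
  ultimately show ?thesis
    unfolding elts_comparable using jl ord_le_refl by blast
qed

text \<open>Only surjectivity needs work: the common extension of \<open>c\<close> and a node of
  level \<open>j\<close> is lifted to level \<open>omax t i\<close> and projected to level
  \<open>i\<close>.\<close>

lemma comparable_tree:
  assumes T: "surjective_tree l D d" and l: "Ord l" and k: "k \<in> elts l" and c: "c \<in> elts (D k)"
  shows "surjective_tree l (comparable l D d k c) d"
proof -
  let ?B = "comparable l D d k c"
  have sub: "elts (?B j) \<subseteq> elts (D j)" for j by (auto simp: elts_comparable)
  have im: "d i j ` elts (?B i) = elts (?B j)" if i: "i \<in> elts l" and ji: "ord_le j i" for i j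
  proof (intro subset_antisym subsetI)
    fix x assume "x \<in> d i j ` elts (?B i)"
    then obtain t z where t: "t \<in> elts l" "ord_le i t" "ord_le k t" "z \<in> elts (D t)"
      "x = d i j (d t i z)" "d t k z = c" by (auto simp: elts_comparable)
    have Ot: "Ord t" using l t Ord_mem by blast
    have jt: "ord_le j t" using ord_le_trans[OF Ot ji t(2)] .
    have "x = d t j z" using t surjective_tree_comp[OF T t(1,2) ji t(4)] by simp
    then show "x \<in> elts (?B j)"
      using t jt surjective_tree_mem[OF T t(1) jt t(4)] by (auto simp: elts_comparable)
  next
    fix x assume "x \<in> elts (?B j)"
    then obtain t z where t: "t \<in> elts l" "ord_le j t" "ord_le k t" "z \<in> elts (D t)"
      "x = d t j z" "d t k z = c" by (auto simp: elts_comparable)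
    let ?u = "omax t i"
    have O: "Ord t" "Ord i" using l t i Ord_mem by blast+
    have u: "?u \<in> elts l" "ord_le t ?u" "ord_le i ?u" "Ord ?u"
      using omax_mem t i omax_ge[OF O] Ord_omax[OF O] by auto
    obtain w where w: "w \<in> elts (D ?u)" "d ?u t w = z"
      using surjective_tree_lift[OF T u(1,2) t(4)] by blast
    have ku: "ord_le k ?u" using ord_le_trans u t by blast
    have "d ?u k w = c"
      using surjective_tree_comp[OF T u(1,2) t(3) w(1)] w t by simp
    then have "d ?u i w \<in> elts (?B i)"
      using u ku w surjective_tree_mem[OF T u(1,3) w(1)] by (auto simp: elts_comparable)
    moreover have "d i j (d ?u i w) = x"
      using surjective_tree_comp[OF T u(1,3) ji w(1)] surjective_tree_comp[OF T u(1,2) t(2) w(1)] w t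
      by simp
    ultimately show "x \<in> d i j ` elts (?B i)" by blast
  qed
  have "is_tree_functor l ?B d"
    unfolding is_tree_functor_def
  proof (intro conjI ballI allI impI)
    fix i x assume "i \<in> elts l" "x \<in> elts (?B i)"
    then show "d i i x = x" using surjective_tree_refl[OF T] sub by blast
  next
    fix i j m x assume "i \<in> elts l" "ord_le j i" "ord_le m j" "x \<in> elts (?B i)"
    then show "d j m (d i j x) = d i m x" using surjective_tree_comp[OF T] sub by blast
  qed (simp add: im)
  then show ?thesis using im by (simp add: surjective_tree_def)
qed

text \<open>At level \<open>k\<close> the subtree has no node but \<open>c\<close>, so its branches
  pass through \<open>c\<close>.\<close>

lemma full_branch_mem_comparable:
  assumes T: "surjective_tree l D d" and l: "Ord l" and k: "k \<in> elts l"
    and y: "full_branch l (comparable l D d k c) d y"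
  shows "full_branch l D d y \<and> y k = c"
proof
  show "full_branch l D d y" using y by (auto simp: full_branch_def elts_comparable)
  have "y k \<in> elts (comparable l D d k c k)" using y k by (simp add: full_branch_def)
  then have "d k k (y k) = c" "y k \<in> elts (D k)"
    using comparable_above[OF T l k ord_le_refl] by auto
  then show "y k = c" using surjective_tree_refl[OF T k] by simp
qed

section \<open>Existence of branches through a given node\<close>

text \<open>In the subtree around \<open>c\<close>, dependent choice lifts a node along the sequence
  \<open>s\<close>; projections from the levels \<open>s n\<close> fill in the rest.\<close>

lemma branch_through_omega_cofinal:
  assumes T: "surjective_tree l D d" and l: "omega_cofinal l" and k: "k \<in> elts l"
    and c: "c \<in> elts (D k)"
  shows "\<exists>y. full_branch l D d y \<and> y k = c"
proof -
  from l obtain s :: "nat \<Rightarrow> 'a" where Ol: "Ord l"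
    and s: "\<And>n. Ord (s n)" "\<And>m n. m < n \<Longrightarrow> s m \<in> elts (s n)" "\<And>n. ord_le (s n) l"
      "\<And>b. Ord b \<Longrightarrow> (\<And>n. ord_le (s n) b) \<Longrightarrow> ord_le l b"
    unfolding omega_cofinal_def by blast
  have sl: "s n \<in> elts l" for n
    using mem_ord_le_trans[OF Ol s(2)[of n "Suc n"] s(3)] by simp
  have mono: "ord_le (s m) (s n)" if "m \<le> n" for m n
    using s(2)[of m n] that by (cases "m = n") (auto simp: ord_le_def)
  have cof: "\<exists>n. ord_le j (s n)" if j: "j \<in> elts l" for j
  proof (rule ccontr)
    assume "\<not> ?thesis"
    then have "ord_le (s n) j" for n using ord_le_total s(1) j Ol Ord_mem by blast
    then have "ord_le l j" using s(4) j Ol Ord_mem by blast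
    then show False using j mem_not_refl mem_not_sym by (auto simp: ord_le_def)
  qed
  let ?B = "comparable l D d k c"
  note TB = comparable_tree[OF T Ol k c]
  have "\<exists>z. \<forall>n. z n \<in> elts (?B (s n)) \<and> d (s (Suc n)) (s n) (z (Suc n)) = z n"
  proof (rule dependent_nat_choice)
    have "c \<in> elts (?B k)"
      using comparable_above[OF T Ol k ord_le_refl] surjective_tree_refl[OF T k c] c by simp
    \<comment> \<open>Level \<open>s 0\<close> may lie on either side of \<open>k\<close>, so
      \<open>c\<close> is lifted to the larger of the two and then projected.\<close>
    then obtain w where w: "w \<in> elts (?B (omax k (s 0)))"
      using surjective_tree_lift[OF TB omax_mem[OF k sl]] omax_ge Ord_mem[OF Ol k] s(1) by blast
    have "d (omax k (s 0)) (s 0) w \<in> elts (?B (s 0))"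
      using surjective_tree_mem[OF TB omax_mem[OF k sl] _ w] omax_ge Ord_mem[OF Ol k] s(1) by blast
    then show "\<exists>x. x \<in> elts (?B (s 0))" by blast
  next
    fix x n assume "x \<in> elts (?B (s n))"
    then show "\<exists>y. y \<in> elts (?B (s (Suc n))) \<and> d (s (Suc n)) (s n) y = x"
      using surjective_tree_lift[OF TB sl mono] by (metis le_SucI order_refl)
  qed
  then obtain z where z: "\<And>n. z n \<in> elts (?B (s n))" "\<And>n. d (s (Suc n)) (s n) (z (Suc n)) = z n"
    by blast
  have zz: "d (s n) (s m) (z n) = z m" if "m \<le> n" for m n
    using that
  proof (induction n rule: dec_induct)
    case base
    show ?case using surjective_tree_refl[OF TB sl z(1)] .
  next
    case (step n)
    then show ?case
      using surjective_tree_comp[OF TB sl mono mono z(1), of n "Suc n" m] z(2) by simp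
  qed
  \<comment> \<open>Any \<open>n\<close> with \<open>j \<le> s n\<close> yields the same projection,
    because the \<open>z n\<close> are compatible; the least one serves as a canonical
    choice.\<close>
  define N where "N j = (LEAST n. ord_le j (s n))" for j
  have N: "ord_le j (s (N j))" if "j \<in> elts l" for j
    unfolding N_def using cof[OF that] by (rule LeastI_ex)
  define y where "y j = d (s (N j)) j (z (N j))" for j
  have y: "y j = d (s n) j (z n)" if "j \<in> elts l" "ord_le j (s n)" for j n
  proof -
    have le: "N j \<le> n" unfolding N_def using that(2) by (rule Least_le)
    show ?thesis
      using surjective_tree_comp[OF TB sl mono[OF le] N[OF that(1)] z(1)] zz[OF le]
      by (simp add: y_def)
  qed
  have "full_branch l ?B d y"
    unfolding full_branch_def
  proof (intro conjI ballI allI impI)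
    fix i assume i: "i \<in> elts l"
    show "y i \<in> elts (?B i)"
      unfolding y_def using surjective_tree_mem[OF TB sl N[OF i] z(1)] .
    fix j assume j: "ord_le j i"
    have "j \<in> elts l" using ord_le_mem_trans[OF Ol j i] .
    moreover have "ord_le j (s (N i))" using ord_le_trans[OF s(1) j N[OF i]] .
    ultimately show "d i j (y i) = y j"
      using y[of j "N i"] surjective_tree_comp[OF TB sl N[OF i] j z(1)] by (simp add: y_def[of i])
  qed
  then show ?thesis using full_branch_mem_comparable[OF T Ol k] by blast
qed

text \<open>Once \<open>c\<close> is lifted to a node \<open>z\<close> of level at least
  \<open>m\<close>, injectivity leaves exactly one node compatible with \<open>z\<close> on each
  level, and these nodes form the branch.\<close>

lemma branch_through_injective:
  assumes T: "surjective_tree l D d" and l: "Ord l" and k: "k \<in> elts l" and c: "c \<in> elts (D k)"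
    and m: "m \<in> elts l"
    and inj: "\<And>j. j \<in> elts l \<Longrightarrow> ord_le m j \<Longrightarrow> inj_on (d j m) (elts (D j))"
  shows "\<exists>y. full_branch l D d y \<and> y k = c"
proof -
  have O: "Ord k" "Ord m" using l k m Ord_mem by blast+
  let ?t = "omax k m"
  have t: "?t \<in> elts l" "ord_le k ?t" "ord_le m ?t" "Ord ?t"
    using omax_mem k m omax_ge[OF O] Ord_omax[OF O] by auto
  obtain z where z: "z \<in> elts (D ?t)" "d ?t k z = c" using surjective_tree_lift[OF T t(1,2) c] by blast
  let ?B = "comparable l D d ?t z"
  note TB = comparable_tree[OF T l t(1) z(1)]
  have one: "x = x'" if j: "j \<in> elts l" and x: "x \<in> elts (?B j)" "x' \<in> elts (?B j)" for j x x'
  proof -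
    have Oj: "Ord j" using l j Ord_mem by blast
    let ?u = "omax ?t j"
    have u: "?u \<in> elts l" "ord_le ?t ?u" "ord_le j ?u" "Ord ?u"
      using omax_mem t j omax_ge[OF t(4) Oj] Ord_omax[OF t(4) Oj] by auto
    have mu: "ord_le m ?u" using ord_le_trans u t by blast
    have eq: "w = w'" if "w \<in> elts (?B ?u)" "w' \<in> elts (?B ?u)" for w w'
    proof -
      have w: "w \<in> elts (D ?u)" "w' \<in> elts (D ?u)" "d ?u ?t w = z" "d ?u ?t w' = z"
        using that comparable_above[OF T l u(1,2)] by auto
      then have "d ?u m w = d ?u m w'"
        using surjective_tree_comp[OF T u(1,2) t(3)] by metis
      then show ?thesis using inj[OF u(1) mu] w by (meson inj_onD)
    qed
    show ?thesis using x surjective_tree_lift[OF TB u(1,3)] eq by metis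
  qed
  have ne: "\<exists>x. x \<in> elts (?B j)" if j: "j \<in> elts l" for j
  proof -
    have Oj: "Ord j" using l j Ord_mem by blast
    have "z \<in> elts (?B ?t)"
      using comparable_above[OF T l t(1) ord_le_refl] surjective_tree_refl[OF T t(1) z(1)] z by simp
    then show ?thesis
      using surjective_tree_lift[OF TB omax_mem[OF t(1) j]] omax_ge[OF t(4) Oj]
        surjective_tree_mem[OF TB omax_mem[OF t(1) j]] by blast
  qed
  then obtain y where y: "\<And>j. j \<in> elts l \<Longrightarrow> y j \<in> elts (?B j)" by metis
  have "full_branch l ?B d y"
    unfolding full_branch_def
  proof (intro conjI ballI allI impI)
    fix i j assume i: "i \<in> elts l" and j: "ord_le j i"
    have "j \<in> elts l" using ord_le_mem_trans[OF l j i] .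
    then show "d i j (y i) = y j"
      using one y surjective_tree_mem[OF TB i j y[OF i]] by blast
  qed (rule y)
  then have y': "full_branch l D d y \<and> y ?t = z" by (rule full_branch_mem_comparable[OF T l t(1)])
  then have "y k = c" using t z by (auto simp: full_branch_def)
  then show ?thesis using y' by blast
qed

text \<open>The subtree around \<open>c\<close> is tidy: its root is the projection of
  \<open>c\<close>, and separation at limits and smallness are inherited from
  \<open>D\<close>.\<close>

lemma branch_through_tree_property:
  assumes T: "surjective_tree l D d" and l: "tree_property l" and k: "k \<in> elts l"
    and c: "c \<in> elts (D k)"
    and uniq: "\<And>i x y. i \<in> elts l \<Longrightarrow> Limit i \<Longrightarrow> i \<noteq> vempty \<Longrightarrow> x \<in> elts (D i) \<Longrightarrow> y \<in> elts (D i) \<Longrightarrow>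
        (\<And>j. j \<in> elts i \<Longrightarrow> d i j x = d i j y) \<Longrightarrow> x = y"
    and card: "\<And>i. i \<in> elts l \<Longrightarrow> |elts (D i)| <o |elts l|"
  shows "\<exists>y. full_branch l D d y \<and> y k = c"
proof -
  have Ll: "Limit l" using l by (intro infinite_regular_Limit) (simp add: tree_property_def)
  then have Ol: "Ord l" by (simp add: Limit_def)
  let ?B = "comparable l D d k c"
  note TB = comparable_tree[OF T Ol k c]
  have Ok: "Ord k" using Ol k Ord_mem by blast
  have sub: "elts (?B j) \<subseteq> elts (D j)" for j by (auto simp: elts_comparable)
  have one: "x = d k vempty c" if "x \<in> elts (?B vempty)" for x
    using that surjective_tree_comp[OF T _ _ vempty_le[OF Ok]] by (fastforce simp: elts_comparable)
  have "l \<noteq> vempty" using k by auto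
  then have zl: "vempty \<in> elts l" using Ll Limit_vempty_mem by blast
  have "c \<in> elts (?B k)"
    using comparable_above[OF T Ol k ord_le_refl] surjective_tree_refl[OF T k c] c by simp
  then have "d k vempty c \<in> elts (?B vempty)"
    using surjective_tree_mem[OF TB k vempty_le[OF Ok]] by blast
  then have zero: "elts (?B vempty) = {d k vempty c}" using one by blast
  have "tidy_tree l ?B d"
    unfolding tidy_tree_def
  proof (intro conjI ballI impI allI)
    show "is_tree_functor l ?B d" using TB by (simp add: surjective_tree_def)
    show "d i j ` elts (?B i) = elts (?B j)" if "i \<in> elts l" "ord_le j i" for i j
      using TB that by (simp add: surjective_tree_def)
    show "\<exists>r. elts (?B vempty) = {r}" using zero by blast
    fix i x y z
    assume i: "i \<in> elts l" "Limit i" and y: "full_branch (vsucc i) ?B d y" "\<forall>j\<in>elts i. y j = x j"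
      and z: "full_branch (vsucc i) ?B d z" "\<forall>j\<in>elts i. z j = x j"
    have yz: "y i \<in> elts (?B i)" "z i \<in> elts (?B i)" using y z by (simp_all add: full_branch_def)
    show "y i = z i"
    proof (cases "i = vempty")
      \<comment> \<open>Since 0 counts as a limit, uniqueness there has to come from the single
        root.\<close>
      case True then show ?thesis using yz zero by simp
    next
      case False
      show ?thesis
      proof (rule uniq[OF i False])
        show "y i \<in> elts (D i)" "z i \<in> elts (D i)" using yz sub by auto
        fix j assume "j \<in> elts i"
        then show "d i j (y i) = d i j (z i)" using y z by (simp add: full_branch_def ord_le_def)
      qed
    qed
  qed
  moreover have "|elts (?B i)| <o |elts l|" if "i \<in> elts l" for i
    using card_of_mono1[OF sub] card[OF that] by (rule ordLeq_ordLess_trans)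
  ultimately obtain y where "full_branch l ?B d y"
    using l unfolding tree_property_def by blast
  then show ?thesis using full_branch_mem_comparable[OF T Ol k] by blast
qed

section \<open>Transitions between levels of the final chain\<close>

lemma elts_nu_vsucc: "x \<in> elts (nu \<kappa> (vsucc i)) \<longleftrightarrow> elts x \<subseteq> elts (nu \<kappa> i) \<and> size_less x \<kappa>"
  for i :: "'v::zfc"
  by (simp add: nu_succ)

lemma conn_refl [simp]: "conn i i x = (x :: 'v::zfc)"
  by (subst conn.simps) simp

lemma nu_Limit_eta:
  "\<not> is_succ i \<Longrightarrow> x \<in> elts (nu \<kappa> i) \<Longrightarrow> family i (\<lambda>k. conn i k x) = (x :: 'v::zfc)"
  by (auto simp: elts_nu_Limit conn_Limit intro!: family_cong)

lemma nu_Limit_ext: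
  assumes "\<not> is_succ (i :: 'v::zfc)" "x \<in> elts (nu \<kappa> i)" "y \<in> elts (nu \<kappa> i)"
    and "\<And>k. k \<in> elts i \<Longrightarrow> conn i k x = conn i k y"
  shows "x = y"
proof -
  have "family i (\<lambda>k. conn i k x) = family i (\<lambda>k. conn i k y)"
    using assms(4) by (intro family_cong) auto
  then show ?thesis using nu_Limit_eta assms by metis
qed

lemma conn_to_Limit:
  assumes "Ord i" "x \<in> elts (nu \<kappa> i)" "ord_le j i" "\<not> is_succ (j :: 'v::zfc)"
  shows "conn i j x = family j (\<lambda>k. conn i k x)"
proof -
  have "conn i j x = family j (\<lambda>k. conn j k (conn i j x))"
    using nu_Limit_eta[OF assms(4) conn_in_nu[OF assms(1-3)]] by simp
  also have "\<dots> = family j (\<lambda>k. conn i k x)"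
    using conn_conn[OF assms(1-3)] by (intro family_cong) (auto simp: ord_le_def)
  finally show ?thesis .
qed

lemma family_in_nu:
  assumes "\<not> is_succ (i :: 'v::zfc)" "\<And>j. j \<in> elts i \<Longrightarrow> x j \<in> elts (nu \<kappa> j)"
    and "\<And>j k. j \<in> elts i \<Longrightarrow> ord_le k j \<Longrightarrow> conn j k (x j) = x k"
  shows "family i x \<in> elts (nu \<kappa> i)"
  unfolding elts_nu_Limit[OF assms(1)] using assms(2,3) by blast

section \<open>The tree of an element of a limit level, and its transitions\<close>

text \<open>The connecting map from level \<open>i + 1\<close> to level \<open>j + 1\<close> is
  direct image under \<open>conn i j\<close>, so compatibility of the components of \<open>a\<close>
  says that \<open>conn i j\<close> maps one component onto the other.\<close>

lemma level_tree:
  assumes l: "Limit (l :: 'v::zfc)" and a: "a \<in> elts (nu \<kappa> l)"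
  shows "surjective_tree l (\<lambda>j. conn l (vsucc j) a) conn"
    and "j \<in> elts l \<Longrightarrow> elts (conn l (vsucc j) a) \<subseteq> elts (nu \<kappa> j) \<and> size_less (conn l (vsucc j) a) \<kappa>"
proof -
  have Ol: "Ord l" using l by (simp add: Limit_def)
  have sl: "ord_le (vsucc j) l" if "j \<in> elts l" for j
    using vsucc_le_iff[OF Ol] that by blast
  show D: "elts (conn l (vsucc j) a) \<subseteq> elts (nu \<kappa> j) \<and> size_less (conn l (vsucc j) a) \<kappa>"
    if "j \<in> elts l" for j
    using conn_in_nu[OF Ol a sl[OF that]] elts_nu_vsucc by blast
  have im: "conn i j ` elts (conn l (vsucc i) a) = elts (conn l (vsucc j) a)"
    if "i \<in> elts l" "ord_le j i" for i j
  proof -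
    have "ord_le (vsucc j) (vsucc i)" using vsucc_le_vsucc that Ol Ord_mem by blast
    from conn_conn[OF Ol a sl[OF that(1)] this] show ?thesis
      unfolding conn_succ by (metis elts_dimage)
  qed
  show "surjective_tree l (\<lambda>j. conn l (vsucc j) a) conn"
    unfolding surjective_tree_def is_tree_functor_def
  proof (intro conjI ballI allI impI)
    fix i j k x
    assume i: "i \<in> elts l" "ord_le j i" "ord_le k j" "x \<in> elts (conn l (vsucc i) a)"
    then show "conn j k (conn i j x) = conn i k x"
      using conn_conn[of i x \<kappa> j k] D[OF i(1)] Ord_mem[OF Ol i(1)] by blast
  qed (simp_all add: im)
qed

text \<open>The condition at index \<open>p\<close> is membership, and direct images yield the
  conditions at all smaller indices.\<close>

lemma step_rel_vsucc:
  assumes p: "Ord (p :: 'v::zfc)" and a: "a \<in> elts (nu \<kappa> (vsucc p))"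
  shows "step_rel (vsucc p) a b \<longleftrightarrow> b \<in> elts a"
proof
  assume "step_rel (vsucc p) a b"
  then have "conn p p b \<in> elts (conn (vsucc p) (vsucc p) a)" by (simp add: step_rel_def)
  then show "b \<in> elts a" by simp
next
  assume b: "b \<in> elts a"
  have "conn p j b \<in> elts (conn (vsucc p) (vsucc j) a)" for j
    unfolding conn_succ using b by simp
  moreover have "a \<in> elts (nu Infty (vsucc p))" using a by (rule nu_subset_Infty)
  moreover have "b \<in> elts (nu Infty p)"
    using a b by (auto simp: elts_nu_vsucc intro: nu_subset_Infty)
  ultimately show "step_rel (vsucc p) a b" by (simp add: step_rel_def)
qed

text \<open>The predecessor of a limit is itself, so the target of a transition is a family, subject
  to the conditions on a branch of the tree of \<open>a\<close>.\<close>

lemma step_rel_branch: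
  assumes l: "Limit (l :: 'v::zfc)" and a: "a \<in> elts (nu \<kappa> l)"
    and y: "full_branch l (\<lambda>j. conn l (vsucc j) a) conn y"
  shows "step_rel l a (family l y)" and "j \<in> elts l \<Longrightarrow> conn l j (family l y) = y j"
proof -
  have ns: "\<not> is_succ l" using l by (simp add: Limit_def)
  have yj: "y j \<in> elts (conn l (vsucc j) a)" if "j \<in> elts l" for j
    using y that by (simp add: full_branch_def)
  show c: "conn l j (family l y) = y j" if "j \<in> elts l" for j
    using that ns by (simp add: conn_Limit)
  have "family l y \<in> elts (nu \<kappa> l)"
    using y level_tree(2)[OF l a] by (intro family_in_nu[OF ns]) (auto simp: full_branch_def)
  then show "step_rel l a (family l y)"
    using a yj c ns nu_subset_Infty by (auto simp: step_rel_def vpred_not_succ)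
qed

text \<open>The entries of \<open>b\<close> are elements of components of \<open>a\<close>; hence
  \<open>b\<close> belongs to the chain bounded by \<kappa>, although \<open>step_rel\<close> speaks
  of the full powerset chain.\<close>

lemma branch_step_rel:
  assumes l: "Limit (l :: 'v::zfc)" and a: "a \<in> elts (nu \<kappa> l)" and b: "step_rel l a b"
  shows "b \<in> elts (nu \<kappa> l)" and "full_branch l (\<lambda>j. conn l (vsucc j) a) conn (\<lambda>j. conn l j b)"
proof -
  have ns: "\<not> is_succ l" and Ol: "Ord l" using l by (simp_all add: Limit_def)
  have b': "b \<in> elts (nu Infty l)" "\<And>j. j \<in> elts l \<Longrightarrow> conn l j b \<in> elts (conn l (vsucc j) a)"
    using b ns by (auto simp: step_rel_def vpred_not_succ)
  have c: "conn j k (conn l j b) = conn l k b" if "j \<in> elts l" "ord_le k j" for j k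
    using conn_conn[OF Ol b'(1) _ that(2)] that by (simp add: ord_le_def)
  show "full_branch l (\<lambda>j. conn l (vsucc j) a) conn (\<lambda>j. conn l j b)"
    using b' c by (simp add: full_branch_def)
  have "family l (\<lambda>j. conn l j b) \<in> elts (nu \<kappa> l)"
    using b'(2) c level_tree(2)[OF l a] by (intro family_in_nu[OF ns]) blast+
  then show "b \<in> elts (nu \<kappa> l)" using nu_Limit_eta[OF ns b'(1)] by simp
qed

text \<open>The tree form of \<open>a_{k+1} = {b_k | a ~> b}\<close>, the equation by which
  \<open>approx\<close> and \<open>conn\<close> agree at index \<open>k + 1\<close> on level
  \<open>l\<close>.\<close>

definition branching :: "'v::zfc bound \<Rightarrow> 'v \<Rightarrow> bool" where
  "branching \<kappa> l \<longleftrightarrow> (\<forall>a \<in> elts (nu \<kappa> l). \<forall>k \<in> elts l. \<forall>c \<in> elts (conn l (vsucc k) a).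
     \<exists>y. full_branch l (\<lambda>j. conn l (vsucc j) a) conn y \<and> y k = c)"

section \<open>Injectivity of connecting maps and size of levels\<close>

text \<open>If \<open>u\<close> is in \<open>x\<close> but not in \<open>y\<close>, it differs from
  each element of \<open>y\<close> at some index below \<open>c\<close>. As \<open>y\<close> has
  fewer than \<open>c\<close> elements, regularity gives one \<open>b < c\<close> separating
  \<open>u\<close> from all of them; yet \<open>x\<close> and \<open>y\<close> have the same image
  under \<open>conn c b\<close>.\<close>

lemma conn_inj_vsucc:
  assumes c: "infinite_regular (c :: 'v::zfc)"
    and x: "x \<in> elts (nu (Card c) (vsucc c))" and y: "y \<in> elts (nu (Card c) (vsucc c))"
    and eq: "conn (vsucc c) c x = conn (vsucc c) c y"
  shows "elts x \<subseteq> elts y"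
proof
  have l: "Limit c" using c by (rule infinite_regular_Limit)
  then have Oc: "Ord c" and ns: "\<not> is_succ c" by (simp_all add: Limit_def)
  note Os = Oc[THEN Ord_vsucc]
  have sub: "elts x \<subseteq> elts (nu (Card c) c)" "elts y \<subseteq> elts (nu (Card c) c)" "|elts y| <o |elts c|"
    using x y by (auto simp: elts_nu_vsucc)
  have im: "conn c m ` elts x = conn c m ` elts y" if m: "m \<in> elts c" for m
  proof -
    have "ord_le (vsucc m) c" using vsucc_le_iff[OF Oc] m by blast
    moreover have "ord_le c (vsucc c)" by (simp add: ord_le_def)
    ultimately have "conn (vsucc c) (vsucc m) x = conn (vsucc c) (vsucc m) y"
      using conn_conn[OF Os x] conn_conn[OF Os y] eq by metis
    then show ?thesis unfolding conn_succ by (metis elts_dimage)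
  qed
  fix u assume u: "u \<in> elts x"
  show "u \<in> elts y"
  proof (rule ccontr)
    assume "u \<notin> elts y"
    have "\<exists>m. m \<in> elts c \<and> conn c m u \<noteq> conn c m v" if v: "v \<in> elts y" for v
    proof -
      have "u \<noteq> v" using v \<open>u \<notin> elts y\<close> by blast
      then show ?thesis using nu_Limit_ext[OF ns, of u "Card c" v] sub u v by blast
    qed
    then obtain g where g: "\<And>v. v \<in> elts y \<Longrightarrow> g v \<in> elts c \<and> conn c (g v) u \<noteq> conn c (g v) v"
      by metis
    have "|g ` elts y| <o |elts c|" using card_of_image sub(3) by (rule ordLeq_ordLess_trans)
    then obtain b where b: "b \<in> elts c" "\<And>v. v \<in> elts y \<Longrightarrow> g v \<in> elts b"
      using infinite_regular_bounded[OF c, of "g ` elts y"] g by blast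
    obtain v where v: "v \<in> elts y" "conn c b u = conn c b v" using im[OF b(1)] u by blast
    have bc: "ord_le b c" and gb: "ord_le (g v) b" using b v by (auto simp: ord_le_def)
    have "conn c (g v) u = conn c (g v) v"
      using conn_conn[OF Oc _ bc gb] sub u v by (metis subsetD)
    then show False using g v by blast
  qed
qed

text \<open>For \<open>j = p + 1\<close>, the projections to level \<open>c + 1\<close> coincide by
  \<open>conn_inj_vsucc\<close>, and direct image under the injective \<open>conn p c\<close> is
  injective. For a limit \<open>j\<close>, components from \<open>c\<close> on agree by induction,
  the earlier ones because they factor through level \<open>c\<close>.\<close>

lemma conn_inj:
  assumes c: "infinite_regular (c :: 'v::zfc)" and j: "Ord j" "ord_le c j"
  shows "inj_on (conn j c) (elts (nu (Card c) j))"
  using j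
proof (induction j rule: zfc_wf_induct)
  case (step j)
  show ?case
  proof (cases "j = c")
    case False
    then have cj: "c \<in> elts j" using step.prems by (simp add: ord_le_def)
    show ?thesis
    proof (cases "is_succ j")
      case True
      then obtain p where p: "j = vsucc p" by (auto simp: is_succ_def)
      have cp: "ord_le c p" and Op: "Ord p" using cj step.prems p by (auto simp: ord_le_def)
      have IH: "inj_on (conn p c) (elts (nu (Card c) p))" using step.IH[of p] cp Op p by simp
      have cc: "ord_le (vsucc c) (vsucc p)" using vsucc_le_vsucc[OF Op cp] .
      have c1: "ord_le c (vsucc c)" by (simp add: ord_le_def)
      show ?thesis
      proof (rule inj_onI)
        fix x y assume x: "x \<in> elts (nu (Card c) j)" and y: "y \<in> elts (nu (Card c) j)"
          and eq: "conn j c x = conn j c y"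
        let ?f = "conn (vsucc p) (vsucc c)"
        have fx: "?f x \<in> elts (nu (Card c) (vsucc c))" "?f y \<in> elts (nu (Card c) (vsucc c))"
          using conn_in_nu[OF _ _ cc] x y step.prems p by blast+
        have "conn (vsucc c) c (?f x) = conn (vsucc c) c (?f y)"
          using conn_conn[OF _ _ cc c1] x y eq step.prems p by metis
        then have "elts (?f x) = elts (?f y)"
          using conn_inj_vsucc[OF c] fx by (metis subset_antisym)
        then have "conn p c ` elts x = conn p c ` elts y" by (simp add: conn_succ)
        then have "elts x = elts y"
          using IH x y p by (metis elts_nu_vsucc inj_on_image_eq_iff)
        then show "x = y" by (rule zfc_extensionality)
      qed
    next
      case False
      show ?thesis
      proof (rule inj_onI)
        fix x y assume x: "x \<in> elts (nu (Card c) j)" and y: "y \<in> elts (nu (Card c) j)"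
          and eq: "conn j c x = conn j c y"
        show "x = y"
        proof (rule nu_Limit_ext[OF False x y])
          fix k assume k: "k \<in> elts j"
          have Ok: "Ord k" and Oc: "Ord c" and kj: "ord_le k j"
            using step.prems k cj Ord_mem by (auto simp: ord_le_def)
          note cx = conn_conn[OF step.prems(1) x] conn_conn[OF step.prems(1) y]
            conn_in_nu[OF step.prems(1) x kj] conn_in_nu[OF step.prems(1) y kj]
          show "conn j k x = conn j k y"
          proof (cases "ord_le c k")
            case True
            have "conn k c (conn j k x) = conn k c (conn j k y)"
              using cx(1,2)[OF kj True] eq by simp
            then show ?thesis using step.IH[OF k Ok True] cx(3,4) by (meson inj_onD)
          next
            case False
            then have "ord_le k c" using ord_le_total Ok Oc by blast
            then show ?thesis using cx(1,2)[OF step.prems(2)] eq by metis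
          qed
        qed
      qed
    qed
  qed (simp add: inj_on_def)
qed

text \<open>An element of a limit level is a set of pairs of an index \<open>k\<close> and an
  element of level \<open>k\<close>. Regularity bounds the number of such pairs, inaccessibility the
  number of sets of them.\<close>

lemma card_nu_less_inaccessible:
  assumes l: "strongly_inaccessible (l :: 'v::zfc)"
  shows "j \<in> elts l \<Longrightarrow> |elts (nu Infty j)| <o |elts l|"
proof (induction j rule: zfc_wf_induct)
  case (step j)
  have reg: "infinite_regular l" using l by (simp add: strongly_inaccessible_def)
  have Ol: "Ord l" and inf: "infinite (elts l)"
    using reg by (auto simp: infinite_regular_def Cardinal_def)
  have pow: "|{y. elts y \<subseteq> elts x}| <o |elts l|" if "|elts x| <o |elts l|" for x :: 'v
    using l that by (simp add: strongly_inaccessible_def)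
  show ?case
  proof (cases "is_succ j")
    case True
    then obtain p where p: "j = vsucc p" by (auto simp: is_succ_def)
    then have "p \<in> elts l" using step.prems Ord_trans[OF Ol] by simp
    then have "|elts (nu Infty p)| <o |elts l|" using step.IH p by simp
    from pow[OF this] show ?thesis by (simp add: p nu_succ)
  next
    case False
    let ?Z = "\<Union>k\<in>elts j. vpair k ` elts (nu Infty k)"
    have jl: "|elts j| <o |elts l|"
      using reg step.prems by (simp add: infinite_regular_def Cardinal_def)
    have "|?Z| <o |elts l|"
    proof (rule stable_UNION[OF infinite_regular_stable[OF reg] jl])
      fix k assume k: "k \<in> elts j"
      then have "|elts (nu Infty k)| <o |elts l|" using step Ord_trans[OF Ol] by blast
      then show "|vpair k ` elts (nu Infty k)| <o |elts l|"
        by (rule ordLeq_ordLess_trans[OF card_of_image])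
    qed
    moreover have sm: "small ?Z" by (intro small_Union small_image small_elts)
    ultimately have "|{y. elts y \<subseteq> ?Z}| <o |elts l|" using pow[of "vset ?Z"] by simp
    moreover have "elts (nu Infty j) \<subseteq> {y. elts y \<subseteq> ?Z}"
      unfolding elts_nu_Limit[OF False] by (auto simp del: elts_vpair) blast
    ultimately show ?thesis using card_of_mono1 ordLeq_ordLess_trans by blast
  qed
qed

lemma extensible_branching:
  assumes \<kappa>: "regular_or_infty \<kappa>" and l: "Limit (l :: 'v::zfc)" and ext: "extensible \<kappa> l"
  shows "branching \<kappa> l"
  unfolding branching_def
proof (intro ballI)
  fix a n c assume a: "a \<in> elts (nu \<kappa> l)" and n: "n \<in> elts l" and c: "c \<in> elts (conn l (vsucc n) a)"
  let ?D = "\<lambda>j. conn l (vsucc j) a"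
  note T = level_tree(1)[OF l a] and D = level_tree(2)[OF l a]
  have Ol: "Ord l" using l by (simp add: Limit_def)
  have uniq: "x = y"
    if "i \<in> elts l" "Limit i" "x \<in> elts (?D i)" "y \<in> elts (?D i)"
      "\<And>j. j \<in> elts i \<Longrightarrow> conn i j x = conn i j y" for i x y
    using that D[OF that(1)] nu_Limit_ext[of i x \<kappa> y] by (auto simp: Limit_def)
  \<comment> \<open>Three sources of branches suffice: 0 has no nodes, and the weakly compact case
    and the case \<open>l = \<kappa>\<close> both provide small levels for the tree
    property.\<close>
  consider (w) "omega_cofinal l" | (t) "tree_property l" "\<And>i. i \<in> elts l \<Longrightarrow> |elts (?D i)| <o |elts l|"
    | (k) m where "\<kappa> = Card m" "m \<in> elts l"
  proof -
    have "l \<noteq> vempty" using n by auto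
    then consider "omega_cofinal l" | "weakly_compact l"
      | m where "\<kappa> = Card m" "ord_le (ord_add m omega) l" | "\<kappa> = Card l" "tree_property l"
      using ext unfolding extensible_def by blast
    then show thesis
    proof cases
      case 2
      have "|elts (?D i)| <o |elts l|" if i: "i \<in> elts l" for i
      proof -
        have "elts (?D i) \<subseteq> elts (nu Infty i)" using D[OF i] nu_subset_Infty by blast
        moreover have "|elts (nu Infty i)| <o |elts l|"
          using 2 i by (intro card_nu_less_inaccessible) (simp_all add: weakly_compact_def)
        ultimately show ?thesis using card_of_mono1 ordLeq_ordLess_trans by blast
      qed
      then show thesis using 2 t by (simp add: weakly_compact_def)
    next
      case (3 m)
      have "(vempty :: 'v) \<in> range ord_of_nat" by (metis ord_of_nat.simps(1) rangeI)
      then have "ord_add m vempty \<in> elts (ord_add m omega)"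
        by (simp add: elts_ord_add omega_def small_range_ord_of_nat)
      then have "m \<in> elts l" using mem_ord_le_trans[OF Ol _ 3(2)] by (simp add: ord_add_empty)
      then show thesis using 3 k by blast
    next
      case 4
      then show thesis using D t by simp
    qed (rule w)
  qed
  then show "\<exists>y. full_branch l ?D conn y \<and> y n = c"
  proof cases
    case w
    then show ?thesis using branch_through_omega_cofinal[OF T _ n c] by blast
  next
    case t
    then show ?thesis using branch_through_tree_property[OF T _ n c] uniq by blast
  next
    case (k m)
    have "inj_on (conn j m) (elts (?D j))" if j: "j \<in> elts l" "ord_le m j" for j
      using conn_inj[of m j] \<kappa> k j D[OF j(1)] Ord_mem[OF Ol] by (auto intro: inj_on_subset)
    then show ?thesis using branch_through_injective[OF T Ol n c k(2)] by blast
  qed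
qed

section \<open>Agreement of approximations and projections\<close>

lemma approx_level_vsucc:
  assumes "ord_le k i" "Ord (j :: 'v::zfc)"
  shows "elts (approx (level_system i) (vsucc j) (k, a)) =
    {approx (level_system i) j (vpred k, b) | b. step_rel k a b}"
  using assms by (auto simp: elts_approx_succ level_system_def)

text \<open>The height \<open>i\<close> of the ambient system is kept apart from the level
  \<open>k\<close>, so that inductions on levels stay within one transition system.\<close>

definition faithful :: "'v::zfc bound \<Rightarrow> 'v \<Rightarrow> 'v \<Rightarrow> 'v \<Rightarrow> bool" where
  "faithful \<kappa> i k j \<longleftrightarrow> (\<forall>a \<in> elts (nu \<kappa> k). approx (level_system i) j (k, a) = conn k j a)"

lemma faithful_Limit:
  assumes "Ord k" "ord_le j k" "\<not> is_succ (j :: 'v::zfc)" "\<And>m. m \<in> elts j \<Longrightarrow> faithful \<kappa> i k m"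
  shows "faithful \<kappa> i k j"
  unfolding faithful_def
proof
  fix a assume a: "a \<in> elts (nu \<kappa> k)"
  have "family j (\<lambda>m. approx (level_system i) m (k, a)) = family j (\<lambda>m. conn k m a)"
    using assms(4) a unfolding faithful_def by (intro family_cong) auto
  then show "approx (level_system i) j (k, a) = conn k j a"
    using approx_Limit[OF assms(3)] conn_to_Limit[OF assms(1) a assms(2,3)] by metis
qed

text \<open>Transitions from a successor level are membership, so both sides are direct images of
  \<open>a\<close> under maps that agree on level \<open>k\<close>.\<close>

lemma faithful_vsucc:
  assumes k: "Ord (k :: 'v::zfc)" "ord_le (vsucc k) i" and j: "ord_le j k" and f: "faithful \<kappa> i k j"
  shows "faithful \<kappa> i (vsucc k) (vsucc j)"
  unfolding faithful_def
proof
  fix a assume a: "a \<in> elts (nu \<kappa> (vsucc k))"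
  have "elts (approx (level_system i) (vsucc j) (vsucc k, a)) =
      {approx (level_system i) j (k, b) | b. b \<in> elts a}"
    using approx_level_vsucc[OF k(2) ord_le_Ord[OF k(1) j], of a] step_rel_vsucc[OF k(1) a] by simp
  also have "\<dots> = elts (conn (vsucc k) (vsucc j) a)"
  proof -
    have "approx (level_system i) j (k, b) = conn k j b" if "b \<in> elts a" for b
      using f a that unfolding faithful_def elts_nu_vsucc by blast
    then show ?thesis unfolding conn_succ elts_dimage image_def by metis
  qed
  finally show "approx (level_system i) (vsucc j) (vsucc k, a) = conn (vsucc k) (vsucc j) a"
    by (rule zfc_extensionality)
qed

lemma Ord_limit_add: "Limit l \<Longrightarrow> Ord (ord_add l (ord_of_nat n) :: 'v::zfc)"
  by (induction n) (auto simp: ord_add_empty ord_add_vsucc Limit_def)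

lemma ord_of_nat_le_add:
  "Limit l \<Longrightarrow> m \<le> n \<Longrightarrow> ord_le (ord_of_nat m) (ord_add l (ord_of_nat n) :: 'v::zfc)"
proof (induction n arbitrary: m)
  case 0
  then show ?case by (simp add: ord_add_empty vempty_le Limit_def)
next
  case (Suc n)
  show ?case
  proof (cases m)
    case 0
    then show ?thesis using vempty_le[OF Ord_limit_add[OF Suc.prems(1), of "Suc n"]] by simp
  next
    case (Suc m')
    then show ?thesis
      using vsucc_le_vsucc[OF Ord_limit_add[OF Suc.prems(1)] Suc.IH[OF Suc.prems(1), of m']] Suc.prems(2)
      by (simp add: ord_add_vsucc)
  qed
qed

text \<open>Every successor above \<open>l\<close> gains one index, starting from index 0, which
  carries a single value.\<close>

lemma faithful_FP:
  fixes l :: "'v::zfc"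
  assumes "Limit l" "Ord i"
  shows "ord_le (ord_add l (ord_of_nat n)) i \<Longrightarrow> m \<le> n \<Longrightarrow>
    faithful \<kappa> i (ord_add l (ord_of_nat n)) (ord_of_nat m)"
proof (induction n arbitrary: m)
  case 0
  then show ?case using assms
    by (auto simp: ord_add_empty Limit_def vempty_le intro: faithful_Limit)
next
  case (Suc n)
  let ?k = "ord_add l (ord_of_nat n)"
  have Os: "Ord (vsucc ?k)" and si: "ord_le (vsucc ?k) i"
    using Suc.prems(1) Ord_limit_add[OF assms(1)] by (auto simp: ord_add_vsucc)
  then have Ok: "Ord ?k" by simp
  have ki: "ord_le ?k i" using ord_le_trans[OF assms(2) _ si] by (simp add: ord_le_def)
  show ?case
  proof (cases m)
    case 0
    then show ?thesis using Os vempty_le[OF Os]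
      by (auto simp: ord_add_vsucc intro: faithful_Limit)
  next
    case (Suc m')
    have IH: "faithful \<kappa> i ?k (ord_of_nat m')" using Suc.IH[OF ki] Suc.prems Suc by simp
    have "ord_le (ord_of_nat m') ?k"
      using ord_of_nat_le_add[OF assms(1)] Suc.prems(2) Suc by simp
    then show ?thesis using faithful_vsucc[OF Ok si _ IH] Suc by (simp add: ord_add_vsucc)
  qed
qed

text \<open>Transitions from a limit level stay on that level, so the induction runs over the index
  alone. At \<open>m + 1\<close> the approximation collects the entries at \<open>m\<close> of all
  branches, and by \<open>branching\<close> these fill the whole component.\<close>

lemma faithful_branching:
  assumes l: "Limit (l :: 'v::zfc)" and i: "Ord i" "ord_le l i" and b: "branching \<kappa> l"
  shows "ord_le j l \<Longrightarrow> faithful \<kappa> i l j"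
proof (induction j rule: zfc_wf_induct)
  case (step j)
  have Ol: "Ord l" and ns: "\<not> is_succ l" using l by (simp_all add: Limit_def)
  show ?case
  proof (cases "is_succ j")
    case True
    then obtain m where m: "j = vsucc m" by (auto simp: is_succ_def)
    have ml: "m \<in> elts l" "Ord m" using step.prems m vsucc_le_iff[OF Ol] Ord_mem[OF Ol] by auto
    have IH: "faithful \<kappa> i l m" using step.IH[of m] m ml by (simp add: ord_le_def)
    show ?thesis
      unfolding faithful_def
    proof
      fix a assume a: "a \<in> elts (nu \<kappa> l)"
      have e: "elts (approx (level_system i) j (l, a)) =
          {approx (level_system i) m (l, b) | b. step_rel l a b}"
        using approx_level_vsucc[OF i(2) ml(2)] m vpred_not_succ[OF ns] by simp
      also have "\<dots> = {conn l m b | b. step_rel l a b}"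
        using IH branch_step_rel(1)[OF l a] unfolding faithful_def by metis
      also have "\<dots> = elts (conn l j a)"
      proof (intro subset_antisym subsetI)
        fix x assume "x \<in> {conn l m b | b. step_rel l a b}"
        then show "x \<in> elts (conn l j a)"
          using branch_step_rel(2)[OF l a] ml m by (auto simp: full_branch_def)
      next
        fix x assume "x \<in> elts (conn l j a)"
        then obtain y where "full_branch l (\<lambda>j. conn l (vsucc j) a) conn y" "y m = x"
          using b a ml m unfolding branching_def by blast
        then show "x \<in> {conn l m b | b. step_rel l a b}"
          using step_rel_branch[OF l a] ml(1) by (intro CollectI exI[of _ "family l y"]) simp
      qed
      finally show "approx (level_system i) j (l, a) = conn l j a" by (rule zfc_extensionality)
    qed
  next
    case False
    have "ord_le m l" if "m \<in> elts j" for m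
      using ord_le_trans[OF Ol _ step.prems] that by (simp add: ord_le_def)
    then show ?thesis using faithful_Limit[OF Ol step.prems False] step.IH by blast
  qed
qed

lemma faithful_all_vsucc:
  assumes k: "Ord (k :: 'v::zfc)" "ord_le (vsucc k) i" and f: "\<And>j. ord_le j k \<Longrightarrow> faithful \<kappa> i k j"
  shows "ord_le j (vsucc k) \<Longrightarrow> faithful \<kappa> i (vsucc k) j"
proof (induction j rule: zfc_wf_induct)
  case (step j)
  show ?case
  proof (cases "is_succ j")
    case True
    then obtain m where m: "j = vsucc m" by (auto simp: is_succ_def)
    then have "ord_le m k" using step.prems Ord_vsucc_le k(1) by auto
    then show ?thesis using faithful_vsucc[OF k _ f] m by blast
  next
    case False
    have "ord_le m (vsucc k)" if "m \<in> elts j" for m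
      using ord_le_trans[OF _ _ step.prems] k(1) that by (simp add: ord_le_def)
    then show ?thesis using faithful_Limit[OF _ step.prems False] step.IH k(1) by simp
  qed
qed

lemma faithful_branching_add:
  assumes l: "Limit (l :: 'v::zfc)" and i: "Ord i" and b: "branching \<kappa> l"
  shows "ord_le (ord_add l (ord_of_nat n)) i \<Longrightarrow> ord_le j (ord_add l (ord_of_nat n)) \<Longrightarrow>
    faithful \<kappa> i (ord_add l (ord_of_nat n)) j"
proof (induction n arbitrary: j)
  case 0
  then show ?case using faithful_branching[OF l i _ b] by (simp add: ord_add_empty)
next
  case (Suc n)
  let ?k = "ord_add l (ord_of_nat n)"
  have si: "ord_le (vsucc ?k) i" using Suc.prems by (simp add: ord_add_vsucc)
  then have "Ord (vsucc ?k)" by (rule ord_le_Ord[OF i])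
  moreover have "ord_le ?k i" using ord_le_trans[OF i _ si] by (simp add: ord_le_def)
  ultimately show ?case using faithful_all_vsucc[OF _ si Suc.IH] Suc.prems by (simp add: ord_add_vsucc)
qed

section \<open>Sets as pointed systems\<close>

text \<open>Membership makes the universe a transition system, so elements of the chain can be
  produced by writing down sets.\<close>

definition approx_set :: "'v::zfc \<Rightarrow> 'v \<Rightarrow> 'v" where
  "approx_set i x = approx {(x, y). y \<in> elts x} i x"

lemma elts_approx_set_vsucc:
  "Ord i \<Longrightarrow> elts (approx_set (vsucc i) x) = approx_set i ` elts (x :: 'v::zfc)"
  by (auto simp: approx_set_def elts_approx_succ)

lemma approx_set_Limit:
  "\<not> is_succ i \<Longrightarrow> approx_set i x = family i (\<lambda>j. approx_set j (x :: 'v::zfc))"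
  unfolding approx_set_def by (rule approx_Limit)

lemma conn_approx_set:
  "Ord i \<Longrightarrow> ord_le j i \<Longrightarrow> conn i j (approx_set i x) = approx_set j (x :: 'v::zfc)"
  unfolding approx_set_def by (rule approx_in_nu(2))

lemma approx_set_eq_le:
  "Ord i \<Longrightarrow> ord_le j i \<Longrightarrow> approx_set i x = approx_set i y \<Longrightarrow> approx_set j x = approx_set j (y :: 'v::zfc)"
  using conn_approx_set by metis

text \<open>At a successor \<open>p + 1\<close> the premise at \<open>p\<close> is the claim; at a
  limit the value is a family of earlier values, to which the premises at all \<open>j < i\<close>
  let the induction pass.\<close>

lemma approx_set_eqI:
  assumes i: "Ord (i :: 'v::zfc)" and eq: "\<And>j. j \<in> elts i \<Longrightarrow> approx_set j ` elts x = approx_set j ` elts y"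
  shows "approx_set i x = approx_set i y"
  using assms
proof (induction i rule: zfc_wf_induct)
  case (step i)
  show ?case
  proof (cases "is_succ i")
    case True
    then obtain p where p: "i = vsucc p" by (auto simp: is_succ_def)
    have "elts (approx_set i x) = elts (approx_set i y)"
      using step.prems p by (simp add: elts_approx_set_vsucc)
    then show ?thesis by (rule zfc_extensionality)
  next
    case False
    have "approx_set j x = approx_set j y" if "j \<in> elts i" for j
      using step.IH[OF that Ord_mem[OF step.prems(1) that]] step.prems(2) Ord_trans[OF step.prems(1) that]
      by blast
    then show ?thesis unfolding approx_set_Limit[OF False] by (intro family_cong) auto
  qed
qed

section \<open>Approximations of ordinals\<close>

text \<open>At an index \<open>j < i\<close>, elements from \<open>j\<close> on all look like
  \<open>j\<close>, by induction, so every ordinal above \<open>j\<close> shows the same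
  approximations of elements as \<open>j + 1\<close>.\<close>

lemma approx_set_Ord_trunc:
  "Ord i \<Longrightarrow> Ord a \<Longrightarrow> ord_le i a \<Longrightarrow> approx_set i a = approx_set i (i :: 'v::zfc)"
proof (induction i arbitrary: a rule: zfc_wf_induct)
  case (step i)
  show ?case
  proof (rule approx_set_eqI[OF step.prems(1)])
    fix j assume j: "j \<in> elts i"
    have Oj: "Ord j" using Ord_mem[OF step.prems(1) j] .
    have ja: "j \<in> elts a" using mem_ord_le_trans[OF step.prems(2) j step.prems(3)] .
    have tr: "approx_set j b = approx_set j j" if "b \<in> elts c" "Ord c" "ord_le j b" for b c
      using step.IH[OF j Oj _ that(3)] that Ord_mem by blast
    have "approx_set j ` elts c = approx_set j ` elts (vsucc j)" if c: "Ord c" "j \<in> elts c" for c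
    proof (intro subset_antisym image_subsetI)
      fix b assume b: "b \<in> elts c"
      show "approx_set j b \<in> approx_set j ` elts (vsucc j)"
      proof (cases "b \<in> elts j")
        case False
        then have "ord_le j b" using Ord_not_mem_iff Oj Ord_mem[OF c(1) b] by blast
        then show ?thesis using tr[OF b c(1)] by simp
      qed simp
    next
      fix b assume "b \<in> elts (vsucc j)"
      then have "b \<in> elts c" using c Ord_trans by auto
      then show "approx_set j b \<in> approx_set j ` elts c" by blast
    qed
    then show "approx_set j ` elts a = approx_set j ` elts i"
      using ja j step.prems by metis
  qed
qed

text \<open>Equality would persist at index \<open>a + 1\<close> and make \<open>a\<close> look, at
  index \<open>a\<close>, like some \<open>c < a\<close>, which the induction hypothesis for
  \<open>c\<close> forbids.\<close>

lemma approx_set_Ord_less: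
  "a \<in> elts b \<Longrightarrow> Ord b \<Longrightarrow> Ord i \<Longrightarrow> a \<in> elts i \<Longrightarrow> approx_set i a \<noteq> approx_set i (b :: 'v::zfc)"
proof (induction a arbitrary: b i rule: zfc_wf_induct)
  case (step a)
  show ?case
  proof
    assume eq: "approx_set i a = approx_set i b"
    have Oa: "Ord a" using step.prems Ord_mem by blast
    have "ord_le (vsucc a) i" using step.prems vsucc_le_iff by blast
    then have "approx_set (vsucc a) a = approx_set (vsucc a) b"
      using approx_set_eq_le[OF step.prems(3) _ eq] by blast
    then have "approx_set a ` elts a = approx_set a ` elts b"
      using elts_approx_set_vsucc[OF Oa] by metis
    then obtain c where c: "c \<in> elts a" "approx_set a a = approx_set a c"
      using step.prems(1) by blast
    then show False using step.IH[OF c(1) c(1) Oa Oa c(1)] by simp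
  qed
qed

text \<open>Only \<open>a\<close> is confined to \<open>i\<close>: a small ordinal is told apart
  from all ordinals, as decoding against an unknown \<open>b\<close> requires.\<close>

lemma approx_set_Ord_inj:
  assumes "Ord i" "Ord b" "a \<in> elts i" "approx_set i a = approx_set i (b :: 'v::zfc)"
  shows "a = b"
proof -
  have Oa: "Ord a" using assms Ord_mem by blast
  consider "a \<in> elts b" | "a = b" | "b \<in> elts a" using Ord_linear[OF Oa assms(2)] by blast
  then show ?thesis
  proof cases
    case 1
    then show ?thesis using approx_set_Ord_less[OF 1 assms(2,1,3)] assms(4) by simp
  next
    case 3
    then show ?thesis
      using approx_set_Ord_less[OF 3 Oa assms(1) Ord_trans[OF assms(1,3) 3]] assms(4) by simp
  qed
qed

text \<open>A semantic substitute for hereditary size below \<kappa>, which implies it through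
  \<open>hereditaryI\<close>.\<close>

definition hereditary :: "'v::zfc bound \<Rightarrow> 'v \<Rightarrow> bool" where
  "hereditary \<kappa> x \<longleftrightarrow> (\<forall>i. Ord i \<longrightarrow> approx_set i x \<in> elts (nu \<kappa> i))"

lemma size_less_image:
  "size_less x \<kappa> \<Longrightarrow> elts y \<subseteq> f ` elts (x :: 'v::zfc) \<Longrightarrow> size_less y \<kappa>"
  by (cases \<kappa>) (auto dest: card_of_mono1 intro: ordLeq_ordLess_trans ordLeq_transitive[OF _ card_of_image])

lemma hereditaryI:
  assumes "\<And>y. y \<in> elts x \<Longrightarrow> hereditary \<kappa> y" and "size_less (x :: 'v::zfc) \<kappa>"
  shows "hereditary \<kappa> x"
  unfolding hereditary_def
proof (intro allI)
  fix i :: 'v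
  show "Ord i \<longrightarrow> approx_set i x \<in> elts (nu \<kappa> i)"
  proof (induction i rule: zfc_wf_induct)
    case (step i)
    show ?case
    proof
      assume i: "Ord i"
      show "approx_set i x \<in> elts (nu \<kappa> i)"
      proof (cases "is_succ i")
        case True
        then obtain p where p: "i = vsucc p" by (auto simp: is_succ_def)
        then have Op: "Ord p" using i by simp
        have "size_less (approx_set i x) \<kappa>"
          using elts_approx_set_vsucc[OF Op] p
          by (intro size_less_image[OF assms(2), of _ "approx_set p"]) simp
        then show ?thesis
          using assms(1) p Op by (auto simp: elts_nu_vsucc elts_approx_set_vsucc hereditary_def)
      next
        case False
        show ?thesis
          unfolding approx_set_Limit[OF False]
          using step i Ord_mem[OF i] conn_approx_set by (intro family_in_nu[OF False]) blast+
      qed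
    qed
  qed
qed

section \<open>Elements without transitions\<close>

text \<open>
  The functions \<open>f\<close> with \<open>F j f\<close> are the branches of length \<open>j\<close> of an abstract tree of height \<open>i\<close>,
  and a branch is coded by the set of all \<open>E k (f k)\<close>, \<open>k \<le> j\<close>. An approximation of index at most \<open>k\<close>
  cannot distinguish the codes of entries at positions \<open>k\<close> and above (\<open>hidden\<close>), so level \<open>j\<close> of the
  resulting element sees exactly the branches of length \<open>j\<close>; yet each entry is recovered at
  some later level (\<open>visible\<close>), so that a transition would produce a branch of length \<open>i\<close>.
\<close>

lemma element_without_transition:
  fixes i :: "'v::zfc" and F :: "'v \<Rightarrow> ('v \<Rightarrow> 'v) \<Rightarrow> bool"
  assumes i: "Limit i" "i \<noteq> vempty"
    and restrict: "\<And>j k f. j \<in> elts i \<Longrightarrow> F j f \<Longrightarrow> ord_le k j \<Longrightarrow> F k f"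
    and cong: "\<And>j f g. j \<in> elts i \<Longrightarrow> F j f \<Longrightarrow> (\<And>k. ord_le k j \<Longrightarrow> f k = g k) \<Longrightarrow> F j g"
    and extend: "\<And>j k f. j \<in> elts i \<Longrightarrow> ord_le k j \<Longrightarrow> F k f \<Longrightarrow> \<exists>g. F j g \<and> (\<forall>m. ord_le m k \<longrightarrow> g m = f m)"
    and nonempty: "\<exists>f. F vempty f"
    and hidden: "\<And>j k k' f f'. k \<in> elts i \<Longrightarrow> k' \<in> elts i \<Longrightarrow> ord_le j k \<Longrightarrow> ord_le j k' \<Longrightarrow>
        F k f \<Longrightarrow> F k' f' \<Longrightarrow> approx_set j (E k (f k)) = approx_set j (E k' (f' k'))"
    and visible: "\<And>j. j \<in> elts i \<Longrightarrow> \<exists>t\<in>elts i. \<forall>k k' f f'. ord_le k j \<longrightarrow> k' \<in> elts i \<longrightarrow>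
        F k f \<longrightarrow> F k' f' \<longrightarrow> approx_set t (E k (f k)) = approx_set t (E k' (f' k')) \<longrightarrow>
        f k = f' k' \<and> k = k'"
    and hereditary: "\<And>k f. k \<in> elts i \<Longrightarrow> F k f \<Longrightarrow> hereditary \<kappa> (E k (f k))"
    and size: "\<And>j. j \<in> elts i \<Longrightarrow> size_less (vsucc j) \<kappa>"
    and levels: "\<And>j. j \<in> elts i \<Longrightarrow>
        \<exists>Z. elts Z = {vset ((\<lambda>k. E k (f k)) ` elts (vsucc j)) | f. F j f} \<and> size_less Z \<kappa>"
    and no_branch: "\<And>f. \<exists>j\<in>elts i. \<not> F j f"
  shows "\<exists>a\<in>elts (nu \<kappa> i). elts (conn i (vsucc vempty) a) \<noteq> {} \<and> (\<forall>b. \<not> step_rel i a b)"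
proof -
  have Oi: "Ord i" and ns: "\<not> is_succ i" using i by (simp_all add: Limit_def)
  define c where "c f j = vset ((\<lambda>k. E k (f k)) ` elts (vsucc j))" for f j
  have elts_c: "elts (c f j) = (\<lambda>k. E k (f k)) ` elts (vsucc j)" for f j
    unfolding c_def by (intro elts_vset small_image small_elts)
  have "\<exists>Z. \<forall>j\<in>elts i. elts (Z j) = {c f j | f. F j f} \<and> size_less (Z j) \<kappa>"
    unfolding c_def using levels by (intro bchoice ballI)
  then obtain Z where Z: "\<And>j. j \<in> elts i \<Longrightarrow> elts (Z j) = {c f j | f. F j f}"
    and Zs: "\<And>j. j \<in> elts i \<Longrightarrow> size_less (Z j) \<kappa>" by blast
  \<comment> \<open>Entries beyond \<open>m\<close> look, at indices below \<open>m\<close>, like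
    the entry at \<open>m\<close>, so the code of a branch and that of its restriction agree at
    index \<open>m\<close>.\<close>
  have cc: "approx_set m (c f j) = approx_set m (c g m)"
    if m: "ord_le m j" "j \<in> elts i" and f: "F j f" and g: "F m g" "\<And>k. ord_le k m \<Longrightarrow> g k = f k" for m j f g
  proof (rule approx_set_eqI)
    have mi: "m \<in> elts i" using ord_le_mem_trans[OF Oi m] .
    show Om: "Ord m" using Ord_mem[OF Oi mi] .
    have Oj: "Ord j" using Ord_mem[OF Oi m(2)] .
    fix n assume n: "n \<in> elts m"
    have nm: "ord_le n m" using n by (simp add: ord_le_def)
    have mem: "approx_set n (E k (g k)) \<in> approx_set n ` elts (c g m)" if "ord_le k m" for k
      using that unfolding elts_c mem_vsucc_iff[symmetric] by blast
    have memj: "approx_set n (E k (f k)) \<in> approx_set n ` elts (c f j)" if "ord_le k j" for k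
      using that unfolding elts_c mem_vsucc_iff[symmetric] by blast
    have "approx_set n (E k (f k)) \<in> approx_set n ` elts (c g m)" if k: "ord_le k j" for k
    proof (cases "ord_le k m")
      case True
      then show ?thesis using mem[OF True] g(2)[OF True] by simp
    next
      case False
      have Ok: "Ord k" using k Oj ord_le_Ord by blast
      then have "ord_le m k" using False ord_le_total Om by blast
      then have "ord_le n k" using ord_le_trans Ok nm by blast
      moreover have "k \<in> elts i" using ord_le_mem_trans[OF Oi k m(2)] .
      ultimately have "approx_set n (E k (f k)) = approx_set n (E m (g m))"
        using hidden[of k m n f g] nm mi restrict[OF m(2) f k] g(1) by simp
      then show ?thesis using mem[of m] by simp
    qed
    moreover have "approx_set n (E k (g k)) \<in> approx_set n ` elts (c f j)" if k: "ord_le k m" for k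
      using memj[OF ord_le_trans[OF Oj k m(1)]] g(2)[OF k] by simp
    ultimately show "approx_set n ` elts (c f j) = approx_set n ` elts (c g m)"
      unfolding elts_c by (auto simp: mem_vsucc_iff simp del: elts_vsucc)
  qed
  \<comment> \<open>Restriction gives one inclusion; the other rests on the extension of shorter
    branches.\<close>
  have im: "approx_set m ` elts (Z j) = approx_set m ` elts (Z m)"
    if m: "ord_le m j" "j \<in> elts i" for m j
  proof -
    have mi: "m \<in> elts i" using ord_le_mem_trans[OF Oi m] .
    have "approx_set m (c f j) \<in> approx_set m ` elts (Z m)" if "F j f" for f
      using cc[OF m that restrict[OF m(2) that m(1)]] Z[OF mi] restrict[OF m(2) that m(1)] by blast
    moreover have "approx_set m (c g m) \<in> approx_set m ` elts (Z j)" if g: "F m g" for g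
    proof -
      obtain f where f: "F j f" "\<And>k. ord_le k m \<Longrightarrow> f k = g k" using extend[OF m(2,1) g] by blast
      have "approx_set m (c f j) = approx_set m (c g m)"
        by (rule cc[OF m f(1) g f(2)[symmetric]])
      moreover have "c f j \<in> elts (Z j)" using Z[OF m(2)] f(1) by blast
      ultimately show ?thesis by (metis imageI)
    qed
    ultimately show ?thesis unfolding Z[OF m(2)] Z[OF mi] by blast
  qed
  \<comment> \<open>The sets \<open>Z j\<close> only become compatible after approximation; the
    resulting family is the element \<open>a\<close>.\<close>
  define y where "y j = approx_set j (Z j)" for j
  have y: "conn j m (y j) = y m" if "j \<in> elts i" "ord_le m j" for j m
  proof -
    have Oj: "Ord j" and Om: "Ord m" using that Ord_mem[OF Oi] ord_le_Ord by blast+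
    have "approx_set n ` elts (Z j) = approx_set n ` elts (Z m)" if n: "n \<in> elts m" for n
      using im[of n j] im[of n m] ord_le_trans[OF Oj, of n m] that \<open>j \<in> elts i\<close> \<open>ord_le m j\<close>
        ord_le_mem_trans[OF Oi, of m j] by (simp add: ord_le_def)
    then have "approx_set m (Z j) = approx_set m (Z m)" using approx_set_eqI[OF Om] by blast
    then show ?thesis using conn_approx_set[OF Oj that(2)] by (simp add: y_def)
  qed
  have hZ: "hereditary \<kappa> (Z j)" if j: "j \<in> elts i" for j
  proof (rule hereditaryI[OF _ Zs[OF j]])
    fix x assume "x \<in> elts (Z j)"
    then obtain f where f: "x = c f j" "F j f" using Z[OF j] by blast
    have "size_less x \<kappa>" using size_less_image[OF size[OF j]] elts_c[of f j] f by blast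
    moreover have "hereditary \<kappa> u" if "u \<in> elts x" for u
    proof -
      obtain k where k: "ord_le k j" "u = E k (f k)"
        using \<open>u \<in> elts x\<close> f elts_c[of f j] mem_vsucc_iff by blast
      then show ?thesis using hereditary[of k f] restrict[OF j f(2)] ord_le_mem_trans[OF Oi _ j] by simp
    qed
    ultimately show "hereditary \<kappa> x" by (rule hereditaryI[rotated])
  qed
  define a where "a = family i y"
  have a: "a \<in> elts (nu \<kappa> i)"
    unfolding a_def using hZ y Ord_mem[OF Oi]
    by (intro family_in_nu[OF ns]) (auto simp: y_def hereditary_def)
  \<comment> \<open>Component \<open>j + 1\<close> of \<open>a\<close> comes from
    \<open>Z (j + 1)\<close>, which at index \<open>j\<close> looks like \<open>Z j\<close>.\<close>
  have ca: "elts (conn i (vsucc j) a) = {approx_set j (c f j) | f. F j f}" if j: "j \<in> elts i" for j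
  proof -
    have sj: "vsucc j \<in> elts i" using Limit_vsucc_mem i j by blast
    have "conn i (vsucc j) a = approx_set (vsucc j) (Z (vsucc j))"
      unfolding a_def by (simp add: conn_Limit[OF ns sj] sj y_def)
    then have "elts (conn i (vsucc j) a) = approx_set j ` elts (Z (vsucc j))"
      using elts_approx_set_vsucc Ord_mem[OF Oi j] by simp
    also have "\<dots> = approx_set j ` elts (Z j)" using im[OF _ sj] by (simp add: ord_le_def)
    finally show ?thesis using Z[OF j] by auto
  qed
  have "elts (conn i (vsucc vempty) a) \<noteq> {}"
    using ca[OF Limit_vempty_mem[OF i]] nonempty by auto
  moreover have False if st: "step_rel i a b" for b
  proof -
    have br: "full_branch i (\<lambda>j. conn i (vsucc j) a) conn (\<lambda>j. conn i j b)"
      using branch_step_rel(2)[OF i(1) a st] .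
    have "\<exists>f. F j f \<and> conn i j b = approx_set j (c f j)" if j: "j \<in> elts i" for j
      using br j ca[OF j] unfolding full_branch_def by blast
    \<comment> \<open>The branches \<open>f j\<close> are chosen separately for each
      \<open>j\<close> and need not cohere.\<close>
    then obtain f where f: "\<And>j. j \<in> elts i \<Longrightarrow> F j (f j)"
      and bf: "\<And>j. j \<in> elts i \<Longrightarrow> conn i j b = approx_set j (c (f j) j)" by metis
    obtain t0 where t0: "\<And>j. j \<in> elts i \<Longrightarrow> t0 j \<in> elts i \<and> (\<forall>k k' f f'. ord_le k j \<longrightarrow> k' \<in> elts i \<longrightarrow>
        F k f \<longrightarrow> F k' f' \<longrightarrow> approx_set (t0 j) (E k (f k)) = approx_set (t0 j) (E k' (f' k')) \<longrightarrow>
        f k = f' k' \<and> k = k')" using visible by metis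
    define t where "t j = omax (t0 j) j" for j
    have t: "t j \<in> elts i" "ord_le (t0 j) (t j)" "ord_le j (t j)" if "j \<in> elts i" for j
      using t0[OF that] omax_mem[of "t0 j" i j] omax_ge[of "t0 j" j] that Ord_mem[OF Oi]
      by (auto simp: t_def)
    \<comment> \<open>Compatibility of \<open>b\<close> makes each entry of the code at stage
      \<open>u + 1\<close> look, at index \<open>u\<close>, like some entry at stage
      \<open>u' + 1\<close>. Once \<open>u\<close> is past the visibility bound for
      \<open>j\<close>, position and value of that entry are determined.\<close>
    have stable: "f (vsucc u) k = f (vsucc u') k"
      if j: "j \<in> elts i" and u: "ord_le (t j) u" "ord_le u u'" "u' \<in> elts i" and k: "ord_le k j" for j u u' k
    proof -
      have ui: "u \<in> elts i" using ord_le_mem_trans[OF Oi u(2,3)] .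
      have O: "Ord u" "Ord u'" "Ord j" "Ord k"
        using ui u j k Ord_mem[OF Oi] ord_le_Ord by blast+
      have su: "vsucc u \<in> elts i" "vsucc u' \<in> elts i" using ui u Limit_vsucc_mem i by blast+
      have ju: "ord_le j u" using ord_le_trans[OF O(1) t(3)[OF j] u(1)] .
      have ku: "ord_le k u" using ord_le_trans[OF O(1) k ju] .
      have ssu: "ord_le (vsucc u) (vsucc u')" using vsucc_le_vsucc[OF O(2) u(2)] .
      have "conn (vsucc u') (vsucc u) (conn i (vsucc u') b) = conn i (vsucc u) b"
        using br su(2) ssu by (simp add: full_branch_def)
      then have "approx_set (vsucc u) (c (f (vsucc u)) (vsucc u)) =
          conn (vsucc u') (vsucc u) (approx_set (vsucc u') (c (f (vsucc u')) (vsucc u')))"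
        using bf[OF su(1)] bf[OF su(2)] by simp
      also have "\<dots> = approx_set (vsucc u) (c (f (vsucc u')) (vsucc u'))"
        using conn_approx_set[OF _ ssu] O by simp
      finally have "approx_set u ` elts (c (f (vsucc u)) (vsucc u)) =
          approx_set u ` elts (c (f (vsucc u')) (vsucc u'))"
        using elts_approx_set_vsucc[OF O(1)] by metis
      moreover have "E k (f (vsucc u) k) \<in> elts (c (f (vsucc u)) (vsucc u))"
        unfolding elts_c using ku by (auto simp: ord_le_def)
      ultimately obtain x where x: "x \<in> elts (c (f (vsucc u')) (vsucc u'))"
        "approx_set u (E k (f (vsucc u) k)) = approx_set u x" by blast
      then obtain k' where k': "ord_le k' (vsucc u')" "x = E k' (f (vsucc u') k')"
        unfolding elts_c using mem_vsucc_iff by blast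
      have k'i: "k' \<in> elts i" using ord_le_mem_trans[OF Oi k'(1) su(2)] .
      have "ord_le (t0 j) u" using ord_le_trans[OF O(1) t(2)[OF j] u(1)] .
      then have "approx_set (t0 j) (E k (f (vsucc u) k)) = approx_set (t0 j) (E k' (f (vsucc u') k'))"
        using approx_set_eq_le[OF O(1)] x(2) k'(2) by blast
      moreover have "F k (f (vsucc u))"
        using restrict[OF su(1) f[OF su(1)]] ord_le_trans[OF _ ku, of "vsucc u"] O by (simp add: ord_le_def)
      moreover have "F k' (f (vsucc u'))" using restrict[OF su(2) f[OF su(2)] k'(1)] .
      ultimately show ?thesis using t0[OF j] k k'i by metis
    qed
    \<comment> \<open>The limit of the \<open>f j\<close>: each position is read at a stage where it
      has become stable.\<close>
    define g where "g j = f (vsucc (t j)) j" for j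
    have "F j g" if j: "j \<in> elts i" for j
    proof (rule cong[OF j])
      have st: "vsucc (t j) \<in> elts i" using Limit_vsucc_mem[OF i(1) t(1)[OF j]] .
      have "ord_le j (vsucc (t j))"
        using ord_le_trans[OF _ t(3)[OF j], of "vsucc (t j)"] Ord_mem[OF Oi st] by (simp add: ord_le_def)
      then show "F j (f (vsucc (t j)))" using restrict[OF st] f[OF st] by blast
      fix k assume k: "ord_le k j"
      have ki: "k \<in> elts i" using ord_le_mem_trans[OF Oi k j] .
      have O: "Ord (t k)" "Ord (t j)" using t(1) ki j Ord_mem[OF Oi] by blast+
      let ?u = "omax (t k) (t j)"
      have u: "?u \<in> elts i" "ord_le (t k) ?u" "ord_le (t j) ?u"
        using omax_mem t(1) ki j omax_ge[OF O] by blast+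
      have "f (vsucc (t j)) k = f (vsucc ?u) k" using stable[OF j _ u(3,1) k] by simp
      moreover have "f (vsucc (t k)) k = f (vsucc ?u) k" using stable[OF ki _ u(2,1)] by simp
      ultimately show "f (vsucc (t j)) k = g k" by (simp add: g_def)
    qed
    then show False using no_branch by blast
  qed
  ultimately show ?thesis using a by blast
qed

lemma size_less_mono: "|elts x| \<le>o |elts (y :: 'v::zfc)| \<Longrightarrow> size_less y \<kappa> \<Longrightarrow> size_less x \<kappa>"
  by (cases \<kappa>) (auto intro: ordLeq_ordLess_trans)

lemma hereditary_Ord:
  "Ord a \<Longrightarrow> size_less a \<kappa> \<Longrightarrow> hereditary \<kappa> (a :: 'v::zfc)"
proof (induction a rule: zfc_wf_induct)
  case (step a)
  show ?case
  proof (rule hereditaryI[OF step.IH step.prems(2)])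
    fix b assume b: "b \<in> elts a"
    then show "Ord b" "b \<in> elts a" using step.prems Ord_mem by blast+
    show "size_less b \<kappa>"
      using card_of_mono1[OF Ord_subset[OF step.prems(1) b]] step.prems(2) by (rule size_less_mono)
  qed
qed

section \<open>Codes from a tree without full branches\<close>

text \<open>Spread \<open>N \<times> elts i\<close> injectively over \<open>i\<close>: the values
  available for \<open>x\<close> are as many as \<open>i\<close>, so they do not all fit below
  \<open>lev x\<close>.\<close>

lemma injective_labelling:
  fixes i :: "'v::zfc" and lev :: "'a \<Rightarrow> 'v"
  assumes i: "Cardinal i" "infinite (elts i)" and N: "|N| \<le>o |elts i|" and lev: "lev ` N \<subseteq> elts i"
  shows "\<exists>h. inj_on h N \<and> (\<forall>x\<in>N. h x \<in> elts i \<and> ord_le (lev x) (h x))"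
proof -
  have Oi: "Ord i" using i by (simp add: Cardinal_def)
  have "|N \<times> elts i| \<le>o |elts i|"
    using i N card_of_mono1[of "elts i" "elts i"]
    by (intro card_of_Times_ordLeq_infinite_Field card_of_Card_order) (auto simp: Field_card_of)
  then obtain g where g: "inj_on g (N \<times> elts i)" "g ` (N \<times> elts i) \<subseteq> elts i"
    using card_of_ordLeq[of "N \<times> elts i" "elts i"] by blast
  have "\<exists>b\<in>elts i. g (x, b) \<notin> elts (lev x)" if x: "x \<in> N" for x
  proof (rule ccontr)
    assume "\<not> ?thesis"
    then have "(\<lambda>b. g (x, b)) ` elts i \<subseteq> elts (lev x)" by blast
    moreover have "inj_on (\<lambda>b. g (x, b)) (elts i)" using g(1) x by (auto simp: inj_on_def)
    ultimately have "|elts i| \<le>o |elts (lev x)|" using card_of_ordLeq by blast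
    moreover have "|elts (lev x)| <o |elts i|" using i lev x by (auto simp: Cardinal_def)
    ultimately show False using not_ordLess_ordLeq by blast
  qed
  then obtain b where b: "\<And>x. x \<in> N \<Longrightarrow> b x \<in> elts i \<and> g (x, b x) \<notin> elts (lev x)" by metis
  define h where "h x = g (x, b x)" for x
  have "inj_on h N" using g(1) b unfolding inj_on_def h_def by fast
  moreover have hi: "h x \<in> elts i" if "x \<in> N" for x using g(2) b that unfolding h_def by blast
  moreover have "ord_le (lev x) (h x)" if x: "x \<in> N" for x
    using Ord_not_mem_iff[of "h x" "lev x"] Ord_mem[OF Oi] hi[OF x] lev x b[OF x]
    unfolding h_def by blast
  ultimately show ?thesis by blast
qed

text \<open>Nodes are coded by distinct ordinals, each at least the level of its node. Truncation at
  index \<open>j\<close> hides the labels from level \<open>j\<close> on. By regularity the labels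
  up to level \<open>j\<close> are bounded below \<open>i\<close>, and such a bound is an index that
  reveals them.\<close>

lemma element_from_tree:
  fixes i :: "'v::zfc"
  assumes i: "infinite_regular i" and tree: "tidy_tree i D d"
    and D: "\<And>j. j \<in> elts i \<Longrightarrow> |elts (D j)| <o |elts i|"
    and no_branch: "\<nexists>x. full_branch i D d x"
    and size: "\<And>x :: 'v. |elts x| <o |elts i| \<Longrightarrow> size_less x \<kappa>"
  shows "\<exists>a\<in>elts (nu \<kappa> i). elts (conn i (vsucc vempty) a) \<noteq> {} \<and> (\<forall>b. \<not> step_rel i a b)"
proof -
  have Li: "Limit i" using i by (rule infinite_regular_Limit)
  then have Oi: "Ord i" by (simp add: Limit_def)
  have C: "Cardinal i" "infinite (elts i)" using i by (auto simp: infinite_regular_def)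
  then have ne: "i \<noteq> vempty" by auto
  have T: "surjective_tree i D d" using tree by (auto simp: tidy_tree_def surjective_tree_def)
  \<comment> \<open>Levels may overlap, so a node is paired with its level.\<close>
  define N where "N = (SIGMA j : elts i. elts (D j))"
  have "|N| \<le>o |elts i|"
    unfolding N_def using C D card_of_mono1[of "elts i" "elts i"]
    by (intro card_of_Sigma_ordLeq_infinite ballI) (auto intro: ordLess_imp_ordLeq)
  then have "\<exists>h. inj_on h N \<and> (\<forall>x\<in>N. h x \<in> elts i \<and> ord_le (fst x) (h x))"
    by (intro injective_labelling[OF C]) (auto simp: N_def)
  then obtain h where h: "inj_on h N" "\<And>x. x \<in> N \<Longrightarrow> h x \<in> elts i" "\<And>x. x \<in> N \<Longrightarrow> ord_le (fst x) (h x)"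
    by blast
  \<comment> \<open>Position \<open>j\<close> is included, hence the successor.\<close>
  define F where "F j f \<longleftrightarrow> full_branch (vsucc j) D d f" for j f
  have FN: "(k, f k) \<in> N" if "k \<in> elts i" "F k f" for k f
    using that by (simp add: N_def F_def full_branch_def)
  have Oh: "Ord (h x)" if "x \<in> N" for x using h(2)[OF that] Ord_mem[OF Oi] by blast
  show ?thesis
  proof (rule element_without_transition[OF Li ne, where F = F and E = "\<lambda>k x. h (k, x)"])
    fix j k f assume j: "j \<in> elts i" and f: "F j f" and k: "ord_le k j"
    have "m \<in> elts (vsucc j)" if "m \<in> elts (vsucc k)" for m
      using that k ord_le_trans[OF Ord_mem[OF Oi j]] by (simp add: mem_vsucc_iff del: elts_vsucc)
    then show "F k f" using f by (simp add: F_def full_branch_def del: elts_vsucc)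
  next
    fix j f g assume j: "j \<in> elts i" and f: "F j f" and fg: "\<And>k. ord_le k j \<Longrightarrow> f k = g k"
    then show "F j g"
      using ord_le_trans[OF Ord_mem[OF Oi j]]
      by (simp add: F_def full_branch_def mem_vsucc_iff del: elts_vsucc)
  next
    fix j k f assume j: "j \<in> elts i" and k: "ord_le k j" and f: "F k f"
    have Oj: "Ord j" using Oi j Ord_mem by blast
    have "f k \<in> elts (D k)" using f by (simp add: F_def full_branch_def)
    then obtain z where z: "z \<in> elts (D j)" "d j k z = f k" using surjective_tree_lift[OF T j k] by blast
    have "F j (\<lambda>m. d j m z)"
      unfolding F_def full_branch_def mem_vsucc_iff
      using surjective_tree_mem[OF T j _ z(1)] surjective_tree_comp[OF T j _ _ z(1)]
      by (simp add: mem_vsucc_iff del: elts_vsucc)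
    moreover have "d j m z = f m" if m: "ord_le m k" for m
    proof -
      have "d j m z = d k m (d j k z)" using surjective_tree_comp[OF T j k m z(1)] by simp
      then show ?thesis using f m z by (simp add: F_def full_branch_def)
    qed
    ultimately show "\<exists>g. F j g \<and> (\<forall>m. ord_le m k \<longrightarrow> g m = f m)" by blast
  next
    obtain r where r: "elts (D vempty) = {r}" using tree by (auto simp: tidy_tree_def)
    have "d vempty vempty r = r"
      using surjective_tree_refl[OF T Limit_vempty_mem[OF Li ne]] r by simp
    then have "F vempty (\<lambda>_. r)"
      using r by (auto simp: F_def full_branch_def ord_le_def)
    then show "\<exists>f. F vempty f" by blast
  next
    fix j k k' f f'
    assume k: "k \<in> elts i" "k' \<in> elts i" "ord_le j k" "ord_le j k'" "F k f" "F k' f'"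
    have Oj: "Ord j" using k Ord_mem[OF Oi] ord_le_Ord by blast
    have "approx_set j (h (m, g m)) = approx_set j j" if m: "m \<in> elts i" "ord_le j m" "F m g" for m g
    proof -
      have "ord_le j (h (m, g m))"
        using ord_le_trans[OF Oh m(2)] h(3)[OF FN[OF m(1,3)]] FN[OF m(1,3)] by simp
      then show ?thesis using approx_set_Ord_trunc[OF Oj Oh] FN[OF m(1,3)] by blast
    qed
    then show "approx_set j (h (k, f k)) = approx_set j (h (k', f' k'))" using k by simp
  next
    fix j assume j: "j \<in> elts i"
    let ?X = "\<Union>k\<in>elts (vsucc j). (\<lambda>x. h (k, x)) ` elts (D k)"
    have sj: "vsucc j \<in> elts i" using Limit_vsucc_mem[OF Li j] .
    have cX: "|?X| <o |elts i|"
    proof (rule stable_UNION[OF infinite_regular_stable[OF i]])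
      show "|elts (vsucc j)| <o |elts i|" using C sj by (auto simp: Cardinal_def simp del: elts_vsucc)
      fix k assume "k \<in> elts (vsucc j)"
      then have "k \<in> elts i" using Ord_trans[OF Oi sj] by blast
      then show "|(\<lambda>x. h (k, x)) ` elts (D k)| <o |elts i|"
        using D card_of_image ordLeq_ordLess_trans by blast
    qed
    have X: "h (k, x) \<in> ?X" if "ord_le k j" "x \<in> elts (D k)" for k x
      using that by (auto simp: mem_vsucc_iff simp del: elts_vsucc)
    have "?X \<subseteq> elts i"
      using h(2) Ord_trans[OF Oi sj] by (auto simp: N_def simp del: elts_vsucc)
    from infinite_regular_bounded[OF i this cX]
    obtain t where t: "t \<in> elts i" "\<And>x. x \<in> ?X \<Longrightarrow> x \<in> elts t" by blast
    have Ot: "Ord t" using t Oi Ord_mem by blast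
    show "\<exists>t\<in>elts i. \<forall>k k' f f'. ord_le k j \<longrightarrow> k' \<in> elts i \<longrightarrow> F k f \<longrightarrow> F k' f' \<longrightarrow>
        approx_set t (h (k, f k)) = approx_set t (h (k', f' k')) \<longrightarrow> f k = f' k' \<and> k = k'"
    proof (intro bexI[OF _ t(1)] allI impI)
      fix k k' f f'
      assume k: "ord_le k j" "k' \<in> elts i" "F k f" "F k' f'"
        and eq: "approx_set t (h (k, f k)) = approx_set t (h (k', f' k'))"
      have ki: "k \<in> elts i" using ord_le_mem_trans[OF Oi k(1) j] .
      note n = FN[OF ki k(3)] FN[OF k(2,4)]
      have "h (k, f k) \<in> elts t" using n(1) k(1) X t(2) by (simp add: N_def)
      then have "h (k, f k) = h (k', f' k')" using approx_set_Ord_inj[OF Ot Oh[OF n(2)] _ eq] by blast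
      then show "f k = f' k' \<and> k = k'" using h(1) n by (auto dest: inj_onD)
    qed
  next
    fix k f assume k: "k \<in> elts i" "F k f"
    have "h (k, f k) \<in> elts i" using h(2) FN k by blast
    then show "hereditary \<kappa> (h (k, f k))"
      using C Oi Ord_mem by (intro hereditary_Ord size) (auto simp: Cardinal_def)
  next
    fix j assume "j \<in> elts i"
    then show "size_less (vsucc j) \<kappa>"
      using C Limit_vsucc_mem[OF Li] by (intro size) (auto simp: Cardinal_def simp del: elts_vsucc)
  next
    fix j assume j: "j \<in> elts i"
    define g where "g x = vset ((\<lambda>k. h (k, d j k x)) ` elts (vsucc j))" for x
    let ?Z = "{vset ((\<lambda>k. h (k, f k)) ` elts (vsucc j)) | f. F j f}"
    \<comment> \<open>A branch is determined by its last node, so there are at most as many codes as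
      nodes of level \<open>j\<close>.\<close>
    have "vset ((\<lambda>k. h (k, f k)) ` elts (vsucc j)) \<in> g ` elts (D j)" if f: "F j f" for f
    proof -
      have fj: "f j \<in> elts (D j)" using f by (simp add: F_def full_branch_def)
      have "d j k (f j) = f k" if "k \<in> elts (vsucc j)" for k
      proof -
        have "ord_le k j" using that mem_vsucc_iff by blast
        then show ?thesis using f by (simp add: F_def full_branch_def)
      qed
      then have "(\<lambda>k. h (k, f k)) ` elts (vsucc j) = (\<lambda>k. h (k, d j k (f j))) ` elts (vsucc j)"
        by (intro image_cong refl) simp
      then have "vset ((\<lambda>k. h (k, f k)) ` elts (vsucc j)) = g (f j)"
        unfolding g_def by (rule arg_cong)
      then show ?thesis using fj by (rule image_eqI)
    qed
    then have sub: "?Z \<subseteq> g ` elts (D j)" by blast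
    then have "small ?Z" by (rule small_subset[OF small_image[OF small_elts]])
    moreover have "|?Z| <o |elts i|"
      using ordLeq_transitive[OF card_of_mono1[OF sub] card_of_image] D[OF j]
      by (rule ordLeq_ordLess_trans)
    ultimately show "\<exists>Z. elts Z = ?Z \<and> size_less Z \<kappa>"
      by (intro exI[of _ "vset ?Z"] conjI size) simp_all
  next
    fix f
    show "\<exists>j\<in>elts i. \<not> F j f"
    proof (rule ccontr)
      assume "\<not> ?thesis"
      then have "full_branch i D d f" unfolding F_def full_branch_def by simp
      then show False using no_branch by blast
    qed
  qed
qed


section \<open>Codes from finite subsets of a cofinal set\<close>

definition next_in :: "'v::zfc set \<Rightarrow> 'v \<Rightarrow> 'v" where
  "next_in S k = (THE v. v \<in> S \<and> ord_le k v \<and> (\<forall>u\<in>S. ord_le k u \<longrightarrow> ord_le v u))"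

lemma next_in_eqI:
  assumes "v \<in> S" "ord_le k v" "\<And>u. u \<in> S \<Longrightarrow> ord_le k u \<Longrightarrow> ord_le v u"
  shows "next_in S k = (v :: 'v::zfc)"
  unfolding next_in_def using assms ord_le_antisym by (intro the_equality) blast+

lemma next_in:
  assumes S: "\<And>u. u \<in> S \<Longrightarrow> Ord u" and v: "v \<in> S" "ord_le k (v :: 'v::zfc)"
  shows "next_in S k \<in> S" "ord_le k (next_in S k)"
    "\<And>u. u \<in> S \<Longrightarrow> ord_le k u \<Longrightarrow> ord_le (next_in S k) u"
proof -
  obtain w where w: "w \<in> {u \<in> S. ord_le k u}" "\<And>y. y \<in> elts w \<Longrightarrow> y \<notin> {u \<in> S. ord_le k u}"
    using wfE_min[OF zfc_foundation, of v "{u \<in> S. ord_le k u}"] v by auto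
  then have le: "ord_le w u" if "u \<in> S" "ord_le k u" for u
    using that Ord_not_mem_iff[of u w] S by blast
  then have "next_in S k = w" using w by (intro next_in_eqI) auto
  then show "next_in S k \<in> S" "ord_le k (next_in S k)"
    "\<And>u. u \<in> S \<Longrightarrow> ord_le k u \<Longrightarrow> ord_le (next_in S k) u"
    using w le by auto
qed

lemma approx_set_pair:
  assumes j: "Ord j" "ord_le j b" "ord_le j b'" "Ord b" "Ord (b' :: 'v::zfc)"
  shows "approx_set j (vset {a, b}) = approx_set j (vset {a, b'})"
proof (rule approx_set_eqI[OF j(1)])
  fix n assume n: "n \<in> elts j"
  have "Ord n" "ord_le n b" "ord_le n b'"
    using n j Ord_mem mem_ord_le_trans by (auto simp: ord_le_def[of n])
  then have "approx_set n b = approx_set n b'" using approx_set_Ord_trunc j by metis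
  then show "approx_set n ` elts (vset {a, b}) = approx_set n ` elts (vset {a, b'})" by simp
qed

lemma approx_set_single:
  assumes j: "Ord j" "ord_le j b" "ord_le j b'" "Ord b" "Ord (b' :: 'v::zfc)"
  shows "approx_set j (vset {b}) = approx_set j (vset {b'})"
proof (rule approx_set_eqI[OF j(1)])
  fix n assume n: "n \<in> elts j"
  have "Ord n" "ord_le n b" "ord_le n b'"
    using n j Ord_mem mem_ord_le_trans by (auto simp: ord_le_def[of n])
  then have "approx_set n b = approx_set n b'" using approx_set_Ord_trunc j by metis
  then show "approx_set n ` elts (vset {b}) = approx_set n ` elts (vset {b'})" by simp
qed

text \<open>
  A set coding the ordinal \<open>k\<close> together with a subset \<open>A\<close> of the ordinal \<open>m\<close>: approximations of index
  at most \<open>k\<close> see neither \<open>k\<close> nor \<open>A\<close>, since they confuse \<open>M = max k m\<close> and \<open>M + 1\<close>, but finitely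
  many levels above \<open>M\<close> both are determined.
\<close>

definition delayed_code :: "'v::zfc \<Rightarrow> 'v \<Rightarrow> 'v set \<Rightarrow> 'v" where
  "delayed_code m k A = vset ({vset {k}} \<union> (\<lambda>x. vset {x, vsucc (omax k m)}) ` elts m \<union>
     (\<lambda>x. vset {x, omax k m}) ` A)"

lemma elts_delayed_code: "A \<subseteq> elts m \<Longrightarrow> elts (delayed_code m k A) =
    {vset {k}} \<union> (\<lambda>x. vset {x, vsucc (omax k m)}) ` elts m \<union> (\<lambda>x. vset {x, omax k m}) ` A"
  unfolding delayed_code_def
  by (intro elts_vset small_Un small_image small_elts small_single small_subset[of "elts m" A])

text \<open>At an index \<open>n < j\<close>, the ordinals \<open>k\<close>, \<open>M\<close> and
  \<open>M + 1\<close> all look like \<open>n\<close>, so both families of pairs become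
  \<open>{x, n}\<close>. The first one already runs through all \<open>x < m\<close>, which conceals
  \<open>A\<close>.\<close>

lemma delayed_code_hidden:
  assumes O: "Ord k" "Ord (m :: 'v::zfc)" "Ord k'" and A: "A \<subseteq> elts m" "A' \<subseteq> elts m"
    and j: "Ord j" "ord_le j k" "ord_le j k'"
  shows "approx_set j (delayed_code m k A) = approx_set j (delayed_code m k' A')"
proof (rule approx_set_eqI[OF j(1)])
  fix n assume n: "n \<in> elts j"
  have On: "Ord n" using n j Ord_mem by blast
  have nj: "ord_le n j" using n by (simp add: ord_le_def)
  have *: "approx_set n ` elts (delayed_code m k A) =
      insert (approx_set n (vset {n})) ((\<lambda>x. approx_set n (vset {x, n})) ` elts m)"
    if k: "Ord k" "ord_le j k" and A: "A \<subseteq> elts m" for k A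
  proof -
    have nk: "ord_le n k" using ord_le_trans[OF k(1) nj k(2)] .
    have OM: "Ord (omax k m)" and "ord_le k (omax k m)"
      using Ord_omax omax_ge k(1) O(2) by blast+
    then have nM: "ord_le n (omax k m)" using ord_le_trans[OF OM nk] by blast
    then have nsM: "ord_le n (vsucc (omax k m))"
      using ord_le_trans[OF _ nM, of "vsucc (omax k m)"] OM by (simp add: ord_le_def)
    have "approx_set n (vset {k}) = approx_set n (vset {n})"
      using approx_set_single[OF On nk _ k(1) On] by simp
    moreover have "approx_set n (vset {x, omax k m}) = approx_set n (vset {x, n})"
      "approx_set n (vset {x, vsucc (omax k m)}) = approx_set n (vset {x, n})" for x
      using approx_set_pair[OF On nM _ OM On] approx_set_pair[OF On nsM _ _ On] OM by simp_all
    ultimately show ?thesis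
      unfolding elts_delayed_code[OF A] image_Un image_image using A by auto
  qed
  show "approx_set n ` elts (delayed_code m k A) = approx_set n ` elts (delayed_code m k' A')"
    using *[OF O(1) j(2) A(1)] *[OF O(3) j(3) A(2)] by simp
qed

text \<open>Index \<open>t\<close> tells each ordinal below it from all other ordinals, and two more
  successors expose the elements of the elements. Then \<open>k\<close> is read off from the only
  singleton, and \<open>x\<close> belongs to \<open>A\<close> iff \<open>{x, M}\<close>
  occurs.\<close>

lemma delayed_code_visible:
  assumes O: "Ord k" "Ord (m :: 'v::zfc)" "Ord k'" and A: "A \<subseteq> elts m" "A' \<subseteq> elts m"
    and t: "Ord t" "vsucc (omax k m) \<in> elts t"
    and eq: "approx_set (vsucc (vsucc t)) (delayed_code m k A) =
      approx_set (vsucc (vsucc t)) (delayed_code m k' A')"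
  shows "k = k' \<and> A = A'"
proof -
  define p where "p = approx_set t"
  have inj: "a = b" if "a \<in> elts t" "Ord b" "p a = p b" for a b
    using approx_set_Ord_inj[OF t(1) that(2,1)] that(3) by (simp add: p_def)
  have "approx_set (vsucc t) ` elts (delayed_code m k A) =
      approx_set (vsucc t) ` elts (delayed_code m k' A')"
    using elts_approx_set_vsucc[of "vsucc t"] t(1) eq by (metis Ord_vsucc)
  then have "elts ` approx_set (vsucc t) ` elts (delayed_code m k A) =
      elts ` approx_set (vsucc t) ` elts (delayed_code m k' A')" by simp
  then have W: "{{p k}} \<union> (\<lambda>x. {p x, p (vsucc (omax k m))}) ` elts m \<union> (\<lambda>x. {p x, p (omax k m)}) ` A =
      {{p k'}} \<union> (\<lambda>x. {p x, p (vsucc (omax k' m))}) ` elts m \<union> (\<lambda>x. {p x, p (omax k' m)}) ` A'"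
    unfolding elts_delayed_code[OF A(1)] elts_delayed_code[OF A(2)]
    by (simp add: elts_approx_set_vsucc[OF t(1)] image_Un image_image p_def)
  have M: "Ord (omax k m)" "ord_le k (omax k m)" "ord_le m (omax k m)"
    "Ord (omax k' m)" "ord_le m (omax k' m)"
    using Ord_omax omax_ge O by blast+
  have Mt: "omax k m \<in> elts t" using Ord_trans[OF t] by simp
  then have kt: "k \<in> elts t" and xt: "\<And>x. x \<in> elts m \<Longrightarrow> x \<in> elts t"
    using ord_le_mem_trans[OF t(1) M(2)] ord_le_mem_trans[OF t(1) M(3)] Ord_trans[OF t(1)] by blast+
  have Ox: "\<And>x. x \<in> elts m \<Longrightarrow> Ord x" using O(2) Ord_mem by blast
  have xM: "x \<in> elts (omax k m)" "x \<in> elts (omax k' m)" if "x \<in> elts m" for x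
    using mem_ord_le_trans[OF _ that] M by blast+
  have ne: "p x \<noteq> p (omax k m)" "p x \<noteq> p (vsucc (omax k m))"
    "p x \<noteq> p (omax k' m)" "p x \<noteq> p (vsucc (omax k' m))" if "x \<in> elts m" for x
  proof -
    have "x \<noteq> y" "x \<noteq> vsucc y" if "x \<in> elts y" for y
      using that mem_not_refl[of x] mem_not_sym[of x y] by auto
    then have "x \<noteq> omax k m" "x \<noteq> vsucc (omax k m)" "x \<noteq> omax k' m" "x \<noteq> vsucc (omax k' m)"
      using xM[OF that] by blast+
    then show "p x \<noteq> p (omax k m)" "p x \<noteq> p (vsucc (omax k m))"
      "p x \<noteq> p (omax k' m)" "p x \<noteq> p (vsucc (omax k' m))"
      using inj[OF xt[OF that]] M(1,4) Ord_vsucc by blast+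
  qed
  \<comment> \<open>No pair collapses to \<open>{p k}\<close>, because \<open>x < m \<le> M\<close>
    keeps its two elements distinct under \<open>p\<close>.\<close>
  have "{p k} \<in> {{p k'}} \<union> (\<lambda>x. {p x, p (vsucc (omax k' m))}) ` elts m \<union>
      (\<lambda>x. {p x, p (omax k' m)}) ` A'" unfolding W[symmetric] by blast
  then have "p k = p k'" using ne A(2) by (auto simp: doubleton_eq_iff)
  then have kk: "k = k'" using inj[OF kt O(3)] by blast
  have nM: "p (omax k m) \<noteq> p (vsucc (omax k m))"
  proof
    assume "p (omax k m) = p (vsucc (omax k m))"
    then have "omax k m = vsucc (omax k m)" using inj[OF Mt] M(1) by simp
    moreover have "omax k m \<in> elts (vsucc (omax k m))" by simp
    ultimately show False using mem_not_refl by metis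
  qed
  \<comment> \<open>With \<open>k = k'\<close> both codes use the same \<open>M\<close>, so
    \<open>?L\<close> is common to both sides and contains no \<open>{p x, p M}\<close>.\<close>
  let ?L = "{{p k}} \<union> (\<lambda>x. {p x, p (vsucc (omax k m))}) ` elts m"
  let ?I = "\<lambda>B. (\<lambda>x. {p x, p (omax k m)}) ` B"
  have W': "?L \<union> ?I A = ?L \<union> ?I A'" using W unfolding kk .
  have sub: "B \<subseteq> B'" if B: "B \<subseteq> elts m" "B' \<subseteq> elts m" and W: "?L \<union> ?I B = ?L \<union> ?I B'" for B B'
  proof
    fix x assume x: "x \<in> B"
    have xm: "x \<in> elts m" using x B by blast
    have "{p x, p (omax k m)} \<in> ?L \<union> ?I B" using x by (intro UnI2 imageI)
    then have "{p x, p (omax k m)} \<in> ?L \<union> ?I B'" unfolding W .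
    then consider "{p x, p (omax k m)} = {p k}"
      | y where "y \<in> elts m" "{p x, p (omax k m)} = {p y, p (vsucc (omax k m))}"
      | y where "y \<in> B'" "{p x, p (omax k m)} = {p y, p (omax k m)}" by blast
    then show "x \<in> B'"
    proof cases
      case 1
      then show ?thesis using ne(1)[OF xm] by (auto simp: doubleton_eq_iff)
    next
      case (2 y)
      then show ?thesis using ne(1)[OF 2(1)] nM ne(2)[OF xm] by (auto simp: doubleton_eq_iff)
    next
      case (3 y)
      have ym: "y \<in> elts m" using 3 B by blast
      have "p x = p y" using 3 ne(1)[OF xm] by (auto simp: doubleton_eq_iff)
      then show ?thesis using inj[OF xt[OF xm] Ox[OF ym]] 3 by simp
    qed
  qed
  have "A = A'" using sub[OF A W'] sub[OF A(2,1) W'[symmetric]] by (rule subset_antisym)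
  then show ?thesis using kk by simp
qed

text \<open>A branch of length \<open>j\<close> is \<open>next_in S\<close> for a finite
  \<open>S\<close> reaching up to \<open>j\<close>. The value at \<open>k\<close> may lie far above
  \<open>k\<close>, so it is coded through \<sigma> by a subset of the fixed \<open>m\<close>, which
  becomes visible soon after \<open>omax k m\<close>.\<close>

lemma element_from_cofinal_set:
  fixes i :: "'v::zfc" and \<sigma> :: "'v \<Rightarrow> 'v set"
  assumes i: "Limit i" "i \<noteq> vempty" "\<not> omega_cofinal i"
    and C: "C \<subseteq> elts i" "\<And>j. j \<in> elts i \<Longrightarrow> \<exists>v\<in>C. ord_le j v"
    and m: "m \<in> elts i" and \<sigma>: "inj_on \<sigma> C" "\<And>v. v \<in> C \<Longrightarrow> \<sigma> v \<subseteq> elts m"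
    and size: "size_less i \<kappa>"
  shows "\<exists>a\<in>elts (nu \<kappa> i). elts (conn i (vsucc vempty) a) \<noteq> {} \<and> (\<forall>b. \<not> step_rel i a b)"
proof -
  have Oi: "Ord i" using i by (simp add: Limit_def)
  have inf: "infinite (elts i)" using i infinite_Limit by blast
  have Om: "Ord m" using m Oi Ord_mem by blast
  have OC: "Ord v" if "v \<in> C" for v using that C Oi Ord_mem by blast
  have sz: "size_less x \<kappa>" if "|elts x| \<le>o |elts i|" for x :: 'v using size_less_mono[OF that size] .
  have szf: "size_less x \<kappa>" if "finite (elts x)" for x :: 'v
    using that inf by (intro sz ordLess_imp_ordLeq finite_ordLess_infinite card_of_Well_order)
      (auto simp: Field_card_of)
  define F where "F j f \<longleftrightarrow> (\<exists>S. finite S \<and> S \<subseteq> C \<and> (\<exists>v\<in>S. ord_le j v) \<and>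
      (\<forall>k. ord_le k j \<longrightarrow> f k = next_in S k))" for j f
  have nx: "next_in S k \<in> S" "ord_le k (next_in S k)"
    "\<And>u. u \<in> S \<Longrightarrow> ord_le k u \<Longrightarrow> ord_le (next_in S k) u"
    if S: "S \<subseteq> C" and k: "ord_le k j" and ex: "\<exists>v\<in>S. ord_le j v" for S k j
  proof -
    obtain v where v: "v \<in> S" "ord_le j v" using ex by blast
    have "ord_le k v" using ord_le_trans[OF OC k v(2)] v S by blast
    then show "next_in S k \<in> S" "ord_le k (next_in S k)"
      "\<And>u. u \<in> S \<Longrightarrow> ord_le k u \<Longrightarrow> ord_le (next_in S k) u"
      using next_in[of S v k] OC S v(1) by blast+
  qed
  have FC: "f j \<in> C \<and> ord_le j (f j)" if F: "F j f" for j f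
  proof -
    obtain S where S: "S \<subseteq> C" "\<exists>v\<in>S. ord_le j v" "f j = next_in S j"
      using F ord_le_refl unfolding F_def by blast
    then show ?thesis using nx(1,2)[OF S(1) ord_le_refl S(2)] by auto
  qed
  show ?thesis
  proof (rule element_without_transition[OF i(1,2), where F = F and E = "\<lambda>k v. delayed_code m k (\<sigma> v)"])
    fix j k f assume j: "j \<in> elts i" and f: "F j f" and k: "ord_le k j"
    obtain S v where S: "finite S" "S \<subseteq> C" "v \<in> S" "ord_le j v" "\<And>l. ord_le l j \<Longrightarrow> f l = next_in S l"
      using f unfolding F_def by blast
    have "ord_le k v" using ord_le_trans[OF _ k S(4)] OC S by blast
    moreover have "f l = next_in S l" if "ord_le l k" for l
      using S(5) ord_le_trans[OF Ord_mem[OF Oi j] that k] by blast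
    ultimately show "F k f" unfolding F_def using S(1-3) by blast
  next
    fix j f g assume "F j f" and "\<And>k. ord_le k j \<Longrightarrow> f k = g k"
    then show "F j g" unfolding F_def by metis
  next
    fix j k f assume j: "j \<in> elts i" and k: "ord_le k j" and f: "F k f"
    obtain S where S: "finite S" "S \<subseteq> C" "\<exists>v\<in>S. ord_le k v" "\<And>l. ord_le l k \<Longrightarrow> f l = next_in S l"
      using f unfolding F_def by blast
    have Oj: "Ord j" using Ord_mem[OF Oi j] .
    show "\<exists>g. F j g \<and> (\<forall>l. ord_le l k \<longrightarrow> g l = f l)"
    proof (cases "\<exists>v\<in>S. ord_le j v")
      case True
      then have "F j (next_in S)" unfolding F_def using S by blast
      then show ?thesis using S(4) by force
    next
      case False
      obtain v where v: "v \<in> C" "ord_le j v" using C(2)[OF j] by blast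
      have "F j (next_in (insert v S))"
        unfolding F_def using S v by (intro exI[of _ "insert v S"]) auto
      \<comment> \<open>Every old value lies below \<open>j\<close>, hence below the new element
        \<open>v\<close>, which therefore changes no entry.\<close>
      moreover have "next_in (insert v S) l = f l" if l: "ord_le l k" for l
      proof -
        note n = nx[OF S(2) l S(3)]
        have "next_in S l \<in> elts j"
          using False n(1) Ord_not_le_iff[OF Oj OC] S(2) by blast
        then have "ord_le (next_in S l) v"
          using mem_ord_le_trans[OF OC[OF v(1)] _ v(2)] by (simp add: ord_le_def)
        then have "next_in (insert v S) l = next_in S l"
          using n by (intro next_in_eqI) auto
        then show ?thesis using S(4)[OF l] by simp
      qed
      ultimately show ?thesis by blast
    qed
  next
    obtain v where v: "v \<in> C" "ord_le vempty v" using C(2)[OF Limit_vempty_mem[OF i(1,2)]] by blast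
    then have "F vempty (next_in {v})" unfolding F_def by blast
    then show "\<exists>f. F vempty f" by blast
  next
    fix j k k' f f'
    assume k: "k \<in> elts i" "k' \<in> elts i" "ord_le j k" "ord_le j k'" "F k f" "F k' f'"
    have O: "Ord k" "Ord k'" "Ord j" using k(1-3) Ord_mem[OF Oi] ord_le_Ord by blast+
    show "approx_set j (delayed_code m k (\<sigma> (f k))) = approx_set j (delayed_code m k' (\<sigma> (f' k')))"
      using k O Om FC \<sigma>(2) by (intro delayed_code_hidden) blast+
  next
    fix j assume j: "j \<in> elts i"
    let ?M = "omax j m"
    have Oj: "Ord j" using Ord_mem[OF Oi j] .
    have Mi: "?M \<in> elts i" using omax_mem[OF j m] .
    have OM: "Ord ?M" using Ord_omax[OF Oj Om] .
    \<comment> \<open>\<open>?M\<close> dominates \<open>omax k m\<close> for every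
      \<open>k \<le> j\<close>, so \<open>?t\<close> exceeds \<open>omax k m + 1\<close> as decoding
      demands; two further successors expose elements of elements.\<close>
    let ?t = "vsucc (vsucc ?M)"
    show "\<exists>t\<in>elts i. \<forall>k k' f f'. ord_le k j \<longrightarrow> k' \<in> elts i \<longrightarrow> F k f \<longrightarrow> F k' f' \<longrightarrow>
        approx_set t (delayed_code m k (\<sigma> (f k))) = approx_set t (delayed_code m k' (\<sigma> (f' k'))) \<longrightarrow>
        f k = f' k' \<and> k = k'"
    proof (intro bexI[of _ "vsucc (vsucc ?t)"] allI impI)
      show "vsucc (vsucc ?t) \<in> elts i" using Mi Limit_vsucc_mem[OF i(1)] by blast
      fix k k' f f'
      assume k: "ord_le k j" "k' \<in> elts i" "F k f" "F k' f'"
        and eq: "approx_set (vsucc (vsucc ?t)) (delayed_code m k (\<sigma> (f k))) =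
          approx_set (vsucc (vsucc ?t)) (delayed_code m k' (\<sigma> (f' k')))"
      have O: "Ord k" "Ord k'" using k Oj ord_le_Ord Ord_mem[OF Oi] by blast+
      have "ord_le (omax k m) ?M"
        using omax_cases[of k m] omax_ge[OF Oj Om] ord_le_trans[OF OM k(1)] by auto
      then have "vsucc (omax k m) \<in> elts ?t"
        using vsucc_le_vsucc[OF OM] mem_vsucc_iff by blast
      then have "k = k' \<and> \<sigma> (f k) = \<sigma> (f' k')"
        using eq FC k \<sigma>(2) O Om OM by (intro delayed_code_visible[where t = ?t]) auto
      then show "f k = f' k' \<and> k = k'" using \<sigma>(1) FC k by (meson inj_onD)
    qed
  next
    fix k f assume k: "k \<in> elts i" "F k f"
    let ?A = "\<sigma> (f k)"
    have A: "?A \<subseteq> elts m" using FC[OF k(2)] \<sigma>(2) by blast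
    have M: "omax k m \<in> elts i" "vsucc (omax k m) \<in> elts i"
      using omax_mem[OF k(1) m] Limit_vsucc_mem[OF i(1)] by blast+
    have mi: "x \<in> elts i" if "x \<in> elts m" for x using Ord_trans[OF Oi m that] .
    have hO: "hereditary \<kappa> x" if "x \<in> elts i" for x
      using that Ord_mem[OF Oi] card_of_mono1[OF Ord_subset[OF Oi]]
      by (intro hereditary_Ord sz) blast+
    have sub: "elts (delayed_code m k ?A) \<subseteq> (\<lambda>(x, y). vset {x, y}) ` (elts i \<times> elts i)"
    proof -
      have pr: "vset {x, y} \<in> (\<lambda>(x, y). vset {x, y}) ` (elts i \<times> elts i)"
        if "x \<in> elts i" "y \<in> elts i" for x y
        using that by (intro image_eqI[of _ _ "(x, y)"]) auto
      have "vset {k} \<in> (\<lambda>(x, y). vset {x, y}) ` (elts i \<times> elts i)" using pr[OF k(1) k(1)] by simp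
      then show ?thesis
        unfolding elts_delayed_code[OF A] using A M mi
        by (intro Un_least image_subsetI pr insert_subsetI empty_subsetI) blast+
    qed
    have "|elts i \<times> elts i| \<le>o |elts i|"
      using inf by (intro ordIso_imp_ordLeq card_of_Times_same_infinite)
    then have "|elts (delayed_code m k ?A)| \<le>o |elts i|"
      using ordLeq_transitive[OF ordLeq_transitive[OF card_of_mono1[OF sub] card_of_image]] by blast
    moreover have "hereditary \<kappa> y" if y: "y \<in> elts (delayed_code m k ?A)" for y
    proof -
      have "y \<in> (\<lambda>(x, y). vset {x, y}) ` (elts i \<times> elts i)" using sub y by (rule subsetD)
      then obtain u v where "y = vset {u, v}" "u \<in> elts i" "v \<in> elts i" by auto
      then show ?thesis using hO by (intro hereditaryI[of y]) (auto intro: szf)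
    qed
    ultimately show "hereditary \<kappa> (delayed_code m k ?A)" by (rule hereditaryI[OF _ sz, rotated])
  next
    fix j assume "j \<in> elts i"
    then have "elts (vsucc j) \<subseteq> elts i" using Ord_subset[OF Oi] Limit_vsucc_mem[OF i(1)] by blast
    then show "size_less (vsucc j) \<kappa>" by (intro sz card_of_mono1)
  next
    fix j assume j: "j \<in> elts i"
    define g where "g S = vset ((\<lambda>k. delayed_code m k (\<sigma> (next_in S k))) ` elts (vsucc j))" for S
    let ?Z = "{vset ((\<lambda>k. delayed_code m k (\<sigma> (f k))) ` elts (vsucc j)) | f. F j f}"
    have sub: "?Z \<subseteq> g ` {S. S \<subseteq> elts i \<and> finite S}"
    proof
      fix z assume "z \<in> ?Z"
      then obtain f where f: "F j f" "z = vset ((\<lambda>k. delayed_code m k (\<sigma> (f k))) ` elts (vsucc j))"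
        by blast
      obtain S where S: "finite S" "S \<subseteq> C" "\<And>l. ord_le l j \<Longrightarrow> f l = next_in S l"
        using f(1) unfolding F_def by blast
      have "z = g S"
        unfolding f(2) g_def using S(3)
        by (intro arg_cong[of _ _ vset] image_cong refl) (simp add: mem_vsucc_iff del: elts_vsucc)
      then show "z \<in> g ` {S. S \<subseteq> elts i \<and> finite S}" using S C(1) by blast
    qed
    have "|?Z| \<le>o |elts i|"
      using ordLeq_transitive[OF ordLeq_transitive[OF card_of_mono1[OF sub] card_of_image]]
        card_of_finite_subsets[OF inf] by blast
    \<comment> \<open>Finite subsets of \<open>i\<close> correspond to elements of its power set, so
      replacement makes the class of codes a set.\<close>
    moreover have "?Z \<subseteq> (\<lambda>y. g (elts y)) ` {y. elts y \<subseteq> elts i}"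
    proof
      fix z assume "z \<in> ?Z"
      then obtain S where S: "S \<subseteq> elts i" "z = g S" using sub by blast
      have "elts (vset S) = S" using S(1) by (intro elts_vset small_subset[OF small_elts])
      then show "z \<in> (\<lambda>y. g (elts y)) ` {y. elts y \<subseteq> elts i}"
        using S by (intro image_eqI[of _ _ "vset S"]) simp_all
    qed
    then have "small ?Z" by (rule small_subset[OF small_image[OF small_Pow[OF small_elts]]])
    ultimately show "\<exists>Z. elts Z = ?Z \<and> size_less Z \<kappa>"
      by (intro exI[of _ "vset ?Z"] conjI sz) simp_all
  next
    fix f
    show "\<exists>j\<in>elts i. \<not> F j f"
    proof (rule ccontr)
      assume "\<not> ?thesis"
      then have f: "F j f" if "j \<in> elts i" for j using that by blast
      \<comment> \<open>Evaluating \<open>f\<close> just past the previous value gives a strictly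
        increasing sequence of its values.\<close>
      define s where "s = rec_nat (f vempty) (\<lambda>_ x. f (vsucc x))"
      have s0: "s 0 = f vempty" and sS: "s (Suc n) = f (vsucc (s n))" for n by (simp_all add: s_def)
      have zi: "vempty \<in> elts i" using Limit_vempty_mem[OF i(1,2)] .
      have si: "s n \<in> elts i" for n
        by (induction n) (use FC f C(1) zi Limit_vsucc_mem[OF i(1)] in \<open>auto simp: s0 sS\<close>)
      have Os: "Ord (s n)" for n using si Ord_mem[OF Oi] by blast
      have step: "s n \<in> elts (s (Suc n))" for n
        using FC[OF f[OF Limit_vsucc_mem[OF i(1) si]], of n] vsucc_le_iff[OF Os[of "Suc n"]]
        by (simp add: sS)
      have mono: "s a \<in> elts (s b)" if "a < b" for a b
        using that by (induction b) (use step Ord_trans[OF Os] in \<open>auto simp: less_Suc_eq\<close>)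
      \<comment> \<open>As \<open>i\<close> is not \<omega>-cofinal, some \<open>b < i\<close>
        bounds the sequence; the finite set behind \<open>f\<close> up to \<open>b\<close> would
        contain all its terms.\<close>
      have "\<exists>b. Ord b \<and> (\<forall>n. ord_le (s n) b) \<and> \<not> ord_le i b"
      proof (rule ccontr)
        assume "\<not> ?thesis"
        then have "omega_cofinal i"
          unfolding omega_cofinal_def using Oi Os mono si by (intro conjI exI[of _ s]) (auto simp: ord_le_def)
        then show False using i(3) by blast
      qed
      then obtain b where b: "Ord b" "\<And>n. ord_le (s n) b" "b \<in> elts i"
        using Ord_not_le_iff[OF Oi] by blast
      obtain S where S: "finite S" "S \<subseteq> C" "\<exists>v\<in>S. ord_le b v" "\<And>l. ord_le l b \<Longrightarrow> f l = next_in S l"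
        using f[OF b(3)] unfolding F_def by blast
      have fS: "f l \<in> S" if "ord_le l b" for l using S(4)[OF that] nx(1)[OF S(2) that S(3)] by simp
      have "s n \<in> S" for n
      proof (cases n)
        case 0
        then show ?thesis using fS[OF vempty_le[OF b(1)]] s0 by simp
      next
        case (Suc n')
        have "s n' \<in> elts b" using mem_ord_le_trans[OF b(1) step b(2)] .
        then show ?thesis using fS vsucc_le_iff[OF b(1)] Suc sS by simp
      qed
      moreover have "inj s"
        by (intro injI) (metis mono linorder_neqE_nat mem_not_refl)
      ultimately show False
        using S(1) by (meson finite_subset image_subsetI infinite_iff_countable_subset)
    qed
  qed
qed

section \<open>Faithful levels and extensible ordinals\<close>

text \<open>A limit above \<kappa> would be extensible, so \<open>l = \<kappa>\<close> or
  \<open>|l| < \<kappa>\<close>. If \<open>l = \<kappa>\<close> or \<open>l\<close> is strongly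
  inaccessible, the tree property fails. In all other cases a cofinal subset embeds into the power
  set of some \<open>m < l\<close>.\<close>

lemma element_of_not_extensible:
  assumes \<kappa>: "regular_or_infty \<kappa>" and l: "Limit (l :: 'v::zfc)" and ext: "\<not> extensible \<kappa> l"
  shows "\<exists>a\<in>elts (nu \<kappa> l). elts (conn l (vsucc vempty) a) \<noteq> {} \<and> (\<forall>b. \<not> step_rel l a b)"
proof -
  have Ol: "Ord l" using l by (simp add: Limit_def)
  have ne: "l \<noteq> vempty" "\<not> omega_cofinal l" "\<not> weakly_compact l"
    using ext by (auto simp: extensible_def)
  have inf: "infinite (elts l)" using infinite_Limit l ne by blast
  have tree: ?thesis
    if reg: "infinite_regular l" and tp: "\<not> tree_property l"
      and size: "\<And>x :: 'v. |elts x| <o |elts l| \<Longrightarrow> size_less x \<kappa>"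
  proof -
    obtain D d where D: "tidy_tree l D d" "\<And>j. j \<in> elts l \<Longrightarrow> |elts (D j)| <o |elts l|"
      "\<nexists>x. full_branch l D d x"
      using reg tp unfolding tree_property_def by blast
    show ?thesis using D by (intro element_from_tree[OF reg] size)
  qed
  have below: "size_less l \<kappa> \<or> \<kappa> = Card l"
  proof (cases \<kappa>)
    case (Card c)
    then have c: "infinite_regular c" using \<kappa> by simp
    then have Oc: "Ord c" by (simp add: infinite_regular_def Cardinal_def)
    have "c \<notin> elts l" using Limit_omega_add_le[OF l] ext l Card by (auto simp: extensible_def)
    then have "l \<in> elts c \<or> l = c" using Ord_linear[OF Ol Oc] by blast
    then show ?thesis using c Card by (auto simp: infinite_regular_def Cardinal_def)
  qed simp
  show ?thesis
  proof (cases "\<kappa> = Card l")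
    case True
    then have "infinite_regular l" "\<not> tree_property l" using \<kappa> ext by (auto simp: extensible_def)
    then show ?thesis using True by (intro tree) simp_all
  next
    case False
    then have size: "size_less l \<kappa>" using below by simp
    show ?thesis
    proof (cases "infinite_regular l \<and> strongly_inaccessible l")
      case True
      have "\<not> tree_property l" using True ne(3) by (simp add: weakly_compact_def)
      then show ?thesis
        using True size_less_mono[OF ordLess_imp_ordLeq size] by (intro tree) blast+
    next
      case False
      have "\<exists>C m (\<sigma> :: 'v \<Rightarrow> 'v set). C \<subseteq> elts l \<and> (\<forall>j\<in>elts l. \<exists>v\<in>C. ord_le j v) \<and> m \<in> elts l \<and>
          inj_on \<sigma> C \<and> (\<forall>v\<in>C. \<sigma> v \<subseteq> elts m)"
      proof (cases "infinite_regular l")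
        case True
        \<comment> \<open>A power set not smaller than \<open>l\<close> receives an injection from
          \<open>l\<close>, so \<open>C\<close> is \<open>l\<close> itself; the injection
          \<open>g\<close> moves the base set into some \<open>m < l\<close>.\<close>
        then obtain x :: 'v where x: "|elts x| <o |elts l|" "\<not> |elts (vpow x)| <o |elts l|"
          using False by (auto simp: strongly_inaccessible_def)
        then have "|elts l| \<le>o |elts (vpow x)|"
          using not_ordLess_iff_ordLeq card_of_Well_order by blast
        then obtain f where f: "inj_on f (elts l)" "f ` elts l \<subseteq> elts (vpow x)"
          using card_of_ordLeq[of "elts l" "elts (vpow x)"] by blast
        obtain m where m: "m \<in> elts l" "|elts x| \<le>o |elts m|" using card_le_elts_mem[OF Ol x(1)] by blast
        then obtain g where g: "inj_on g (elts x)" "g ` elts x \<subseteq> elts m"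
          using card_of_ordLeq[of "elts x" "elts m"] by blast
        have sub: "elts (f v) \<subseteq> elts x" if "v \<in> elts l" for v using f(2) that by auto
        have "inj_on (\<lambda>v. g ` elts (f v)) (elts l)"
        proof (rule inj_onI)
          fix u v assume uv: "u \<in> elts l" "v \<in> elts l" "g ` elts (f u) = g ` elts (f v)"
          then have "elts (f u) = elts (f v)" using inj_on_image_eq_iff[OF g(1) sub sub] by blast
          then have "f u = f v" by (rule zfc_extensionality)
          then show "u = v" using f(1) uv by (meson inj_onD)
        qed
        moreover have "\<forall>v\<in>elts l. g ` elts (f v) \<subseteq> elts m" using sub g(2) by blast
        moreover have "\<forall>j\<in>elts l. \<exists>v\<in>elts l. ord_le j v" using ord_le_refl by blast
        ultimately show ?thesis using m(1) by blast
      next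
        case False
        obtain C m where C: "C \<subseteq> elts l" "m \<in> elts l" "\<forall>j\<in>elts l. \<exists>v\<in>C. ord_le j v" "|C| \<le>o |elts m|"
          using not_regular_cofinal[OF l ne(1) False] by blast
        obtain g where g: "inj_on g C" "g ` C \<subseteq> elts m" using card_of_ordLeq[of C "elts m"] C(4) by blast
        \<comment> \<open>A cofinal set no larger than \<open>m\<close> embeds by
          singletons.\<close>
        have "inj_on (\<lambda>v. {g v}) C" using g(1) by (auto simp: inj_on_def)
        moreover have "\<forall>v\<in>C. {g v} \<subseteq> elts m" using g(2) by blast
        ultimately show ?thesis using C(1-3) by blast
      qed
      then obtain C m and \<sigma> :: "'v \<Rightarrow> 'v set" where C: "C \<subseteq> elts l" "\<And>j. j \<in> elts l \<Longrightarrow> \<exists>v\<in>C. ord_le j v"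
        "m \<in> elts l" "inj_on \<sigma> C" "\<And>v. v \<in> C \<Longrightarrow> \<sigma> v \<subseteq> elts m" by blast
      show ?thesis by (rule element_from_cofinal_set[OF l ne(1,2) C size])
    qed
  qed
qed

section \<open>From limit levels to all levels\<close>

lemma size_less_single: "regular_or_infty \<kappa> \<Longrightarrow> size_less (vset {x :: 'v::zfc}) \<kappa>"
proof (cases \<kappa>)
  case (Card c)
  assume "regular_or_infty \<kappa>"
  then have "infinite (elts c)" using Card by (simp add: infinite_regular_def)
  then have "|{x}| <o |elts c|"
    by (intro finite_ordLess_infinite card_of_Well_order) (simp_all add: Field_card_of)
  then show ?thesis using Card by simp
qed simp

text \<open>On level \<open>l\<close>, an element without transitions has the empty set as
  approximation of index 1, while its component there is nonempty. Passing to singletons moves a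
  disagreement up by one level and one index.\<close>

lemma not_faithful_not_extensible:
  fixes l :: "'v::zfc"
  assumes \<kappa>: "regular_or_infty \<kappa>" and l: "Limit l" and ext: "\<not> extensible \<kappa> l" and i: "Ord i"
  shows "ord_le (ord_add l (ord_of_nat n)) i \<Longrightarrow>
    \<not> faithful \<kappa> i (ord_add l (ord_of_nat n)) (ord_of_nat (Suc n))"
proof (induction n)
  case 0
  obtain a where a: "a \<in> elts (nu \<kappa> l)" "elts (conn l (vsucc vempty) a) \<noteq> {}" "\<And>b. \<not> step_rel l a b"
    using element_of_not_extensible[OF \<kappa> l ext] by blast
  have "elts (approx (level_system i) (vsucc vempty) (l, a)) = {}"
    using approx_level_vsucc[of l i vempty a] 0 a(3) by (simp add: ord_add_empty)
  then have "approx (level_system i) (vsucc vempty) (l, a) \<noteq> conn l (vsucc vempty) a"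
    using a(2) by metis
  then show ?case using a(1) unfolding faithful_def by (auto simp: ord_add_empty)
next
  case (Suc n)
  let ?k = "ord_add l (ord_of_nat n)"
  have Ok: "Ord ?k" using Ord_limit_add[OF l] .
  have si: "ord_le (vsucc ?k) i" using Suc.prems by (simp add: ord_add_vsucc)
  have ki: "ord_le ?k i" using ord_le_trans[OF i _ si] by (simp add: ord_le_def)
  obtain a where a: "a \<in> elts (nu \<kappa> ?k)"
    "approx (level_system i) (ord_of_nat (Suc n)) (?k, a) \<noteq> conn ?k (ord_of_nat (Suc n)) a"
    using Suc.IH[OF ki] unfolding faithful_def by blast
  let ?m = "ord_of_nat (Suc n) :: 'v"
  have s: "vset {a} \<in> elts (nu \<kappa> (vsucc ?k))"
    using a(1) size_less_single[OF \<kappa>] by (simp add: elts_nu_vsucc)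
  have "elts (approx (level_system i) (vsucc ?m) (vsucc ?k, vset {a})) =
      {approx (level_system i) ?m (?k, a)}"
    using approx_level_vsucc[OF si, of ?m "vset {a}"] step_rel_vsucc[OF Ok s]
    by (simp del: ord_of_nat.simps)
  moreover have "elts (conn (vsucc ?k) (vsucc ?m) (vset {a})) = {conn ?k ?m a}"
    by (simp add: conn_succ)
  ultimately have "approx (level_system i) (vsucc ?m) (vsucc ?k, vset {a}) \<noteq>
      conn (vsucc ?k) (vsucc ?m) (vset {a})" using a(2) by (metis singleton_inject)
  then show ?case using s unfolding faithful_def by (auto simp: ord_add_vsucc)
qed

text \<open>Approximation and projection at index \<open>m\<close> are the images under
  \<open>conn j m\<close> of those at index \<open>j\<close>.\<close>

lemma faithful_le:
  assumes "Ord i" "ord_le j i" "ord_le (m :: 'v::zfc) j" "faithful \<kappa> i i j"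
  shows "faithful \<kappa> i i m"
  unfolding faithful_def
proof
  fix a assume a: "a \<in> elts (nu \<kappa> i)"
  have "approx (level_system i) m (i, a) = conn j m (approx (level_system i) j (i, a))"
    by (rule approx_in_nu(2)[OF ord_le_Ord[OF assms(1,2)] assms(3), symmetric])
  also have "\<dots> = conn i m a"
    using assms(4) a conn_conn[OF assms(1) a assms(2,3)] by (simp add: faithful_def)
  finally show "approx (level_system i) m (i, a) = conn i m a" .
qed

lemma ord_le_ord_of_nat:
  "ord_le j (ord_of_nat n :: 'v::zfc) \<Longrightarrow> \<exists>m\<le>n. j = ord_of_nat m"
proof (induction n)
  case 0
  then show ?case by (simp add: ord_le_def)
next
  case (Suc n)
  then have "j = ord_of_nat (Suc n) \<or> ord_le j (ord_of_nat n)" by (auto simp: ord_le_def)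
  then show ?case using Suc.IH le_SucI by blast
qed

theorem theorem8p12:
  fixes \<kappa> :: "'v::zfc bound" and i j :: 'v
  assumes "regular_or_infty \<kappa>"
    and "Ord i" and "Ord j" and "ord_le j i"
  shows "(\<forall>a \<in> elts (nu \<kappa> i). approx (level_system i) j (i, a) = conn i j a) \<longleftrightarrow>
         (ord_le j (ord_of_nat (FP i)) \<or> extensible \<kappa> (LP i))"
proof -
  obtain l n where l: "Limit l" and i: "i = ord_add l (ord_of_nat n)"
    using LP_FP_exist[OF assms(2)] by blast
  have LF: "LP i = l" "FP i = n" using LP_ord_add[OF l] FP_ord_add[OF l] i by simp_all
  have "faithful \<kappa> i i j \<longleftrightarrow> ord_le j (ord_of_nat n) \<or> extensible \<kappa> l"
  proof
    assume f: "faithful \<kappa> i i j"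
    show "ord_le j (ord_of_nat n) \<or> extensible \<kappa> l"
    proof (rule ccontr)
      assume c: "\<not> ?thesis"
      \<comment> \<open>Agreement at \<open>j > n\<close> descends to index \<open>n + 1\<close>,
        where it is refuted.\<close>
      then have "ord_of_nat n \<in> elts j" using Ord_not_le_iff[OF assms(3)] by auto
      then have "ord_le (ord_of_nat (Suc n)) j" using vsucc_le_iff[OF assms(3)] by simp
      then have "faithful \<kappa> i i (ord_of_nat (Suc n))" using faithful_le[OF assms(2,4) _ f] by blast
      then show False
        using not_faithful_not_extensible[OF assms(1) l _ assms(2), of n] c i by simp
    qed
  next
    assume "ord_le j (ord_of_nat n) \<or> extensible \<kappa> l"
    then show "faithful \<kappa> i i j"
    proof
      assume "ord_le j (ord_of_nat n)"
      then obtain m where "m \<le> n" "j = ord_of_nat m" using ord_le_ord_of_nat by blast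
      then show ?thesis using faithful_FP[OF l assms(2), of n m] i by simp
    next
      assume "extensible \<kappa> l"
      then show ?thesis
        using faithful_branching_add[OF l assms(2) extensible_branching[OF assms(1) l], of n j]
          assms(4) i by simp
    qed
  qed
  then show ?thesis unfolding LF by (simp add: faithful_def)
qed

end
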